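(* There is an algorithm that, given a graph $G$ on $n$ vertices, a rooted branch decomposition $(T,\delta)$ of $G$ of module-width $w$, and an integer $k$, decides whether $G$ has a fall coloring with $k$ colors in time $n^{2^{\mathcal{O}(w)}}$.
   Context: All graphs are finite and simple. A fall coloring of $G$ with $k$ colors is a partition $(C_1,\ldots,C_k)$ of $V(G)$ into independent sets such that every vertex $v$, say $v\in C_i$, has at least one neighbor in $C_j$ for every $j\in\{1,\ldots,k\}\setminus\{i\}$ (equivalently, a partition of $V(G)$ into $k$ independent dominating sets). The \textsc{Fall Coloring} problem asks, given $G$ and $k$, whether $G$ has a fall coloring with $k$ colors. A rooted branch decomposition of $G$ is a pair $(T,\delta)$ where $T$ is a rooted tree of maximum degree at most $3$ and $\delta$ is a bijection from $V(G)$ to the set of leaves of $T$. For a node $t$ of $T$, let $T_t$ be the subtree of $T$ rooted at $t$, $V_t=\{v\in V(G): \delta(v)\text{ is a leaf of }T_t\}$ and $\overline{V_t}=V(G)\setminus V_t$. Let $\sim_t$ be the equivalence relation on $V_t$ with $u\sim_t v$ iff $N_G(u)\cap\overline{V_t}=N_G(v)\cap\overline{V_t}$. The module-width of $(T,\delta)$ is $\max_{t\in V(T)}|V_t/{\sim_t}|$.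
   Formalization: The time bound proved is O(|V(T)| + n^{2^{O(w)}}): T may have nodes with one child, so its size is not bounded in n and w, and the linear time for reading T is added; if |V(T)| is polynomial in n this is n^{2^{O(w)}}. *)

theory Defs
  imports Complex_Main "HOL-Library.Landau_Symbols" "HOL-Library.Disjoint_Sets"
begin

section \<open>Finite simple graphs and fall colorings\<close>

record 'v graph =
  verts :: "'v set"
  edges :: "'v set set"

definition simple_graph :: "'v graph \<Rightarrow> bool" where
  "simple_graph G \<longleftrightarrow> finite (verts G) \<and>
     (\<forall>e\<in>edges G. e \<subseteq> verts G \<and> card e = 2)"

definition nbhd :: "'v graph \<Rightarrow> 'v \<Rightarrow> 'v set" where
  "nbhd G u = {v \<in> verts G. {u, v} \<in> edges G}"

definition independent :: "'v graph \<Rightarrow> 'v set \<Rightarrow> bool" where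
  "independent G S \<longleftrightarrow> S \<subseteq> verts G \<and> (\<forall>u\<in>S. \<forall>v\<in>S. {u, v} \<notin> edges G)"

definition fall_coloring :: "'v graph \<Rightarrow> nat \<Rightarrow> (nat \<Rightarrow> 'v set) \<Rightarrow> bool" where
  "fall_coloring G k C \<longleftrightarrow>
     (\<Union>i\<in>{1..k}. C i) = verts G \<and>
     disjoint_family_on C {1..k} \<and>
     (\<forall>i\<in>{1..k}. C i \<noteq> {}) \<and>
     (\<forall>i\<in>{1..k}. independent G (C i)) \<and>
     (\<forall>i\<in>{1..k}. \<forall>v\<in>C i. \<forall>j\<in>{1..k} - {i}. nbhd G v \<inter> C j \<noteq> {})"

definition has_fall_coloring :: "'v graph \<Rightarrow> nat \<Rightarrow> bool" where
  "has_fall_coloring G k \<longleftrightarrow> (\<exists>C. fall_coloring G k C)"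


section \<open>Rooted branch decompositions and module-width\<close>

text \<open>A rooted tree is given by its parent function, with the root as its own parent.
  Since every node reaches the root by iterating the parent function, the only cycle of
  that function is the loop at the root.\<close>

record 'a rtree =
  nodes :: "'a set"
  root :: 'a
  parent :: "'a \<Rightarrow> 'a"

definition rooted_tree :: "'a rtree \<Rightarrow> bool" where
  "rooted_tree T \<longleftrightarrow> finite (nodes T) \<and> root T \<in> nodes T \<and>
     parent T (root T) = root T \<and>
     (\<forall>t\<in>nodes T. parent T t \<in> nodes T) \<and>
     (\<forall>t\<in>nodes T. \<exists>i. (parent T ^^ i) t = root T)"

definition children :: "'a rtree \<Rightarrow> 'a \<Rightarrow> 'a set" where
  "children T t = {s \<in> nodes T. s \<noteq> root T \<and> parent T s = t}"

definition tree_degree :: "'a rtree \<Rightarrow> 'a \<Rightarrow> nat" where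
  "tree_degree T t = card (children T t) + (if t = root T then 0 else 1)"

definition leaves :: "'a rtree \<Rightarrow> 'a set" where
  "leaves T = {t \<in> nodes T. children T t = {}}"

definition subtree_nodes :: "'a rtree \<Rightarrow> 'a \<Rightarrow> 'a set" where
  "subtree_nodes T t = {s \<in> nodes T. \<exists>i. (parent T ^^ i) s = t}"

definition rooted_branch_decomposition :: "'v graph \<Rightarrow> 'a rtree \<Rightarrow> ('v \<Rightarrow> 'a) \<Rightarrow> bool" where
  "rooted_branch_decomposition G T \<delta> \<longleftrightarrow>
     rooted_tree T \<and> (\<forall>t\<in>nodes T. tree_degree T t \<le> 3) \<and>
     bij_betw \<delta> (verts G) (leaves T)"

definition verts_below :: "'v graph \<Rightarrow> 'a rtree \<Rightarrow> ('v \<Rightarrow> 'a) \<Rightarrow> 'a \<Rightarrow> 'v set" where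
  "verts_below G T \<delta> t = {v \<in> verts G. \<delta> v \<in> subtree_nodes T t}"

definition twin_rel :: "'v graph \<Rightarrow> 'v set \<Rightarrow> ('v \<times> 'v) set" where
  "twin_rel G S = {(u, v). u \<in> S \<and> v \<in> S \<and>
     nbhd G u \<inter> (verts G - S) = nbhd G v \<inter> (verts G - S)}"

definition module_width :: "'v graph \<Rightarrow> 'a rtree \<Rightarrow> ('v \<Rightarrow> 'a) \<Rightarrow> nat" where
  "module_width G T \<delta> =
     Max ((\<lambda>t. card (verts_below G T \<delta> t // twin_rel G (verts_below G T \<delta> t))) ` nodes T)"


section \<open>Algorithms\<close>

text \<open>Algorithms are programs of a unit-cost random access machine with structured control
  flow. A program uses finitely many named registers and a memory with indirect addressing;
  all cells hold natural numbers. The only arithmetic operations are addition and truncated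
  subtraction: with unit-cost multiplication the machine would no longer be polynomially
  equivalent to Turing machines.\<close>

type_synonym reg = string

datatype com =
    Const reg nat
  | Add reg reg reg
  | Sub reg reg reg
  | Load reg reg
  | Store reg reg
  | Seq com com
  | If reg com com
  | While reg com

type_synonym state = "(reg \<Rightarrow> nat) \<times> (nat \<Rightarrow> nat)"

text \<open>\<open>exec c s t s'\<close>: started in state \<open>s\<close>, the program \<open>c\<close> halts in state \<open>s'\<close> after
  exactly \<open>t\<close> steps. A test of \<open>If\<close> or \<open>While\<close> costs one step and succeeds iff the register
  is nonzero.\<close>

inductive exec :: "com \<Rightarrow> state \<Rightarrow> nat \<Rightarrow> state \<Rightarrow> bool" where
  Const: "exec (Const x a) (r, m) 1 (r(x := a), m)"
| Add: "exec (Add x y z) (r, m) 1 (r(x := r y + r z), m)"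
| Sub: "exec (Sub x y z) (r, m) 1 (r(x := r y - r z), m)"
| Load: "exec (Load x y) (r, m) 1 (r(x := m (r y)), m)"
| Store: "exec (Store x y) (r, m) 1 (r, m(r x := r y))"
| Seq: "exec c1 s1 t1 s2 \<Longrightarrow> exec c2 s2 t2 s3 \<Longrightarrow> exec (Seq c1 c2) s1 (t1 + t2) s3"
| IfTrue: "fst s x \<noteq> 0 \<Longrightarrow> exec c1 s t s' \<Longrightarrow> exec (If x c1 c2) s (Suc t) s'"
| IfFalse: "fst s x = 0 \<Longrightarrow> exec c2 s t s' \<Longrightarrow> exec (If x c1 c2) s (Suc t) s'"
| WhileFalse: "fst s x = 0 \<Longrightarrow> exec (While x c) s 1 s"
| WhileTrue: "fst s1 x \<noteq> 0 \<Longrightarrow> exec c s1 t1 s2 \<Longrightarrow> exec (While x c) s2 t2 s3 \<Longrightarrow>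
    exec (While x c) s1 (Suc (t1 + t2)) s3"

inductive_cases ConstE: "exec (Const x a) s t s'"
inductive_cases AddE: "exec (Add x y z) s t s'"
inductive_cases SubE: "exec (Sub x y z) s t s'"
inductive_cases LoadE: "exec (Load x y) s t s'"
inductive_cases StoreE: "exec (Store x y) s t s'"
inductive_cases SeqE: "exec (Seq c1 c2) s t s'"
inductive_cases IfE: "exec (If x c1 c2) s t s'"
inductive_cases WhileE: "exec (While x c) s t s'"

lemma exec_deterministic:
  "exec c s t s' \<Longrightarrow> exec c s u s'' \<Longrightarrow> u = t \<and> s'' = s'"
proof (induction arbitrary: u s'' rule: exec.induct)
  case (Seq c1 s1 t1 s2 c2 t2 s3)
  from Seq.prems show ?case by (rule SeqE) (use Seq.IH in blast)
next
  case (IfTrue s x c1 t s' c2)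
  from IfTrue.prems show ?case by (rule IfE) (use IfTrue.hyps(1) IfTrue.IH in auto)
next
  case (IfFalse s x c2 t s' c1)
  from IfFalse.prems show ?case by (rule IfE) (use IfFalse.hyps(1) IfFalse.IH in auto)
next
  case (WhileFalse s x c)
  from WhileFalse.prems show ?case by (rule WhileE) (use WhileFalse.hyps in simp_all)
next
  case (WhileTrue s1 x c t1 s2 t2 s3)
  from WhileTrue.prems show ?case by (rule WhileE) (use WhileTrue.hyps(1) in simp, use WhileTrue.IH in blast)
qed (auto elim: ConstE AddE SubE LoadE StoreE)

text \<open>The input consists of a graph with vertices \<open>0, \<dots>, n - 1\<close>, a tree with nodes
  \<open>0, \<dots>, N - 1\<close>, a leaf map, and a number \<open>k\<close>. The memory contains the adjacency matrix of
  the graph row by row, then the parent array, then the leaf map.\<close>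

definition input_mem :: "nat graph \<Rightarrow> nat rtree \<Rightarrow> (nat \<Rightarrow> nat) \<Rightarrow> nat \<Rightarrow> nat" where
  "input_mem G T \<delta> a = (let n = card (verts G); N = card (nodes T) in
     if a < n * n then (if {a div n, a mod n} \<in> edges G then 1 else 0)
     else if a < n * n + N then parent T (a - n * n)
     else if a < n * n + N + n then \<delta> (a - (n * n + N))
     else 0)"

definition input_state :: "nat graph \<Rightarrow> nat rtree \<Rightarrow> (nat \<Rightarrow> nat) \<Rightarrow> nat \<Rightarrow> state" where
  "input_state G T \<delta> k =
     ((\<lambda>_. 0)(''n'' := card (verts G), ''N'' := card (nodes T), ''root'' := root T, ''k'' := k),
      input_mem G T \<delta>)"

definition ram_output :: "state \<Rightarrow> nat" where
  "ram_output s = fst s ''out''"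

end

(* Process the decomposition tree bottom-up and describe a color class, restricted to the vertices
   below a node, by its type: the twin classes it meets, and the twin classes that contain a vertex
   it does not dominate yet. For w twin classes there are at most 4^w types, and a partial coloring
   matters only through the number of color classes of each type. Writing these numbers as the
   digits of one number in base n + 1 turns the combination of two partial colorings into a sum of
   k prescribed weights, so the reachable combinations are found by one pass over an array of size
   (n + 1)^(O(4^w)).

   The tree may have many more nodes than the graph has vertices. A state machine that climbs along
   every edge once reduces it, in linear time, to at most n - 1 merges of disjoint vertex sets, each
   of which is a union of at most three sets V_t and hence has at most 3w twin classes. *)

theory Submission
  imports Defs "HOL-Combinatorics.Permutations" "HOL-Library.Nat_Bijection"
begin


section \<open>A loop language on the machine\<close>

text \<open>Expressions are read relative to registers \<open>r\<close> and arrays \<open>h\<close>. Array 16 is the read-only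
  input; arrays 0 to 15 are interleaved in the memory above the input.\<close>

datatype exp =
    V reg
  | C nat
  | Plus exp exp
  | Minus exp exp
  | Rd nat exp
  | Cond exp exp exp
  | Sum reg exp exp

type_synonym arrays = "nat \<Rightarrow> nat \<Rightarrow> nat"

primrec eval :: "exp \<Rightarrow> (reg \<Rightarrow> nat) \<Rightarrow> arrays \<Rightarrow> nat" where
  "eval (V x) r h = r x"
| "eval (C a) r h = a"
| "eval (Plus a b) r h = eval a r h + eval b r h"
| "eval (Minus a b) r h = eval a r h - eval b r h"
| "eval (Rd j e) r h = h j (eval e r h)"
| "eval (Cond a b c) r h = (if eval a r h \<noteq> 0 then eval b r h else eval c r h)"
| "eval (Sum x b e) r h = (\<Sum>i<eval b r h. eval e (r(x := i)) h)"

primrec ecost :: "exp \<Rightarrow> (reg \<Rightarrow> nat) \<Rightarrow> arrays \<Rightarrow> nat" where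
  "ecost (V x) r h = 2"
| "ecost (C a) r h = 1"
| "ecost (Plus a b) r h = ecost a r h + ecost b r h + 1"
| "ecost (Minus a b) r h = ecost a r h + ecost b r h + 1"
| "ecost (Rd j e) r h = ecost e r h + 8"
| "ecost (Cond a b c) r h = ecost a r h + ecost b r h + ecost c r h + 1"
| "ecost (Sum x b e) r h = ecost b r h + (\<Sum>i<eval b r h. ecost e (r(x := i)) h + 4) + 7"

datatype stm =
    Asg reg exp
  | Sto nat exp exp
  | Sq stm stm (infixr \<open>;;\<close> 60)
  | IfS exp stm stm
  | For reg exp stm

type_synonym lstate = "(reg \<Rightarrow> nat) \<times> arrays"

primrec run :: "stm \<Rightarrow> lstate \<Rightarrow> lstate" where
  "run (Asg x e) \<sigma> = ((fst \<sigma>)(x := eval e (fst \<sigma>) (snd \<sigma>)), snd \<sigma>)"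
| "run (Sto j a e) \<sigma> = (fst \<sigma>, (snd \<sigma>)(j := (snd \<sigma> j)
     (eval a (fst \<sigma>) (snd \<sigma>) := eval e (fst \<sigma>) (snd \<sigma>))))"
| "run (s1 ;; s2) \<sigma> = run s2 (run s1 \<sigma>)"
| "run (IfS e s1 s2) \<sigma> = (if eval e (fst \<sigma>) (snd \<sigma>) \<noteq> 0 then run s1 \<sigma> else run s2 \<sigma>)"
| "run (For x b s) \<sigma> =
     (let \<tau> = foldl (\<lambda>\<tau> i. run s ((fst \<tau>)(x := i), snd \<tau>)) \<sigma> [0..<eval b (fst \<sigma>) (snd \<sigma>)]
      in ((fst \<tau>)(x := fst \<sigma> x), snd \<tau>))"

abbreviation iter :: "reg \<Rightarrow> stm \<Rightarrow> lstate \<Rightarrow> nat \<Rightarrow> lstate" where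
  "iter x s \<sigma> m \<equiv> foldl (\<lambda>\<tau> i. run s ((fst \<tau>)(x := i), snd \<tau>)) \<sigma> [0..<m]"

primrec scost :: "stm \<Rightarrow> lstate \<Rightarrow> nat" where
  "scost (Asg x e) \<sigma> = ecost e (fst \<sigma>) (snd \<sigma>) + 2"
| "scost (Sto j a e) \<sigma> = ecost a (fst \<sigma>) (snd \<sigma>) + ecost e (fst \<sigma>) (snd \<sigma>) + 8"
| "scost (s1 ;; s2) \<sigma> = scost s1 \<sigma> + scost s2 (run s1 \<sigma>)"
| "scost (IfS e s1 s2) \<sigma> = ecost e (fst \<sigma>) (snd \<sigma>) + 1 +
     (if eval e (fst \<sigma>) (snd \<sigma>) \<noteq> 0 then scost s1 \<sigma> else scost s2 \<sigma>)"
| "scost (For x b s) \<sigma> = ecost b (fst \<sigma>) (snd \<sigma>) + 4 +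
     (\<Sum>i<eval b (fst \<sigma>) (snd \<sigma>).
        scost s ((fst (iter x s \<sigma> i))(x := i), snd (iter x s \<sigma> i)) + 6)"


subsection \<open>Compilation\<close>

definition tmp :: "nat \<Rightarrow> reg" where
  "tmp i = replicate (Suc i) CHR ''.''"

lemma tmp_eq_iff [simp]: "tmp i = tmp j \<longleftrightarrow> i = j"
  unfolding tmp_def by (metis length_replicate nat.inject)

definition usr :: "reg \<Rightarrow> bool" where
  "usr x \<longleftrightarrow> x \<noteq> [] \<and> hd x \<noteq> CHR ''.''"

lemma usr_tmp [simp]: "\<not> usr (tmp i)"
  by (simp add: usr_def tmp_def)

lemma usr_neq_tmp [simp]: "usr x \<Longrightarrow> x \<noteq> tmp i" "usr x \<Longrightarrow> tmp i \<noteq> x"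
  by auto

primrec wfe :: "exp \<Rightarrow> bool" where
  "wfe (V x) \<longleftrightarrow> usr x"
| "wfe (C a) \<longleftrightarrow> True"
| "wfe (Plus a b) \<longleftrightarrow> wfe a \<and> wfe b"
| "wfe (Minus a b) \<longleftrightarrow> wfe a \<and> wfe b"
| "wfe (Rd j e) \<longleftrightarrow> wfe e \<and> j \<le> 16"
| "wfe (Cond a b c) \<longleftrightarrow> wfe a \<and> wfe b \<and> wfe c"
| "wfe (Sum x b e) \<longleftrightarrow> usr x \<and> x \<noteq> ''B'' \<and> wfe b \<and> wfe e"

primrec wfs :: "stm \<Rightarrow> bool" where
  "wfs (Asg x e) \<longleftrightarrow> usr x \<and> x \<noteq> ''B'' \<and> wfe e"
| "wfs (Sto j a e) \<longleftrightarrow> j < 16 \<and> wfe a \<and> wfe e"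
| "wfs (s1 ;; s2) \<longleftrightarrow> wfs s1 \<and> wfs s2"
| "wfs (IfS e s1 s2) \<longleftrightarrow> wfe e \<and> wfs s1 \<and> wfs s2"
| "wfs (For x b s) \<longleftrightarrow> usr x \<and> x \<noteq> ''B'' \<and> wfe b \<and> wfs s"

fun seqs :: "com list \<Rightarrow> com" where
  "seqs [] = Const (tmp 0) 0"
| "seqs [c] = c"
| "seqs (c # cs) = Seq c (seqs cs)"

definition cell :: "nat \<Rightarrow> nat \<Rightarrow> nat \<Rightarrow> com list" where
  "cell d e j = [Add (tmp d) (tmp d) (tmp d), Add (tmp d) (tmp d) (tmp d),
     Add (tmp d) (tmp d) (tmp d), Add (tmp d) (tmp d) (tmp d),
     Add (tmp d) (tmp d) ''B'', Const (tmp e) j, Add (tmp d) (tmp d) (tmp e)]"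

primrec cexp :: "exp \<Rightarrow> nat \<Rightarrow> com" where
  "cexp (V x) d = seqs [Const (tmp d) 0, Add (tmp d) x (tmp d)]"
| "cexp (C a) d = Const (tmp d) a"
| "cexp (Plus a b) d = seqs [cexp a d, cexp b (Suc d), Add (tmp d) (tmp d) (tmp (Suc d))]"
| "cexp (Minus a b) d = seqs [cexp a d, cexp b (Suc d), Sub (tmp d) (tmp d) (tmp (Suc d))]"
| "cexp (Rd j e) d = (if j < 16 then seqs (cexp e d # cell d (Suc d) j @ [Load (tmp d) (tmp d)])
     else seqs [cexp e d, Sub (tmp (Suc d)) ''B'' (tmp d),
       If (tmp (Suc d)) (Load (tmp d) (tmp d)) (Const (tmp d) 0)])"
| "cexp (Cond a b c) d = seqs [cexp a d, If (tmp d) (cexp b d) (cexp c d)]"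
| "cexp (Sum x b e) d = seqs [cexp b d,
     Const (tmp (d + 1)) 0, Add (tmp (d + 2)) x (tmp (d + 1)), Const x 0, Const (tmp (d + 3)) 1,
     While (tmp d) (seqs [cexp e (d + 4), Add (tmp (d + 1)) (tmp (d + 1)) (tmp (d + 4)),
       Add x x (tmp (d + 3)), Sub (tmp d) (tmp d) (tmp (d + 3))]),
     Add x (tmp (d + 2)) (tmp d), Add (tmp d) (tmp (d + 1)) (tmp d)]"

primrec cstm :: "stm \<Rightarrow> nat \<Rightarrow> com" where
  "cstm (Asg x e) d = seqs [cexp e d, Const (tmp (Suc d)) 0, Add x (tmp d) (tmp (Suc d))]"
| "cstm (Sto j a e) d = seqs (cexp a d # cexp e (Suc d) # cell d (d + 2) j @
     [Store (tmp d) (tmp (Suc d))])"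
| "cstm (s1 ;; s2) d = seqs [cstm s1 d, cstm s2 d]"
| "cstm (IfS e s1 s2) d = seqs [cexp e d, If (tmp d) (cstm s1 d) (cstm s2 d)]"
| "cstm (For x b s) d = seqs [cexp b d, Const (tmp (d + 1)) 0, Add (tmp (d + 2)) x (tmp (d + 1)),
     While (tmp d) (seqs [Const (tmp (d + 3)) 0, Add x (tmp (d + 1)) (tmp (d + 3)),
       cstm s (d + 3), Const (tmp (d + 3)) 1, Add (tmp (d + 1)) (tmp (d + 1)) (tmp (d + 3)),
       Sub (tmp d) (tmp d) (tmp (d + 3))]),
     Add x (tmp (d + 2)) (tmp d)]"

definition halts :: "com \<Rightarrow> state \<Rightarrow> nat \<Rightarrow> state \<Rightarrow> bool" where
  "halts c s b s' \<longleftrightarrow> (\<exists>t\<le>b. exec c s t s')"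

lemma halts_basic:
  "halts (Const x a) (r, m) 1 (r(x := a), m)"
  "halts (Add x y z) (r, m) 1 (r(x := r y + r z), m)"
  "halts (Sub x y z) (r, m) 1 (r(x := r y - r z), m)"
  "halts (Load x y) (r, m) 1 (r(x := m (r y)), m)"
  "halts (Store x y) (r, m) 1 (r, m(r x := r y))"
  unfolding halts_def by (meson exec.intros order_refl)+

lemma halts_Seq: "halts c1 s b1 s1 \<Longrightarrow> halts c2 s1 b2 s2 \<Longrightarrow> halts (Seq c1 c2) s (b1 + b2) s2"
  unfolding halts_def by (meson add_mono exec.Seq)

lemma halts_If:
  "fst s x \<noteq> 0 \<Longrightarrow> halts c1 s b s' \<Longrightarrow> halts (If x c1 c2) s (Suc b) s'"
  "fst s x = 0 \<Longrightarrow> halts c2 s b s' \<Longrightarrow> halts (If x c1 c2) s (Suc b) s'"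
  unfolding halts_def by (meson exec.IfTrue exec.IfFalse Suc_le_mono)+

lemma halts_While_False: "fst s x = 0 \<Longrightarrow> halts (While x c) s 1 s"
  unfolding halts_def by (meson exec.WhileFalse order_refl)

lemma halts_While_True: "fst s x \<noteq> 0 \<Longrightarrow> halts c s b1 s1 \<Longrightarrow> halts (While x c) s1 b2 s2 \<Longrightarrow>
    halts (While x c) s (Suc (b1 + b2)) s2"
  unfolding halts_def by (meson exec.WhileTrue Suc_le_mono add_mono)

lemma halts_mono: "halts c s b s' \<Longrightarrow> b \<le> b' \<Longrightarrow> halts c s b' s'"
  unfolding halts_def by (meson le_trans)

lemma halts_seqs_Cons:
  "halts c s b s1 \<Longrightarrow> halts (seqs (d # cs)) s1 b' s2 \<Longrightarrow> halts (seqs (c # d # cs)) s (b + b') s2"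
  by (simp add: halts_Seq)

lemma halts_seqs_basic:
  "halts (seqs (d # cs)) (r(x := a), m) b s \<Longrightarrow> halts (seqs (Const x a # d # cs)) (r, m) (Suc b) s"
  "halts (seqs (d # cs)) (r(x := r y + r z), m) b s \<Longrightarrow>
     halts (seqs (Add x y z # d # cs)) (r, m) (Suc b) s"
  "halts (seqs (d # cs)) (r(x := r y - r z), m) b s \<Longrightarrow>
     halts (seqs (Sub x y z # d # cs)) (r, m) (Suc b) s"
  using halts_seqs_Cons[OF halts_basic(1)] halts_seqs_Cons[OF halts_basic(2)]
    halts_seqs_Cons[OF halts_basic(3)] by simp_all

definition agree :: "(reg \<Rightarrow> nat) \<Rightarrow> (reg \<Rightarrow> nat) \<Rightarrow> bool" where
  "agree r r0 \<longleftrightarrow> (\<forall>x. usr x \<longrightarrow> r x = r0 x)"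

definition stores :: "nat \<Rightarrow> (nat \<Rightarrow> nat) \<Rightarrow> arrays \<Rightarrow> bool" where
  "stores B m h \<longleftrightarrow> (\<forall>i. \<forall>j<16. m (B + 16 * i + j) = h j i) \<and>
     (\<forall>i. h 16 i = (if i < B then m i else 0))"

lemma agreeD: "agree r r0 \<Longrightarrow> usr x \<Longrightarrow> r x = r0 x"
  by (simp add: agree_def)

lemma usr_B [simp]: "usr ''B''"
  by (simp add: usr_def)

lemma agree_tmp [simp]: "agree (r(tmp i := a)) r0 \<longleftrightarrow> agree r r0"
  by (auto simp: agree_def)

lemma agree_upd: "agree r r0 \<Longrightarrow> agree (r(x := a)) (r0(x := a))"
  by (auto simp: agree_def)

lemma agree_upd_same: "agree r (r0(x := b)) \<Longrightarrow> a = r0 x \<Longrightarrow> agree (r(x := a)) r0"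
  by (auto simp: agree_def)

lemma halts_cell:
  assumes "halts (seqs (c # cs)) (r(tmp d := r ''B'' + 16 * r (tmp d) + j, tmp e := j), m) b s"
    and "d \<noteq> e"
  shows "halts (seqs (cell d e j @ c # cs)) (r, m) (b + 7) s"
proof -
  have "halts (seqs (cell d e j @ c # cs)) (r, m) (Suc (Suc (Suc (Suc (Suc (Suc (Suc b))))))) s"
    unfolding cell_def append.simps
    apply (rule halts_seqs_basic)+
    using assms by (simp add: fun_upd_twist mult.commute[of 16] numeral_Bit0 distrib_left ac_simps)
  then show ?thesis
    by (rule halts_mono) simp
qed


lemma cexpI:
  assumes "halts c s b0 (r1, m)" "b0 \<le> b" "r1 (tmp d) = v" "agree r1 r0"
    "\<forall>j<d. r1 (tmp j) = r (tmp j)"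
  shows "\<exists>r'. halts c s b (r', m) \<and> r' (tmp d) = v \<and> agree r' r0 \<and> (\<forall>j<d. r' (tmp j) = r (tmp j))"
  using assms halts_mono by blast

lemma cexp_halts:
  assumes "wfe e" "agree r r0" "r0 ''B'' = B" "stores B m h"
  shows "\<exists>r'. halts (cexp e d) (r, m) (ecost e r0 h) (r', m) \<and> r' (tmp d) = eval e r0 h \<and>
    agree r' r0 \<and> (\<forall>j<d. r' (tmp j) = r (tmp j))"
  using assms
proof (induction e arbitrary: r r0 d)
  case (V x)
  have "halts (cexp (V x) d) (r, m) (1 + 1) (r(tmp d := r x), m)"
    using halts_Seq[OF halts_basic(1)[of "tmp d" 0 r m] halts_basic(2)[of "tmp d" x "tmp d"]] V
    by simp
  then show ?case by (rule cexpI) (use V agreeD[of r r0 x] in auto)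
next
  case (C a)
  then show ?case using halts_basic(1)[of "tmp d" a r m] by (auto intro!: exI[of _ "r(tmp d := a)"])
next
  case (Plus a b)
  from Plus.IH(1)[of r r0 d] Plus.prems obtain r1 where
    1: "halts (cexp a d) (r, m) (ecost a r0 h) (r1, m)" "r1 (tmp d) = eval a r0 h" "agree r1 r0"
      "\<forall>j<d. r1 (tmp j) = r (tmp j)" by auto
  from Plus.IH(2)[of r1 r0 "Suc d"] Plus.prems 1 obtain r2 where
    2: "halts (cexp b (Suc d)) (r1, m) (ecost b r0 h) (r2, m)" "r2 (tmp (Suc d)) = eval b r0 h"
      "agree r2 r0" "\<forall>j<Suc d. r2 (tmp j) = r1 (tmp j)" by auto
  have "halts (cexp (Plus a b) d) (r, m) (ecost a r0 h + (ecost b r0 h + 1))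
      (r2(tmp d := r2 (tmp d) + r2 (tmp (Suc d))), m)"
    unfolding cexp.simps seqs.simps by (intro halts_Seq[OF 1(1)] halts_Seq[OF 2(1)] halts_basic)
  then show ?case by (rule cexpI) (use 1 2 in auto)
next
  case (Minus a b)
  from Minus.IH(1)[of r r0 d] Minus.prems obtain r1 where
    1: "halts (cexp a d) (r, m) (ecost a r0 h) (r1, m)" "r1 (tmp d) = eval a r0 h" "agree r1 r0"
      "\<forall>j<d. r1 (tmp j) = r (tmp j)" by auto
  from Minus.IH(2)[of r1 r0 "Suc d"] Minus.prems 1 obtain r2 where
    2: "halts (cexp b (Suc d)) (r1, m) (ecost b r0 h) (r2, m)" "r2 (tmp (Suc d)) = eval b r0 h"
      "agree r2 r0" "\<forall>j<Suc d. r2 (tmp j) = r1 (tmp j)" by auto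
  have "halts (cexp (Minus a b) d) (r, m) (ecost a r0 h + (ecost b r0 h + 1))
      (r2(tmp d := r2 (tmp d) - r2 (tmp (Suc d))), m)"
    unfolding cexp.simps seqs.simps by (intro halts_Seq[OF 1(1)] halts_Seq[OF 2(1)] halts_basic)
  then show ?case by (rule cexpI) (use 1 2 in auto)
next
  case (Rd j e)
  from Rd.IH[of r r0 d] Rd.prems obtain r1 where
    1: "halts (cexp e d) (r, m) (ecost e r0 h) (r1, m)" "r1 (tmp d) = eval e r0 h" "agree r1 r0"
      "\<forall>j<d. r1 (tmp j) = r (tmp j)" by auto
  have B: "r1 ''B'' = B" using 1(3) Rd.prems by (simp add: agreeD)
  show ?case
  proof (cases "j < 16")
    case True
    let ?a = "r1 ''B'' + 16 * r1 (tmp d) + j"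
    let ?r = "r1(tmp d := ?a, tmp (Suc d) := j)"
    have m: "m ?a = h j (eval e r0 h)" using True Rd.prems(4) 1(2) B by (simp add: stores_def)
    have "halts (seqs [Load (tmp d) (tmp d)]) (?r, m) 1 (?r(tmp d := m (?r (tmp d))), m)"
      unfolding seqs.simps by (rule halts_basic)
    then have "halts (seqs (cell d (Suc d) j @ [Load (tmp d) (tmp d)])) (r1, m) (1 + 7) (?r(tmp d := m (?r (tmp d))), m)"
      by (rule halts_cell) simp
    from halts_Seq[OF 1(1) this]
    have "halts (cexp (Rd j e) d) (r, m) (ecost e r0 h + (1 + 7)) (?r(tmp d := m (?r (tmp d))), m)"
      using True by (simp add: cell_def)
    then show ?thesis by (rule cexpI) (use 1 m in auto)
  next
    case False
    with Rd.prems have j: "j = 16" by simp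
    let ?r1 = "r1(tmp (Suc d) := r1 ''B'' - r1 (tmp d))"
    let ?r = "?r1(tmp d := eval (Rd j e) r0 h)"
    have "halts (If (tmp (Suc d)) (Load (tmp d) (tmp d)) (Const (tmp d) 0)) (?r1, m) (Suc 1) (?r, m)"
    proof (cases "r1 (tmp d) < B")
      case True
      then show ?thesis using B Rd.prems(4) 1(2) halts_basic(4)[of "tmp d" "tmp d" ?r1 m] j
        by (intro halts_If(1)) (auto simp: stores_def)
    next
      case False
      then show ?thesis using B Rd.prems(4) 1(2) halts_basic(1)[of "tmp d" 0 ?r1 m] j
        by (intro halts_If(2)) (auto simp: stores_def)
    qed
    from halts_Seq[OF 1(1) halts_Seq[OF halts_basic(3) this]]
    have "halts (cexp (Rd j e) d) (r, m) (ecost (Rd j e) r0 h) (?r, m)"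
      using False by (auto elim!: halts_mono)
    then show ?thesis by (rule cexpI) (use 1 in auto)
  qed
next
  case (Cond a b c)
  from Cond.IH(1)[of r r0 d] Cond.prems obtain r1 where
    1: "halts (cexp a d) (r, m) (ecost a r0 h) (r1, m)" "r1 (tmp d) = eval a r0 h" "agree r1 r0"
      "\<forall>j<d. r1 (tmp j) = r (tmp j)" by auto
  show ?case
  proof (cases "eval a r0 h = 0")
    case False
    from Cond.IH(2)[of r1 r0 d] Cond.prems 1 obtain r2 where
      2: "halts (cexp b d) (r1, m) (ecost b r0 h) (r2, m)" "r2 (tmp d) = eval b r0 h" "agree r2 r0"
        "\<forall>j<d. r2 (tmp j) = r1 (tmp j)" by auto
    have "halts (cexp (Cond a b c) d) (r, m) (ecost a r0 h + Suc (ecost b r0 h)) (r2, m)"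
      unfolding cexp.simps seqs.simps
      by (intro halts_Seq[OF 1(1)] halts_If(1)[OF _ 2(1)]) (use 1(2) False in auto)
    then show ?thesis by (rule cexpI) (use 1 2 False in auto)
  next
    case True
    from Cond.IH(3)[of r1 r0 d] Cond.prems 1 obtain r2 where
      2: "halts (cexp c d) (r1, m) (ecost c r0 h) (r2, m)" "r2 (tmp d) = eval c r0 h" "agree r2 r0"
        "\<forall>j<d. r2 (tmp j) = r1 (tmp j)" by auto
    have "halts (cexp (Cond a b c) d) (r, m) (ecost a r0 h + Suc (ecost c r0 h)) (r2, m)"
      unfolding cexp.simps seqs.simps
      by (intro halts_Seq[OF 1(1)] halts_If(2)[OF _ 2(1)]) (use 1(2) True in auto)
    then show ?thesis by (rule cexpI) (use 1 2 True in auto)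
  qed
next
  case (Sum x b e)
  note [simp] = Sum.prems(3)
  from Sum.IH(1)[of r r0 d] Sum.prems obtain r1 where
    1: "halts (cexp b d) (r, m) (ecost b r0 h) (r1, m)" "r1 (tmp d) = eval b r0 h" "agree r1 r0"
      "\<forall>j<d. r1 (tmp j) = r (tmp j)" by auto
  have x: "usr x" "x \<noteq> ''B''" using Sum.prems by auto
  define v where "v = eval b r0 h"
  define R where "R i = r0(x := i)" for i
  let ?body = "seqs [cexp e (d + 4), Add (tmp (d + 1)) (tmp (d + 1)) (tmp (d + 4)),
       Add x x (tmp (d + 3)), Sub (tmp d) (tmp d) (tmp (d + 3))]"
  have loop: "\<exists>r'. halts (While (tmp d) ?body) (r2, m)
        ((\<Sum>i = v - j..<v. ecost e (R i) h + 4) + 1) (r', m) \<and>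
      r' (tmp d) = 0 \<and> r' (tmp (d + 1)) = r2 (tmp (d + 1)) + (\<Sum>i = v - j..<v. eval e (R i) h) \<and>
      agree r' (R v) \<and> (\<forall>i<d. r' (tmp i) = r2 (tmp i)) \<and> r' (tmp (d + 2)) = r2 (tmp (d + 2))"
    if "j \<le> v" "agree r2 (R (v - j))" "r2 (tmp d) = j" "r2 (tmp (d + 3)) = 1" for j r2
    using that
  proof (induction j arbitrary: r2)
    case 0
    then show ?case using halts_While_False[of "(r2, m)" "tmp d" ?body]
      by (intro exI[of _ r2]) auto
  next
    case (Suc j)
    have prems: "Suc j \<le> v" "agree r2 (R (v - Suc j))" "r2 (tmp d) = Suc j" "r2 (tmp (d + 3)) = 1"
      by fact+
    let ?r0 = "R (v - Suc j)"
    have "?r0 ''B'' = B" "wfe e" using Sum.prems x by (simp_all add: R_def)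
    then have "\<exists>r3. halts (cexp e (d + 4)) (r2, m) (ecost e ?r0 h) (r3, m) \<and>
        r3 (tmp (d + 4)) = eval e ?r0 h \<and> agree r3 ?r0 \<and> (\<forall>j<d + 4. r3 (tmp j) = r2 (tmp j))"
      using prems(2) Sum.prems(4) by (intro Sum.IH(2))
    then obtain r3 where
      3: "halts (cexp e (d + 4)) (r2, m) (ecost e ?r0 h) (r3, m)" "r3 (tmp (d + 4)) = eval e ?r0 h"
        "agree r3 ?r0" "\<forall>j<d + 4. r3 (tmp j) = r2 (tmp j)" by blast
    let ?r4 = "r3(tmp (d + 1) := r3 (tmp (d + 1)) + r3 (tmp (d + 4)))"
    let ?r5 = "?r4(x := ?r4 x + ?r4 (tmp (d + 3)))"
    let ?r6 = "?r5(tmp d := ?r5 (tmp d) - ?r5 (tmp (d + 3)))"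
    have body: "halts ?body (r2, m) (ecost e ?r0 h + (1 + (1 + 1))) (?r6, m)"
      unfolding seqs.simps by (intro halts_Seq[OF 3(1)] halts_Seq[OF halts_basic(2)] halts_basic)
    have vj: "Suc (v - Suc j) = v - j" using prems by simp
    have ag: "agree ?r6 (R (v - j))"
      using agree_upd[OF 3(3), of x "v - j"] 3 prems x vj by (simp add: agree_def R_def)
    obtain r' where
      IH: "halts (While (tmp d) ?body) (?r6, m)
        ((\<Sum>i = v - j..<v. ecost e (R i) h + 4) + 1) (r', m)"
        "r' (tmp d) = 0" "r' (tmp (d + 1)) = ?r6 (tmp (d + 1)) + (\<Sum>i = v - j..<v. eval e (R i) h)"
        "agree r' (R v)" "\<forall>i<d. r' (tmp i) = ?r6 (tmp i)" "r' (tmp (d + 2)) = ?r6 (tmp (d + 2))"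
    proof -
      have "j \<le> v" "?r6 (tmp d) = j" "?r6 (tmp (d + 3)) = 1" using prems x 3(4) by auto
      from Suc.IH[OF this(1) ag this(2,3)] show ?thesis using that by blast
    qed
    have sum: "(\<Sum>i = v - Suc j..<v. f i) = f (v - Suc j) + (\<Sum>i = v - j..<v. f i)" for f :: "nat \<Rightarrow> nat"
      using prems vj by (subst sum.atLeast_Suc_lessThan) auto
    have "halts (While (tmp d) ?body) (r2, m)
        ((\<Sum>i = v - Suc j..<v. ecost e (R i) h + 4) + 1) (r', m)"
      unfolding sum using halts_While_True[OF _ body IH(1)] prems
      by (auto elim!: halts_mono)
    then show ?case
      using IH 3(2,4) x prems by (intro exI[of _ r']) (simp add: sum)
  qed
  let ?r2 = "r1(tmp (d + 1) := 0)"
  let ?r3 = "?r2(tmp (d + 2) := ?r2 x + ?r2 (tmp (d + 1)))"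
  let ?r4 = "?r3(x := 0, tmp (d + 3) := 1)"
  have ag: "agree ?r4 (R 0)" using 1(3) x by (auto simp: agree_def R_def)
  obtain r5 where
    5: "halts (While (tmp d) ?body) (?r4, m)
        ((\<Sum>i<v. ecost e (R i) h + 4) + 1) (r5, m)"
      "r5 (tmp d) = 0" "r5 (tmp (d + 1)) = (\<Sum>i<v. eval e (R i) h)"
      "agree r5 (R v)" "\<forall>i<d. r5 (tmp i) = r (tmp i)" "r5 (tmp (d + 2)) = r0 x"
    using loop[of v ?r4] ag 1 x v_def agreeD[OF 1(3) x(1)] by (auto simp: atLeast0LessThan)
  let ?r6 = "r5(x := r5 (tmp (d + 2)) + r5 (tmp d))"
  let ?r7 = "?r6(tmp d := ?r6 (tmp (d + 1)) + ?r6 (tmp d))"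
  have "halts (cexp (Sum x b e) d) (r, m)
     (ecost b r0 h + (1 + (1 + (1 + (1 + ((\<Sum>i<v. ecost e (R i) h + 4) + 1 + (1 + 1))))))) (?r7, m)"
    unfolding seqs.simps cexp.simps
    by (intro halts_Seq[OF 1(1)] halts_Seq[OF halts_basic(1)] halts_Seq[OF halts_basic(2)] halts_Seq[OF 5(1)[unfolded seqs.simps]] halts_basic)
  then have "halts (cexp (Sum x b e) d) (r, m) (ecost (Sum x b e) r0 h) (?r7, m)"
    by (rule halts_mono) (simp add: v_def R_def)
  moreover have "agree ?r7 r0" using 5(2,6) x agree_upd_same[OF 5(4)[unfolded R_def]] by simp
  moreover note order_refl
  moreover have "?r7 (tmp d) = eval (Sum x b e) r0 h" "\<forall>j<d. ?r7 (tmp j) = r (tmp j)"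
    using 5 x by (auto simp: R_def v_def)
  ultimately show ?case by (intro cexpI)
qed

lemma stores_Sto:
  assumes "stores B m h" "j < 16"
  shows "stores B (m(B + 16 * a + j := x)) (h(j := (h j)(a := x)))"
proof -
  have "B + 16 * i + j' = B + 16 * a + j \<longleftrightarrow> i = a \<and> j' = j" if "j' < 16" for i j'
  proof -
    have "(16 * i + j') div 16 = i" "(16 * a + j) div 16 = a" using that assms(2) by simp_all
    then have "16 * i + j' = 16 * a + j \<longleftrightarrow> i = a \<and> j' = j" by fastforce
    then show ?thesis by simp
  qed
  then show ?thesis using assms by (auto simp: stores_def)
qed

lemma cstmI:
  assumes "halts c s b0 (r1, m1)" "b0 \<le> b" "agree r1 r0" "stores B m1 h"
    "\<forall>j<d. r1 (tmp j) = r (tmp j)" "r0 ''B'' = B"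
  shows "\<exists>r' m'. halts c s b (r', m') \<and> agree r' r0 \<and> stores B m' h \<and>
    (\<forall>j<d. r' (tmp j) = r (tmp j)) \<and> r0 ''B'' = B"
  using assms halts_mono by blast

lemma cstm_halts:
  assumes "wfs s" "agree r (fst \<sigma>)" "fst \<sigma> ''B'' = B" "stores B m (snd \<sigma>)"
  shows "\<exists>r' m'. halts (cstm s d) (r, m) (scost s \<sigma>) (r', m') \<and> agree r' (fst (run s \<sigma>)) \<and>
    stores B m' (snd (run s \<sigma>)) \<and> (\<forall>j<d. r' (tmp j) = r (tmp j)) \<and> fst (run s \<sigma>) ''B'' = B"
  using assms
proof (induction s arbitrary: r m \<sigma> d)
  case (Asg x e)
  from cexp_halts[of e r "fst \<sigma>" B m "snd \<sigma>" d] Asg obtain r1 where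
    1: "halts (cexp e d) (r, m) (ecost e (fst \<sigma>) (snd \<sigma>)) (r1, m)" "agree r1 (fst \<sigma>)"
      "r1 (tmp d) = eval e (fst \<sigma>) (snd \<sigma>)" "\<forall>j<d. r1 (tmp j) = r (tmp j)" by auto
  let ?r2 = "r1(tmp (Suc d) := 0)"
  let ?r3 = "?r2(x := ?r2 (tmp d) + ?r2 (tmp (Suc d)))"
  have "halts (cstm (Asg x e) d) (r, m) (ecost e (fst \<sigma>) (snd \<sigma>) + (1 + 1)) (?r3, m)"
    unfolding cstm.simps seqs.simps by (intro halts_Seq[OF 1(1)] halts_Seq[OF halts_basic(1)] halts_basic)
  moreover have "ecost e (fst \<sigma>) (snd \<sigma>) + (1 + 1) \<le> scost (Asg x e) \<sigma>"
    by simp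
  moreover have "agree ?r3 (fst (run (Asg x e) \<sigma>))"
    using 1 agree_upd[OF 1(2)] by (simp add: agree_def)
  moreover have "stores B m (snd (run (Asg x e) \<sigma>))" "\<forall>j<d. ?r3 (tmp j) = r (tmp j)"
      "fst (run (Asg x e) \<sigma>) ''B'' = B"
    using 1 Asg.prems by auto
  ultimately show ?case by (rule cstmI)
next
  case (Sto k a e)
  from cexp_halts[of a r "fst \<sigma>" B m "snd \<sigma>" d] Sto obtain r1 where
    1: "halts (cexp a d) (r, m) (ecost a (fst \<sigma>) (snd \<sigma>)) (r1, m)" "agree r1 (fst \<sigma>)"
      "r1 (tmp d) = eval a (fst \<sigma>) (snd \<sigma>)" "\<forall>j<d. r1 (tmp j) = r (tmp j)" by auto
  from cexp_halts[of e r1 "fst \<sigma>" B m "snd \<sigma>" "Suc d"] Sto 1 obtain r2 where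
    2: "halts (cexp e (Suc d)) (r1, m) (ecost e (fst \<sigma>) (snd \<sigma>)) (r2, m)" "agree r2 (fst \<sigma>)"
      "r2 (tmp (Suc d)) = eval e (fst \<sigma>) (snd \<sigma>)" "\<forall>j<Suc d. r2 (tmp j) = r1 (tmp j)" by auto
  have B: "r2 ''B'' = B" using 2(2) Sto.prems by (simp add: agreeD)
  let ?A = "eval a (fst \<sigma>) (snd \<sigma>)" and ?E = "eval e (fst \<sigma>) (snd \<sigma>)"
  let ?r3 = "r2(tmp d := r2 ''B'' + 16 * r2 (tmp d) + k, tmp (d + 2) := k)"
  let ?m = "m(?r3 (tmp d) := ?r3 (tmp (Suc d)))"
  have "halts (seqs (cell d (d + 2) k @ [Store (tmp d) (tmp (Suc d))])) (r2, m) (1 + 7) (?r3, ?m)"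
    by (rule halts_cell) (simp only: seqs.simps halts_basic, simp)
  from halts_Seq[OF 1(1) halts_Seq[OF 2(1) this]]
  have "halts (cstm (Sto k a e) d) (r, m) (scost (Sto k a e) \<sigma>) (?r3, ?m)"
    by (auto simp: cell_def elim!: halts_mono)
  moreover note order_refl
  moreover have "agree ?r3 (fst (run (Sto k a e) \<sigma>))"
    using 2(2) by simp
  moreover have "?m = m(B + 16 * ?A + k := ?E)"
    using 1 2 B by simp
  then have "stores B ?m (snd (run (Sto k a e) \<sigma>))"
    using stores_Sto[of B m "snd \<sigma>" k ?A ?E] Sto.prems by simp
  moreover have "\<forall>j<d. ?r3 (tmp j) = r (tmp j)" "fst (run (Sto k a e) \<sigma>) ''B'' = B"
    using 1 2 Sto.prems by auto
  ultimately show ?case by (rule cstmI)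
next
  case (Sq s1 s2)
  from Sq.IH(1)[of r \<sigma> m d] Sq.prems obtain r1 m1 where
    1: "halts (cstm s1 d) (r, m) (scost s1 \<sigma>) (r1, m1)" "agree r1 (fst (run s1 \<sigma>))"
      "stores B m1 (snd (run s1 \<sigma>))" "\<forall>j<d. r1 (tmp j) = r (tmp j)" "fst (run s1 \<sigma>) ''B'' = B" by auto
  from Sq.IH(2)[of r1 "run s1 \<sigma>" m1 d] Sq.prems 1 obtain r2 m2 where
    2: "halts (cstm s2 d) (r1, m1) (scost s2 (run s1 \<sigma>)) (r2, m2)" "agree r2 (fst (run s2 (run s1 \<sigma>)))"
      "stores B m2 (snd (run s2 (run s1 \<sigma>)))" "\<forall>j<d. r2 (tmp j) = r1 (tmp j)"
      "fst (run s2 (run s1 \<sigma>)) ''B'' = B" by auto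
  show ?case using halts_Seq[OF 1(1) 2(1)] 1 2 by auto
next
  case (IfS e s1 s2)
  from cexp_halts[of e r "fst \<sigma>" B m "snd \<sigma>" d] IfS.prems obtain r1 where
    1: "halts (cexp e d) (r, m) (ecost e (fst \<sigma>) (snd \<sigma>)) (r1, m)" "agree r1 (fst \<sigma>)"
      "r1 (tmp d) = eval e (fst \<sigma>) (snd \<sigma>)" "\<forall>j<d. r1 (tmp j) = r (tmp j)" by auto
  let ?s = "if eval e (fst \<sigma>) (snd \<sigma>) \<noteq> 0 then s1 else s2"
  from IfS.IH(1)[of r1 \<sigma> m d] IfS.IH(2)[of r1 \<sigma> m d] IfS.prems 1 obtain r2 m2 where
    2: "halts (cstm ?s d) (r1, m) (scost ?s \<sigma>) (r2, m2)" "agree r2 (fst (run ?s \<sigma>))"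
      "stores B m2 (snd (run ?s \<sigma>))" "\<forall>j<d. r2 (tmp j) = r1 (tmp j)"
      "fst (run ?s \<sigma>) ''B'' = B" by (cases "eval e (fst \<sigma>) (snd \<sigma>) \<noteq> 0") auto
  have "halts (If (tmp d) (cstm s1 d) (cstm s2 d)) (r1, m) (Suc (scost ?s \<sigma>)) (r2, m2)"
  proof (cases "eval e (fst \<sigma>) (snd \<sigma>) \<noteq> 0")
    case True
    then show ?thesis using 2(1) 1(3) by (intro halts_If(1)) auto
  next
    case False
    then show ?thesis using 2(1) 1(3) by (intro halts_If(2)) auto
  qed
  from halts_Seq[OF 1(1) this]
  have "halts (cstm (IfS e s1 s2) d) (r, m) (scost (IfS e s1 s2) \<sigma>) (r2, m2)"
    by (auto elim!: halts_mono)
  moreover have "run (IfS e s1 s2) \<sigma> = run ?s \<sigma>" by simp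
  ultimately show ?case by (intro cstmI[OF _ order_refl, of _ _ _ r2 m2]) (use 1(4) 2(2-) in auto)
next
  case (For x b s)
  from cexp_halts[of b r "fst \<sigma>" B m "snd \<sigma>" d] For.prems obtain r1 where
    1: "halts (cexp b d) (r, m) (ecost b (fst \<sigma>) (snd \<sigma>)) (r1, m)" "agree r1 (fst \<sigma>)"
      "r1 (tmp d) = eval b (fst \<sigma>) (snd \<sigma>)" "\<forall>j<d. r1 (tmp j) = r (tmp j)" by auto
  have x: "usr x" "x \<noteq> ''B''" using For.prems by auto
  define v where "v = eval b (fst \<sigma>) (snd \<sigma>)"
  define I where "I = iter x s \<sigma>"
  define J where "J i = ((fst (I i))(x := i), snd (I i))" for i
  have I_Suc: "I (Suc i) = run s (J i)" for i
    by (simp add: I_def J_def)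
  let ?body = "seqs [Const (tmp (d + 3)) 0, Add x (tmp (d + 1)) (tmp (d + 3)),
       cstm s (d + 3), Const (tmp (d + 3)) 1, Add (tmp (d + 1)) (tmp (d + 1)) (tmp (d + 3)),
       Sub (tmp d) (tmp d) (tmp (d + 3))]"
  have loop: "\<exists>r' m'. halts (While (tmp d) ?body) (r2, m2)
        ((\<Sum>i = v - j..<v. scost s (J i) + 6) + 1) (r', m') \<and>
      r' (tmp d) = 0 \<and> agree r' (fst (I v)) \<and> stores B m' (snd (I v)) \<and> fst (I v) ''B'' = B \<and>
      (\<forall>i<d. r' (tmp i) = r2 (tmp i)) \<and> r' (tmp (d + 2)) = r2 (tmp (d + 2))"
    if "j \<le> v" "agree r2 (fst (I (v - j)))" "stores B m2 (snd (I (v - j)))"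
      "fst (I (v - j)) ''B'' = B" "r2 (tmp d) = j" "r2 (tmp (d + 1)) = v - j" for j r2 m2
    using that
  proof (induction j arbitrary: r2 m2)
    case 0
    then show ?case using halts_While_False[of "(r2, m2)" "tmp d" ?body]
      by (intro exI[of _ r2] exI[of _ m2]) auto
  next
    case (Suc j)
    have prems: "Suc j \<le> v" "agree r2 (fst (I (v - Suc j)))" "stores B m2 (snd (I (v - Suc j)))"
      "fst (I (v - Suc j)) ''B'' = B" "r2 (tmp d) = Suc j" "r2 (tmp (d + 1)) = v - Suc j"
      by fact+
    have vj: "Suc (v - Suc j) = v - j" using prems by simp
    let ?i = "v - Suc j"
    let ?r3 = "r2(tmp (d + 3) := 0)"
    let ?r4 = "?r3(x := ?r3 (tmp (d + 1)) + ?r3 (tmp (d + 3)))"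
    have "?r3 (tmp (d + 1)) + ?r3 (tmp (d + 3)) = ?i"
      using prems(6) by simp
    moreover have "agree ?r3 (fst (I ?i))"
      using prems(2) by (simp only: agree_tmp)
    then have "agree (?r3(x := ?i)) (fst (J ?i))"
      unfolding J_def fst_conv by (rule agree_upd)
    ultimately have ag: "agree ?r4 (fst (J ?i))"
      by (simp only:)
    have "fst (J ?i) ''B'' = B" "stores B m2 (snd (J ?i))" using prems x by (simp_all add: J_def)
    from For.IH[OF _ ag this, of "d + 3"] For.prems obtain r5 m5 where
      5: "halts (cstm s (d + 3)) (?r4, m2) (scost s (J ?i)) (r5, m5)" "agree r5 (fst (run s (J ?i)))"
      "stores B m5 (snd (run s (J ?i)))" "\<forall>j<d + 3. r5 (tmp j) = ?r4 (tmp j)"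
      "fst (run s (J ?i)) ''B'' = B" unfolding wfs.simps by blast
    from 5(4) x have 54: "\<forall>j<d + 3. r5 (tmp j) = r2 (tmp j)" by simp
    have step: "run s (J ?i) = I (v - j)" unfolding vj[symmetric] I_Suc ..
    let ?r6 = "r5(tmp (d + 3) := 1)"
    let ?r7 = "?r6(tmp (d + 1) := ?r6 (tmp (d + 1)) + ?r6 (tmp (d + 3)))"
    let ?r8 = "?r7(tmp d := ?r7 (tmp d) - ?r7 (tmp (d + 3)))"
    have body: "halts ?body (r2, m2) (1 + (1 + (scost s (J ?i) + (1 + (1 + 1))))) (?r8, m5)"
      unfolding seqs.simps
      by (intro halts_Seq[OF halts_basic(1)] halts_Seq[OF halts_basic(2)] halts_Seq[OF 5(1)] halts_basic)
    obtain r' m' where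
      IH: "halts (While (tmp d) ?body) (?r8, m5)
        ((\<Sum>i = v - j..<v. scost s (J i) + 6) + 1) (r', m')"
        "r' (tmp d) = 0" "agree r' (fst (I v))" "stores B m' (snd (I v))" "fst (I v) ''B'' = B"
        "\<forall>i<d. r' (tmp i) = ?r8 (tmp i)" "r' (tmp (d + 2)) = ?r8 (tmp (d + 2))"
    proof -
      have "j \<le> v" "?r8 (tmp d) = j" "?r8 (tmp (d + 1)) = v - j" using prems 54 by auto
      moreover have "agree ?r8 (fst (I (v - j)))" using 5(2) unfolding step by simp
      ultimately show ?thesis using Suc.IH[of ?r8 m5] 5(3,5) that unfolding step by blast
    qed
    have sum: "(\<Sum>i = v - Suc j..<v. f i) = f (v - Suc j) + (\<Sum>i = v - j..<v. f i)" for f :: "nat \<Rightarrow> nat"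
      using prems vj by (subst sum.atLeast_Suc_lessThan) auto
    have "halts (While (tmp d) ?body) (r2, m2)
        ((\<Sum>i = v - Suc j..<v. scost s (J i) + 6) + 1) (r', m')"
      unfolding sum using halts_While_True[OF _ body IH(1)] prems
      by (auto elim!: halts_mono)
    then show ?case
      using IH 54 prems by (intro exI[of _ r'] exI[of _ m']) simp
  qed
  let ?r2 = "r1(tmp (d + 1) := 0)"
  let ?r3 = "?r2(tmp (d + 2) := ?r2 x + ?r2 (tmp (d + 1)))"
  obtain r5 m5 where
    5: "halts (While (tmp d) ?body) (?r3, m) ((\<Sum>i<v. scost s (J i) + 6) + 1) (r5, m5)"
      "r5 (tmp d) = 0" "agree r5 (fst (I v))" "stores B m5 (snd (I v))" "fst (I v) ''B'' = B"
      "\<forall>i<d. r5 (tmp i) = r (tmp i)" "r5 (tmp (d + 2)) = fst \<sigma> x"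
    using loop[of v ?r3 m] 1 x For.prems v_def agreeD[OF 1(2) x(1)] by (auto simp: atLeast0LessThan I_def)
  let ?r6 = "r5(x := r5 (tmp (d + 2)) + r5 (tmp d))"
  have "halts (cstm (For x b s) d) (r, m)
     (ecost b (fst \<sigma>) (snd \<sigma>) + (1 + (1 + ((\<Sum>i<v. scost s (J i) + 6) + 1 + 1)))) (?r6, m5)"
    unfolding seqs.simps cstm.simps
    by (intro halts_Seq[OF 1(1)] halts_Seq[OF halts_basic(1)] halts_Seq[OF halts_basic(2)] halts_Seq[OF 5(1)[unfolded seqs.simps]] halts_basic)
  then have "halts (cstm (For x b s) d) (r, m) (scost (For x b s) \<sigma>) (?r6, m5)"
    by (rule halts_mono) (simp add: v_def J_def I_def)
  moreover note order_refl
  moreover have run: "run (For x b s) \<sigma> = ((fst (I v))(x := fst \<sigma> x), snd (I v))"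
    by (simp add: v_def Let_def I_def)
  have "agree ?r6 ((fst (I v))(x := fst \<sigma> x))"
    using agree_upd[OF 5(3)] 5 by simp
  then have "agree ?r6 (fst (run (For x b s) \<sigma>))"
    unfolding run fst_conv .
  moreover have "stores B m5 (snd (run (For x b s) \<sigma>))" "\<forall>j<d. ?r6 (tmp j) = r (tmp j)"
      "fst (run (For x b s) \<sigma>) ''B'' = B"
    using 5 x unfolding run by auto
  ultimately show ?case by (rule cstmI)
qed

subsection \<open>Cost bounds\<close>

primrec edepth :: "exp \<Rightarrow> nat" where
  "edepth (V x) = 0"
| "edepth (C a) = 0"
| "edepth (Plus a b) = max (edepth a) (edepth b)"
| "edepth (Minus a b) = max (edepth a) (edepth b)"
| "edepth (Rd j e) = edepth e"
| "edepth (Cond a b c) = max (edepth a) (max (edepth b) (edepth c))"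
| "edepth (Sum x b e) = Suc (edepth e)"

primrec sdepth :: "stm \<Rightarrow> nat" where
  "sdepth (Asg x e) = edepth e"
| "sdepth (Sto j a e) = max (edepth a) (edepth e)"
| "sdepth (s1 ;; s2) = max (sdepth s1) (sdepth s2)"
| "sdepth (IfS e s1 s2) = max (edepth e) (max (sdepth s1) (sdepth s2))"
| "sdepth (For x b s) = Suc (sdepth s)"

definition is_bound :: "reg set \<Rightarrow> exp \<Rightarrow> bool" where
  "is_bound R b \<longleftrightarrow> (\<exists>y\<in>R. b = V y)"

primrec ebounded :: "reg set \<Rightarrow> exp \<Rightarrow> bool" where
  "ebounded R (V x) \<longleftrightarrow> True"
| "ebounded R (C a) \<longleftrightarrow> True"
| "ebounded R (Plus a b) \<longleftrightarrow> ebounded R a \<and> ebounded R b"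
| "ebounded R (Minus a b) \<longleftrightarrow> ebounded R a \<and> ebounded R b"
| "ebounded R (Rd j e) \<longleftrightarrow> ebounded R e"
| "ebounded R (Cond a b c) \<longleftrightarrow> ebounded R a \<and> ebounded R b \<and> ebounded R c"
| "ebounded R (Sum x b e) \<longleftrightarrow> x \<notin> R \<and> is_bound R b \<and> ebounded R e"

primrec sbounded :: "reg set \<Rightarrow> stm \<Rightarrow> bool" where
  "sbounded R (Asg x e) \<longleftrightarrow> x \<notin> R \<and> ebounded R e"
| "sbounded R (Sto j a e) \<longleftrightarrow> ebounded R a \<and> ebounded R e"
| "sbounded R (s1 ;; s2) \<longleftrightarrow> sbounded R s1 \<and> sbounded R s2"
| "sbounded R (IfS e s1 s2) \<longleftrightarrow> ebounded R e \<and> sbounded R s1 \<and> sbounded R s2"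
| "sbounded R (For x b s) \<longleftrightarrow> x \<notin> R \<and> is_bound R b \<and> sbounded R s"

lemma sum_mult_bound:
  fixes f :: "nat \<Rightarrow> nat"
  assumes "\<And>i. i < n \<Longrightarrow> f i \<le> K" "n \<le> Z"
  shows "(\<Sum>i<n. f i) \<le> K * Z"
proof -
  have "(\<Sum>i<n. f i) \<le> n * K"
    using assms(1) by (intro order_trans[OF sum_bounded_above]) auto
  then show ?thesis using assms(2) by (metis mult.commute mult_le_mono1 order_trans)
qed

lemma mult_power_mono:
  fixes Z :: nat
  assumes "c \<le> K * Z ^ d" "1 \<le> Z" "d \<le> d'"
  shows "c \<le> K * Z ^ d'"
  using assms(1) by (rule order_trans) (intro mult_mono power_increasing assms, simp_all)

lemma const_le_power: "(1::nat) \<le> Z \<Longrightarrow> c \<le> c * Z ^ d"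
  by simp

lemma ecost_bound:
  assumes "ebounded R e"
  shows "\<exists>K. \<forall>r h Z. 1 \<le> Z \<longrightarrow> (\<forall>y\<in>R. r y \<le> Z) \<longrightarrow> ecost e r h \<le> K * Z ^ edepth e"
  using assms
proof (induction e)
  case (Plus a b)
  then obtain K L where
    1: "\<forall>r h Z. 1 \<le> Z \<longrightarrow> (\<forall>y\<in>R. r y \<le> Z) \<longrightarrow> ecost a r h \<le> K * Z ^ edepth a" and
    2: "\<forall>r h Z. 1 \<le> Z \<longrightarrow> (\<forall>y\<in>R. r y \<le> Z) \<longrightarrow> ecost b r h \<le> L * Z ^ edepth b" by auto
  show ?case
  proof (intro exI[of _ "K + L + 1"] allI impI)
    fix r :: "reg \<Rightarrow> nat" and h and Z :: nat assume Z: "1 \<le> Z" "\<forall>y\<in>R. r y \<le> Z"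
    define d where "d = edepth (Plus a b)"
    have c1: "ecost a r h \<le> K * Z ^ d"
      by (rule mult_power_mono[where d = "edepth a"]) (use 1 Z in \<open>auto simp: d_def simp del: split_paired_All\<close>)
    have c2: "ecost b r h \<le> L * Z ^ d"
      by (rule mult_power_mono[where d = "edepth b"]) (use 2 Z in \<open>auto simp: d_def simp del: split_paired_All\<close>)
    note c1 c2
    moreover have "1 \<le> 1 * Z ^ d" using Z(1) by (rule const_le_power)
    ultimately have "ecost (Plus a b) r h \<le> (K + L + 1) * Z ^ d"
      unfolding ecost.simps add_mult_distrib by linarith
    then show "ecost (Plus a b) r h \<le> (K + L + 1) * Z ^ edepth (Plus a b)" by (simp add: d_def)
  qed
next
  case (Minus a b)
  then obtain K L where
    1: "\<forall>r h Z. 1 \<le> Z \<longrightarrow> (\<forall>y\<in>R. r y \<le> Z) \<longrightarrow> ecost a r h \<le> K * Z ^ edepth a" and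
    2: "\<forall>r h Z. 1 \<le> Z \<longrightarrow> (\<forall>y\<in>R. r y \<le> Z) \<longrightarrow> ecost b r h \<le> L * Z ^ edepth b" by auto
  show ?case
  proof (intro exI[of _ "K + L + 1"] allI impI)
    fix r :: "reg \<Rightarrow> nat" and h and Z :: nat assume Z: "1 \<le> Z" "\<forall>y\<in>R. r y \<le> Z"
    define d where "d = edepth (Minus a b)"
    have c1: "ecost a r h \<le> K * Z ^ d"
      by (rule mult_power_mono[where d = "edepth a"]) (use 1 Z in \<open>auto simp: d_def simp del: split_paired_All\<close>)
    have c2: "ecost b r h \<le> L * Z ^ d"
      by (rule mult_power_mono[where d = "edepth b"]) (use 2 Z in \<open>auto simp: d_def simp del: split_paired_All\<close>)
    note c1 c2
    moreover have "1 \<le> 1 * Z ^ d" using Z(1) by (rule const_le_power)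
    ultimately have "ecost (Minus a b) r h \<le> (K + L + 1) * Z ^ d"
      unfolding ecost.simps add_mult_distrib by linarith
    then show "ecost (Minus a b) r h \<le> (K + L + 1) * Z ^ edepth (Minus a b)" by (simp add: d_def)
  qed
next
  case (Cond a b c)
  then obtain K L M where
    1: "\<forall>r h Z. 1 \<le> Z \<longrightarrow> (\<forall>y\<in>R. r y \<le> Z) \<longrightarrow> ecost a r h \<le> K * Z ^ edepth a" and
    2: "\<forall>r h Z. 1 \<le> Z \<longrightarrow> (\<forall>y\<in>R. r y \<le> Z) \<longrightarrow> ecost b r h \<le> L * Z ^ edepth b" and
    3: "\<forall>r h Z. 1 \<le> Z \<longrightarrow> (\<forall>y\<in>R. r y \<le> Z) \<longrightarrow> ecost c r h \<le> M * Z ^ edepth c" by auto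
  show ?case
  proof (intro exI[of _ "K + L + M + 1"] allI impI)
    fix r :: "reg \<Rightarrow> nat" and h and Z :: nat assume Z: "1 \<le> Z" "\<forall>y\<in>R. r y \<le> Z"
    define d where "d = edepth (Cond a b c)"
    have c1: "ecost a r h \<le> K * Z ^ d"
      by (rule mult_power_mono[where d = "edepth a"]) (use 1 Z in \<open>auto simp: d_def simp del: split_paired_All\<close>)
    have c2: "ecost b r h \<le> L * Z ^ d"
      by (rule mult_power_mono[where d = "edepth b"]) (use 2 Z in \<open>auto simp: d_def simp del: split_paired_All\<close>)
    have c3: "ecost c r h \<le> M * Z ^ d"
      by (rule mult_power_mono[where d = "edepth c"]) (use 3 Z in \<open>auto simp: d_def simp del: split_paired_All\<close>)
    note c1 c2 c3
    moreover have "1 \<le> 1 * Z ^ d" using Z(1) by (rule const_le_power)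
    ultimately have "ecost (Cond a b c) r h \<le> (K + L + M + 1) * Z ^ d"
      unfolding ecost.simps add_mult_distrib by linarith
    then show "ecost (Cond a b c) r h \<le> (K + L + M + 1) * Z ^ edepth (Cond a b c)" by (simp add: d_def)
  qed
next
  case (Rd j e)
  then obtain K where
    1: "\<forall>r h Z. 1 \<le> Z \<longrightarrow> (\<forall>y\<in>R. r y \<le> Z) \<longrightarrow> ecost e r h \<le> K * Z ^ edepth e" by auto
  show ?case
  proof (intro exI[of _ "K + 8"] allI impI)
    fix r :: "reg \<Rightarrow> nat" and h and Z :: nat assume Z: "1 \<le> Z" "\<forall>y\<in>R. r y \<le> Z"
    have "ecost e r h \<le> K * Z ^ edepth e" using 1 Z by auto
    moreover have "8 \<le> 8 * Z ^ edepth e" using Z(1) by (rule const_le_power)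
    ultimately show "ecost (Rd j e) r h \<le> (K + 8) * Z ^ edepth (Rd j e)"
      unfolding ecost.simps edepth.simps add_mult_distrib by linarith
  qed
next
  case (Sum x b e)
  then obtain K y where
    1: "\<forall>r h Z. 1 \<le> Z \<longrightarrow> (\<forall>y\<in>R. r y \<le> Z) \<longrightarrow> ecost e r h \<le> K * Z ^ edepth e"
    and y: "b = V y" "y \<in> R" and x: "x \<notin> R" by (auto simp: is_bound_def)
  show ?case
  proof (intro exI[of _ "K + 4 + 9"] allI impI)
    fix r :: "reg \<Rightarrow> nat" and h and Z :: nat assume Z: "1 \<le> Z" "\<forall>y\<in>R. r y \<le> Z"
    have "(\<Sum>i<r y. ecost e (r(x := i)) h + 4) \<le> ((K + 4) * Z ^ edepth e) * Z"
    proof (rule sum_mult_bound)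
      fix i
      have "ecost e (r(x := i)) h \<le> K * Z ^ edepth e" using 1 Z x by auto
      moreover have "4 \<le> 4 * Z ^ edepth e" using Z(1) by (rule const_le_power)
      ultimately show "ecost e (r(x := i)) h + 4 \<le> (K + 4) * Z ^ edepth e"
        unfolding add_mult_distrib by linarith
    qed (use Z y in auto)
    moreover have "9 \<le> 9 * Z ^ Suc (edepth e)" using Z(1) by (rule const_le_power)
    ultimately have "9 + (\<Sum>i<r y. ecost e (r(x := i)) h + 4) \<le> (K + 4) * Z ^ edepth e * Z + 9 * Z ^ Suc (edepth e)"
      by linarith
    then show "ecost (Sum x b e) r h \<le> (K + 4 + 9) * Z ^ edepth (Sum x b e)"
      unfolding y by (simp add: algebra_simps)
  qed
qed (use order.refl in \<open>auto intro: exI[of _ 2]\<close>)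

lemma run_preserves:
  "sbounded R s \<Longrightarrow> y \<in> R \<Longrightarrow> fst (run s \<sigma>) y = fst \<sigma> y"
proof (induction s arbitrary: \<sigma>)
  case (For x b s)
  have "fst (iter x s \<sigma> m) y = fst \<sigma> y" for m
    by (induction m) (use For in auto)
  then show ?case using For.prems by (auto simp: Let_def)
qed auto

lemma scost_bound:
  assumes "sbounded R s"
  shows "\<exists>K. \<forall>\<sigma> Z. 1 \<le> Z \<longrightarrow> (\<forall>y\<in>R. fst \<sigma> y \<le> Z) \<longrightarrow> scost s \<sigma> \<le> K * Z ^ sdepth s"
  using assms
proof (induction s)
  case (Asg x e)
  then obtain K where
    1: "\<forall>r h Z. 1 \<le> Z \<longrightarrow> (\<forall>y\<in>R. r y \<le> Z) \<longrightarrow> ecost e r h \<le> K * Z ^ edepth e"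
    using ecost_bound by fastforce
  show ?case
  proof (intro exI[of _ "K + 2"] allI impI)
    fix \<sigma> :: lstate and Z :: nat assume Z: "1 \<le> Z" "\<forall>y\<in>R. fst \<sigma> y \<le> Z"
    have "ecost e (fst \<sigma>) (snd \<sigma>) \<le> K * Z ^ edepth e" using 1 Z by auto
    moreover have "2 \<le> 2 * Z ^ edepth e" using Z(1) by (rule const_le_power)
    ultimately show "scost (Asg x e) \<sigma> \<le> (K + 2) * Z ^ sdepth (Asg x e)"
      unfolding scost.simps sdepth.simps add_mult_distrib by linarith
  qed
next
  case (Sto j a b)
  then obtain K L where
    1: "\<forall>r h Z. 1 \<le> Z \<longrightarrow> (\<forall>y\<in>R. r y \<le> Z) \<longrightarrow> ecost a r h \<le> K * Z ^ edepth a" and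
    2: "\<forall>r h Z. 1 \<le> Z \<longrightarrow> (\<forall>y\<in>R. r y \<le> Z) \<longrightarrow> ecost b r h \<le> L * Z ^ edepth b"
    using ecost_bound by fastforce
  show ?case
  proof (intro exI[of _ "K + L + 8"] allI impI)
    fix \<sigma> :: lstate and Z :: nat assume Z: "1 \<le> Z" "\<forall>y\<in>R. fst \<sigma> y \<le> Z"
    define d where "d = sdepth (Sto j a b)"
    have c1: "ecost a (fst \<sigma>) (snd \<sigma>) \<le> K * Z ^ d"
      by (rule mult_power_mono[where d = "edepth a"]) (use 1 Z in \<open>auto simp: d_def simp del: split_paired_All\<close>)
    have c2: "ecost b (fst \<sigma>) (snd \<sigma>) \<le> L * Z ^ d"
      by (rule mult_power_mono[where d = "edepth b"]) (use 2 Z in \<open>auto simp: d_def simp del: split_paired_All\<close>)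
    note c1 c2
    moreover have "8 \<le> 8 * Z ^ d" using Z(1) by (rule const_le_power)
    ultimately have "scost (Sto j a b) \<sigma> \<le> (K + L + 8) * Z ^ d"
      unfolding scost.simps add_mult_distrib by linarith
    then show "scost (Sto j a b) \<sigma> \<le> (K + L + 8) * Z ^ sdepth (Sto j a b)" by (simp add: d_def)
  qed
next
  case (Sq s1 s2)
  then obtain K L where
    1: "\<forall>\<sigma> Z. 1 \<le> Z \<longrightarrow> (\<forall>y\<in>R. fst \<sigma> y \<le> Z) \<longrightarrow> scost s1 \<sigma> \<le> K * Z ^ sdepth s1" and
    2: "\<forall>\<sigma> Z. 1 \<le> Z \<longrightarrow> (\<forall>y\<in>R. fst \<sigma> y \<le> Z) \<longrightarrow> scost s2 \<sigma> \<le> L * Z ^ sdepth s2" by auto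
  show ?case
  proof (intro exI[of _ "K + L"] allI impI)
    fix \<sigma> :: lstate and Z :: nat assume Z: "1 \<le> Z" "\<forall>y\<in>R. fst \<sigma> y \<le> Z"
    define d where "d = sdepth (s1 ;; s2)"
    have Z2: "\<forall>y\<in>R. fst (run s1 \<sigma>) y \<le> Z" using Z Sq.prems run_preserves[of R s1 _ \<sigma>] by auto
    have c1: "scost s1 \<sigma> \<le> K * Z ^ d"
      by (rule mult_power_mono[where d = "sdepth s1"]) (use 1 Z in \<open>auto simp: d_def simp del: split_paired_All\<close>)
    have c2: "scost s2 (run s1 \<sigma>) \<le> L * Z ^ d"
      by (rule mult_power_mono[where d = "sdepth s2"]) (use 2 Z Z2 in \<open>auto simp: d_def simp del: split_paired_All\<close>)
    with c1 have "scost (s1 ;; s2) \<sigma> \<le> (K + L) * Z ^ d"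
      unfolding scost.simps add_mult_distrib by linarith
    then show "scost (s1 ;; s2) \<sigma> \<le> (K + L) * Z ^ sdepth (s1 ;; s2)" by (simp add: d_def)
  qed
next
  case (IfS e s1 s2)
  then have "ebounded R e" "sbounded R s1" "sbounded R s2" by simp_all
  with ecost_bound[of R e] IfS.IH obtain J K L where
    0: "\<forall>r h Z. 1 \<le> Z \<longrightarrow> (\<forall>y\<in>R. r y \<le> Z) \<longrightarrow> ecost e r h \<le> J * Z ^ edepth e" and
    1: "\<forall>\<sigma> Z. 1 \<le> Z \<longrightarrow> (\<forall>y\<in>R. fst \<sigma> y \<le> Z) \<longrightarrow> scost s1 \<sigma> \<le> K * Z ^ sdepth s1" and
    2: "\<forall>\<sigma> Z. 1 \<le> Z \<longrightarrow> (\<forall>y\<in>R. fst \<sigma> y \<le> Z) \<longrightarrow> scost s2 \<sigma> \<le> L * Z ^ sdepth s2"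
    by blast
  show ?case
  proof (intro exI[of _ "J + 1 + K + L"] allI impI)
    fix \<sigma> :: lstate and Z :: nat assume Z: "1 \<le> Z" "\<forall>y\<in>R. fst \<sigma> y \<le> Z"
    define d where "d = sdepth (IfS e s1 s2)"
    have c0: "ecost e (fst \<sigma>) (snd \<sigma>) \<le> J * Z ^ d"
      by (rule mult_power_mono[where d = "edepth e"]) (use 0 Z in \<open>auto simp: d_def simp del: split_paired_All\<close>)
    have c1: "scost s1 \<sigma> \<le> K * Z ^ d"
      by (rule mult_power_mono[where d = "sdepth s1"]) (use 1 Z in \<open>auto simp: d_def simp del: split_paired_All\<close>)
    have c2: "scost s2 \<sigma> \<le> L * Z ^ d"
      by (rule mult_power_mono[where d = "sdepth s2"]) (use 2 Z in \<open>auto simp: d_def simp del: split_paired_All\<close>)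
    note c0 c1 c2
    moreover have "1 \<le> 1 * Z ^ d" using Z(1) by (rule const_le_power)
    ultimately have "scost (IfS e s1 s2) \<sigma> \<le> (J + 1 + K + L) * Z ^ d"
      unfolding scost.simps add_mult_distrib by (simp split: if_split)
    then show "scost (IfS e s1 s2) \<sigma> \<le> (J + 1 + K + L) * Z ^ sdepth (IfS e s1 s2)" by (simp add: d_def)
  qed
next
  case (For x b s)
  then obtain K y where
    1: "\<forall>\<sigma> Z. 1 \<le> Z \<longrightarrow> (\<forall>y\<in>R. fst \<sigma> y \<le> Z) \<longrightarrow> scost s \<sigma> \<le> K * Z ^ sdepth s"
    and y: "b = V y" "y \<in> R" and x: "x \<notin> R" by (auto simp: is_bound_def)
  show ?case
  proof (intro exI[of _ "K + 6 + 6"] allI impI)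
    fix \<sigma> :: lstate and Z :: nat assume Z: "1 \<le> Z" "\<forall>y\<in>R. fst \<sigma> y \<le> Z"
    have it: "fst (iter x s \<sigma> m) z = fst \<sigma> z" if "z \<in> R" for m z
      by (induction m) (use that run_preserves For.prems in auto)
    have "(\<Sum>i<fst \<sigma> y. scost s ((fst (iter x s \<sigma> i))(x := i), snd (iter x s \<sigma> i)) + 6)
       \<le> ((K + 6) * Z ^ sdepth s) * Z"
    proof (rule sum_mult_bound)
      fix i
      have "scost s ((fst (iter x s \<sigma> i))(x := i), snd (iter x s \<sigma> i)) \<le> K * Z ^ sdepth s"
      proof -
        have "\<forall>z\<in>R. fst ((fst (iter x s \<sigma> i))(x := i), snd (iter x s \<sigma> i)) z \<le> Z" using Z x it by auto
        then show ?thesis using 1 Z(1) by blast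
      qed
      moreover have "6 \<le> 6 * Z ^ sdepth s" using Z(1) by (rule const_le_power)
      ultimately show "scost s ((fst (iter x s \<sigma> i))(x := i), snd (iter x s \<sigma> i)) + 6 \<le> (K + 6) * Z ^ sdepth s"
        unfolding add_mult_distrib by linarith
    qed (use Z y in auto)
    moreover have "6 \<le> 6 * Z ^ Suc (sdepth s)" using Z(1) by (rule const_le_power)
    ultimately have "6 + (\<Sum>i<fst \<sigma> y. scost s ((fst (iter x s \<sigma> i))(x := i), snd (iter x s \<sigma> i)) + 6)
       \<le> (K + 6) * Z ^ sdepth s * Z + 6 * Z ^ Suc (sdepth s)"
      by linarith
    then show "scost (For x b s) \<sigma> \<le> (K + 6 + 6) * Z ^ sdepth (For x b s)"
      unfolding y by (simp add: algebra_simps)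
  qed
qed


section \<open>Derived expressions and loops\<close>

definition ENot where "ENot e = Cond e (C 0) (C 1)"
definition EAnd where "EAnd a b = Cond a b (C 0)"
definition EOr where "EOr a b = Cond a (C 1) b"
definition ELt where "ELt a b = Minus b a"
definition EEq where "EEq a b = ENot (Plus (Minus a b) (Minus b a))"
definition EEx where "EEx x b e = Sum x (V b) e"
definition EAll where "EAll x b e = ENot (EEx x b (ENot e))"
definition EBool where "EBool e = Cond e (C 1) (C 0)"
definition EMul where "EMul e y = Sum ''*'' (V y) e"
definition Skip where "Skip = Asg ''z'' (V ''z'')"

lemmas derived_defs = ENot_def EAnd_def EOr_def ELt_def EEq_def EEx_def EAll_def EBool_def EMul_def Skip_def

definition holds :: "exp \<Rightarrow> (reg \<Rightarrow> nat) \<Rightarrow> arrays \<Rightarrow> bool" where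
  "holds e r h \<longleftrightarrow> eval e r h \<noteq> 0"

lemma holds_simps [simp]:
  "holds (V x) r h \<longleftrightarrow> r x \<noteq> 0"
  "holds (Rd j e) r h \<longleftrightarrow> h j (eval e r h) \<noteq> 0"
  "holds (ENot e) r h \<longleftrightarrow> \<not> holds e r h"
  "holds (EAnd a b) r h \<longleftrightarrow> holds a r h \<and> holds b r h"
  "holds (EOr a b) r h \<longleftrightarrow> holds a r h \<or> holds b r h"
  "holds (ELt a b) r h \<longleftrightarrow> eval a r h < eval b r h"
  "holds (EEq a b) r h \<longleftrightarrow> eval a r h = eval b r h"
  "holds (EEx x y e) r h \<longleftrightarrow> (\<exists>i<r y. holds e (r(x := i)) h)"
  "holds (EAll x y e) r h \<longleftrightarrow> (\<forall>i<r y. holds e (r(x := i)) h)"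
  by (auto simp: holds_def derived_defs)

lemma eval_Bool [simp]: "eval (EBool e) r h = of_bool (holds e r h)"
  by (simp add: EBool_def holds_def)

lemma eval_Cond [simp]: "eval (Cond a b c) r h = (if holds a r h then eval b r h else eval c r h)"
  by (simp add: holds_def)

declare eval.simps(6) [simp del]

lemma run_IfS [simp]: "run (IfS e s1 s2) \<sigma> = (if holds e (fst \<sigma>) (snd \<sigma>) then run s1 \<sigma> else run s2 \<sigma>)"
  by (simp add: holds_def)

lemma run_Skip [simp]: "run Skip \<sigma> = \<sigma>"
  by (simp add: Skip_def)

declare run.simps(4,5) [simp del]

lemma run_For_invariant:
  assumes "eval b r h = m" "P 0 r h"
    and "\<And>i r1 h1. i < m \<Longrightarrow> P i r1 h1 \<Longrightarrow>
      P (Suc i) (fst (run s (r1(x := i), h1))) (snd (run s (r1(x := i), h1)))"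
  obtains r1 h1 where "P m r1 h1" "run (For x b s) (r, h) = (r1(x := r x), h1)"
proof -
  have "P i (fst (iter x s (r, h) i)) (snd (iter x s (r, h) i))" if "i \<le> m" for i
    using that by (induction i) (use assms in auto)
  from this[OF order_refl] that show thesis
    using assms(1) by (auto simp: run.simps(5) Let_def)
qed

lemma run_fill:
  assumes b: "eval b r h = m" and inj: "inj_on c {..<m}"
    and step: "\<And>i f. i < m \<Longrightarrow> (\<And>i'. i' < i \<Longrightarrow> f (c i') = g i') \<Longrightarrow>
        (\<And>y. y \<notin> c ` {..<i} \<Longrightarrow> f y = h j y) \<Longrightarrow>
        eval a (r(x := i)) (h(j := f)) = c i \<and> eval e (r(x := i)) (h(j := f)) = g i"
  obtains f where "run (For x b (Sto j a e)) (r, h) = (r, h(j := f))"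
    "\<And>i. i < m \<Longrightarrow> f (c i) = g i" "\<And>y. y \<notin> c ` {..<m} \<Longrightarrow> f y = h j y"
proof -
  define P where "P i r1 h1 \<longleftrightarrow> (\<forall>v. r1(x := v) = r(x := v)) \<and> (\<exists>f. h1 = h(j := f) \<and> (\<forall>i'<i. f (c i') = g i') \<and>
      (\<forall>y. y \<notin> c ` {..<i} \<longrightarrow> f y = h j y))" for i and r1 :: "reg \<Rightarrow> nat" and h1
  have P0: "P 0 r h" unfolding P_def by (intro conjI exI[of _ "h j"]) auto
  have PS: "P (Suc i) (fst (run (Sto j a e) (r1(x := i), h1))) (snd (run (Sto j a e) (r1(x := i), h1)))"
    if i: "i < m" and "P i r1 h1" for i r1 h1
  proof -
    from \<open>P i r1 h1\<close> obtain f where f: "h1 = h(j := f)" "\<forall>i'<i. f (c i') = g i'"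
      "\<forall>y. y \<notin> c ` {..<i} \<longrightarrow> f y = h j y" and r: "\<And>v. r1(x := v) = r(x := v)"
      unfolding P_def by blast
    have ev: "eval a (r(x := i)) h1 = c i" "eval e (r(x := i)) h1 = g i"
      using step[OF i, of f] f by auto
    have "run (Sto j a e) (r1(x := i), h1) = (r(x := i), h(j := f(c i := g i)))"
      using ev r[of i] f(1) by simp
    moreover have "(f(c i := g i)) (c i') = g i'" if "i' < Suc i" for i'
    proof (cases "i' = i")
      case False
      then have "c i' \<noteq> c i" using that i inj by (auto simp: inj_on_def)
      then show ?thesis using that f(2) False by auto
    qed simp
    moreover have "(f(c i := g i)) y = h j y" if "y \<notin> c ` {..<Suc i}" for y
      using that f(3) by (auto simp: lessThan_Suc)
    ultimately show ?thesis unfolding P_def by auto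
  qed
  obtain r1 h1 where Pm: "P m r1 h1" and run: "run (For x b (Sto j a e)) (r, h) = (r1(x := r x), h1)"
    using run_For_invariant[where P = P and x = x and s = "Sto j a e", OF b P0 PS] by blast
  from Pm have "r1(x := r x) = r" unfolding P_def by (metis fun_upd_triv)
  with run Pm that show thesis unfolding P_def by auto
qed

lemma run_fill_range:
  assumes b: "eval b r h = m"
    and step: "\<And>i f. i < m \<Longrightarrow> (\<And>i'. i' < i \<Longrightarrow> f i' = g i') \<Longrightarrow> eval e (r(x := i)) (h(j := f)) = g i"
  obtains f where "run (For x b (Sto j (V x) e)) (r, h) = (r, h(j := f))" "\<And>i. i < m \<Longrightarrow> f i = g i"
  by (rule run_fill[OF b, of "\<lambda>i. i" g j "V x" x e]) (use step that in auto)

lemma run_fill_matrix: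
  assumes b: "eval (V bx) r h = mx" and r: "r bw = my" "bw \<noteq> x" "bw \<noteq> y" "x \<noteq> y" "''*'' \<noteq> x" "''*'' \<noteq> y"
    and step: "\<And>i i' f. i < mx \<Longrightarrow> i' < my \<Longrightarrow> (\<And>l l'. l < i \<Longrightarrow> l' < my \<Longrightarrow> f (l * my + l') = g l l') \<Longrightarrow>
        eval e (r(x := i, y := i')) (h(j := f)) = g i i'"
  obtains f where "run (For x (V bx) (For y (V bw) (Sto j (Plus (EMul (V x) bw) (V y)) e))) (r, h) = (r, h(j := f))"
    "\<And>i i'. i < mx \<Longrightarrow> i' < my \<Longrightarrow> f (i * my + i') = g i i'"
proof -
  let ?s = "For y (V bw) (Sto j (Plus (EMul (V x) bw) (V y)) e)"
  define P where "P i r1 h1 \<longleftrightarrow> (\<forall>v. r1(x := v) = r(x := v)) \<and> (\<exists>f. h1 = h(j := f) \<and>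
      (\<forall>l<i. \<forall>l'<my. f (l * my + l') = g l l'))" for i and r1 :: "reg \<Rightarrow> nat" and h1
  have P0: "P 0 r h" unfolding P_def by (intro conjI exI[of _ "h j"]) auto
  have PS: "P (Suc i) (fst (run ?s (r1(x := i), h1))) (snd (run ?s (r1(x := i), h1)))"
    if i: "i < mx" and "P i r1 h1" for i r1 h1
  proof -
    from \<open>P i r1 h1\<close> obtain f where f: "h1 = h(j := f)" "\<forall>l<i. \<forall>l'<my. f (l * my + l') = g l l'"
      and r': "\<And>v. r1(x := v) = r(x := v)" unfolding P_def by blast
    have other: "l * my + l' \<notin> (\<lambda>i'. i * my + i') ` {..<n'}" if "l < i" "l' < my" for l l' n'
    proof -
      have "l * my + l' < Suc l * my" using that by simp
      also have "\<dots> \<le> i * my" using that by (intro mult_le_mono1) simp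
      finally show ?thesis by auto
    qed
    obtain f' where f': "run ?s (r(x := i), h(j := f)) = (r(x := i), (h(j := f))(j := f'))"
      "\<And>i'. i' < my \<Longrightarrow> f' (i * my + i') = g i i'"
      "\<And>z. z \<notin> (\<lambda>i'. i * my + i') ` {..<my} \<Longrightarrow> f' z = (h(j := f)) j z"
    proof (rule run_fill[where c = "\<lambda>i'. i * my + i'" and g = "g i" and x = y and b = "V bw"
          and a = "Plus (EMul (V x) bw) (V y)" and e = e and r = "r(x := i)" and h = "h(j := f)" and j = j and m = my])
      fix i' f1
      assume i': "i' < my" and f1: "\<And>z. z \<notin> (\<lambda>i'. i * my + i') ` {..<i'} \<Longrightarrow> f1 z = (h(j := f)) j z"
      have "f1 (l * my + l') = g l l'" if "l < i" "l' < my" for l l'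
        using f1[OF other[OF that]] f(2) that by simp
      from step[OF i i' this] show "eval (Plus (EMul (V x) bw) (V y)) (r(x := i, y := i')) ((h(j := f))(j := f1)) = i * my + i' \<and>
         eval e (r(x := i, y := i')) ((h(j := f))(j := f1)) = g i i'"
        using r by (simp add: EMul_def)
    qed (use r in \<open>auto simp: inj_on_def\<close>)
    have "\<forall>l<Suc i. \<forall>l'<my. f' (l * my + l') = g l l'"
      using f'(2,3) f(2) other by (auto simp: less_Suc_eq)
    then show ?thesis unfolding P_def f(1) r' f'(1) by auto
  qed
  obtain r1 h1 where Pm: "P mx r1 h1" and run: "run (For x (V bx) ?s) (r, h) = (r1(x := r x), h1)"
    using run_For_invariant[where P = P and x = x and s = ?s, OF b P0 PS] by blast
  from Pm have "r1(x := r x) = r" unfolding P_def by (metis fun_upd_triv)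
  with run Pm that show thesis unfolding P_def by auto
qed

section \<open>The program\<close>

text \<open>Contents of the arrays, where \<open>W2 = 2 * W\<close>, \<open>D = 2 ^ W2\<close>, \<open>b = n + 1\<close>, \<open>M = b ^ D\<close>, and a merged
  component is named by the label of one of its vertices:
  0: number of children of a node that have not been left yet;
  1: label of the component collected at a node, plus 1 (0 if there is none);
  2, 3: labels \<open>a\<close>, \<open>c\<close> of the two components of each merge, where \<open>a\<close> survives;
  4, 5: label and twin class of each vertex before the current merge;
  6: at \<open>a * M + x\<close>, whether component \<open>a\<close> has a partial coloring with type counts \<open>x\<close>;
  7: the reachable sums of weights;
  8, 9: the powers of 2 and of \<open>b\<close>;
  10, 11: label and twin class of each vertex after the current merge;
  12: at \<open>p * D + q\<close>, the weight of combining types \<open>p\<close> and \<open>q\<close>, 0 if they are incompatible;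
  13: at \<open>x * W2 + y\<close>, bit \<open>y\<close> of \<open>x\<close>;
  14: the new row of array 6;
  16: the adjacency matrix, the parents and the leaf of each vertex.
  A type is a number below \<open>D\<close>: bit \<open>s < W\<close> says that class \<open>s\<close> is met, bit \<open>W + s\<close> that class \<open>s\<close>
  contains an undominated vertex.\<close>

definition adj :: "reg \<Rightarrow> reg \<Rightarrow> exp" where
  "adj u v = Rd 16 (Plus (EMul (V u) ''n'') (V v))"

definition parent_of :: "reg \<Rightarrow> exp" where
  "parent_of t = Rd 16 (Plus (V ''nn'') (V t))"

definition climb :: stm where
  "climb = IfS (V ''act'')
     (IfS (EEq (V ''t'') (V ''root'')) (Asg ''act'' (C 0))
       (Asg ''p'' (parent_of ''t'') ;;
        IfS (Rd 1 (V ''p''))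
          (Sto 2 (V ''m'') (Minus (Rd 1 (V ''p'')) (C 1)) ;;
           Sto 3 (V ''m'') (V ''lab'') ;;
           Asg ''m'' (Plus (V ''m'') (C 1)))
          (Sto 1 (V ''p'') (Plus (V ''lab'') (C 1))) ;;
        Sto 0 (V ''p'') (Minus (Rd 0 (V ''p'')) (C 1)) ;;
        IfS (Rd 0 (V ''p'')) (Asg ''act'' (C 0))
          (Asg ''t'' (V ''p'') ;; Asg ''lab'' (Minus (Rd 1 (V ''p'')) (C 1)))))
     (IfS (ELt (V ''v'') (V ''n''))
       (Asg ''t'' (Rd 16 (Plus (V ''nn'') (Plus (V ''N'') (V ''v'')))) ;;
        Asg ''lab'' (V ''v'') ;; Asg ''v'' (Plus (V ''v'') (C 1)) ;; Asg ''act'' (C 1))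
       Skip)"

definition prepare :: stm where
  "prepare = (Asg ''nn'' (EMul (V ''n'') ''n'') ;; Asg ''NN'' (Plus (V ''N'') (V ''n'')))"

definition count_children :: stm where
  "count_children = For ''x'' (V ''N'') (IfS (EEq (V ''x'') (V ''root'')) Skip
     (Sto 0 (parent_of ''x'') (Plus (Rd 0 (parent_of ''x'')) (C 1))))"

definition list_merges :: stm where
  "list_merges = (count_children ;; For ''x'' (V ''NN'') climb)"

definition same :: "reg \<Rightarrow> reg \<Rightarrow> exp" where
  "same u v = EEq (Rd 10 (V u)) (Rd 10 (V v))"

definition twin_exp :: "reg \<Rightarrow> reg \<Rightarrow> exp" where
  "twin_exp u v = EAll ''q'' ''n'' (EOr (same ''q'' v) (EEq (adj u ''q'') (adj v ''q'')))"

definition first_exp :: exp where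
  "first_exp = EAll ''y'' ''n'' (EOr (ENot (EAnd (same ''y'' ''s'') (ELt (V ''y'') (V ''s'')))) (ENot (twin_exp ''y'' ''s'')))"

definition cls_exp :: exp where
  "cls_exp = Sum ''s'' (V ''n'') (EBool (EAnd (EAnd (same ''s'' ''u'') first_exp)
     (EAll ''y'' ''n'' (EOr (ENot (same ''y'' ''u'')) (EOr (ELt (V ''s'') (V ''y'')) (ENot (twin_exp ''y'' ''u'')))))))"

definition update :: stm where
  "update = (Asg ''a'' (Rd 2 (V ''i'')) ;; Asg ''c'' (Rd 3 (V ''i'')) ;;
     For ''u'' (V ''n'') (Sto 10 (V ''u'') (Cond (EEq (Rd 4 (V ''u'')) (V ''c'')) (V ''a'') (Rd 4 (V ''u'')))) ;;
     For ''u'' (V ''n'') (Sto 11 (V ''u'') cls_exp))"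

definition commit :: stm where
  "commit = (For ''u'' (V ''n'') (Sto 4 (V ''u'') (Rd 10 (V ''u''))) ;;
     For ''u'' (V ''n'') (Sto 5 (V ''u'') (Rd 11 (V ''u''))))"

definition init :: stm where
  "init = (For ''u'' (V ''n'') (Sto 4 (V ''u'') (V ''u'')) ;; For ''u'' (V ''n'') (Sto 5 (V ''u'') (C 0)))"

definition find_width :: stm where
  "find_width = (Asg ''W'' (C 1) ;; init ;;
     For ''i'' (V ''m'') (update ;; commit ;;
       For ''u'' (V ''n'') (Asg ''W'' (Plus (V ''W'') (Minus (Plus (Rd 5 (V ''u'')) (C 1)) (V ''W''))))))"

definition powers1 :: stm where
  "powers1 = (Asg ''W2'' (Plus (V ''W'') (V ''W'')) ;; Asg ''g'' (C 1) ;; Asg ''b'' (Plus (V ''n'') (C 1)))"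

definition powers2 :: stm where
  "powers2 = (For ''x'' (V ''W2'') (Sto 8 (V ''x'') (V ''g'') ;; Asg ''g'' (Plus (V ''g'') (V ''g''))) ;;
     Asg ''D'' (V ''g'') ;; Asg ''g'' (C 1))"

definition powers3 :: stm where
  "powers3 = (For ''x'' (V ''D'') (Sto 9 (V ''x'') (V ''g'') ;; Asg ''g'' (EMul (V ''g'') ''b'')) ;;
     Asg ''M'' (V ''g''))"

definition powers4 :: stm where
  "powers4 = Asg ''L'' (EMul (EMul (EMul (V ''b'') ''M'') ''M'') ''M'')"

definition bit_recurrence :: exp where
  "bit_recurrence = Cond (ELt (V ''x'') (Rd 8 (V ''y''))) (C 0)
     (Cond (ELt (V ''x'') (Plus (Rd 8 (V ''y'')) (Rd 8 (V ''y'')))) (C 1)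
       (Rd 13 (Plus (EMul (Minus (V ''x'') (Plus (Rd 8 (V ''y'')) (Rd 8 (V ''y'')))) ''W2'') (V ''y''))))"

definition fill_bits :: stm where
  "fill_bits = For ''x'' (V ''D'') (For ''y'' (V ''W2'')
     (Sto 13 (Plus (EMul (V ''x'') ''W2'') (V ''y'')) bit_recurrence))"

definition init_tables :: stm where
  "init_tables = For ''x'' (V ''n'') (For ''y'' (V ''M'') (Sto 6 (Plus (EMul (V ''x'') ''M'') (V ''y''))
     (EBool (EEq (Plus (V ''y'') (Rd 9 (Rd 8 (V ''W'')))) (Plus (V ''b'') (EMul (Rd 9 (Rd 8 (V ''W''))) ''k''))))))"

definition bit_exp :: "reg \<Rightarrow> exp \<Rightarrow> exp" where
  "bit_exp x e = Rd 13 (Plus (EMul (V x) ''W2'') e)"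

definition hit_exp :: "reg \<Rightarrow> exp" where
  "hit_exp u = EOr (EAnd (EEq (Rd 4 (V u)) (V ''a'')) (bit_exp ''p'' (Rd 5 (V u))))
     (EAnd (EEq (Rd 4 (V u)) (V ''c'')) (bit_exp ''q'' (Rd 5 (V u))))"

definition compatible_exp :: exp where
  "compatible_exp = EAll ''u'' ''n'' (EAll ''v'' ''n'' (ENot (EAnd (EAnd (EEq (Rd 4 (V ''u'')) (V ''a'')) (EEq (Rd 4 (V ''v'')) (V ''c'')))
     (EAnd (EAnd (hit_exp ''u'') (hit_exp ''v'')) (adj ''u'' ''v'')))))"

definition still_undom_exp :: exp where
  "still_undom_exp = EOr
     (EAnd (EAnd (EEq (Rd 4 (V ''u'')) (V ''a'')) (bit_exp ''p'' (Plus (V ''W'') (Rd 5 (V ''u'')))))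
       (EAll ''v'' ''n'' (ENot (EAnd (EAnd (EEq (Rd 4 (V ''v'')) (V ''c'')) (hit_exp ''v'')) (adj ''u'' ''v'')))))
     (EAnd (EAnd (EEq (Rd 4 (V ''u'')) (V ''c'')) (bit_exp ''q'' (Plus (V ''W'') (Rd 5 (V ''u'')))))
       (EAll ''v'' ''n'' (ENot (EAnd (EAnd (EEq (Rd 4 (V ''v'')) (V ''a'')) (hit_exp ''v'')) (adj ''u'' ''v'')))))"

definition merge_exp :: exp where
  "merge_exp = Sum ''s'' (V ''W2'') (Cond (EEx ''u'' ''n'' (EOr (EAnd (hit_exp ''u'') (EEq (Rd 11 (V ''u'')) (V ''s'')))
     (EAnd still_undom_exp (EEq (Plus (V ''W'') (Rd 11 (V ''u''))) (V ''s''))))) (Rd 8 (V ''s'')) (C 0))"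

definition weight_exp :: exp where
  "weight_exp = Plus (Rd 9 (V ''p'')) (EMul (Plus (Rd 9 (V ''q''))
     (EMul (Plus (Rd 9 merge_exp) (V ''M'')) ''M'')) ''M'')"

definition fill_weights :: stm where
  "fill_weights = For ''p'' (V ''D'') (For ''q'' (V ''D'') (Sto 12 (Plus (EMul (V ''p'') ''D'') (V ''q''))
     (Cond compatible_exp weight_exp (C 0))))"

definition weight_at :: exp where
  "weight_at = Rd 12 (Plus (EMul (V ''p'') ''D'') (V ''q''))"

definition reachable_exp :: exp where
  "reachable_exp = EOr (EEq (V ''x'') (C 0)) (EEx ''p'' ''D'' (EEx ''q'' ''D''
     (EAnd weight_at (EAnd (ENot (ELt (V ''x'') weight_at)) (Rd 7 (Minus (V ''x'') weight_at))))))"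

definition fill_reachable :: stm where
  "fill_reachable = For ''x'' (V ''L'') (Sto 7 (V ''x'') (EBool reachable_exp))"

definition joined_exp :: exp where
  "joined_exp = EEx ''x'' ''M'' (EEx ''y'' ''M''
     (EAnd (EAnd (Rd 6 (Plus (EMul (V ''a'') ''M'') (V ''x''))) (Rd 6 (Plus (EMul (V ''c'') ''M'') (V ''y''))))
       (Rd 7 (Plus (V ''x'') (EMul (Plus (V ''y'') (EMul (Plus (V ''z'') (EMul (V ''k'') ''M'')) ''M'')) ''M'')))))"

definition join_tables :: stm where
  "join_tables = (For ''z'' (V ''M'') (Sto 14 (V ''z'') (EBool joined_exp)) ;;
     For ''z'' (V ''M'') (Sto 6 (Plus (EMul (V ''a'') ''M'') (V ''z'')) (Rd 14 (V ''z''))))"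

definition merge_step :: stm where
  "merge_step = (update ;; fill_weights ;; fill_reachable ;; join_tables ;; commit)"

definition answer :: stm where
  "answer = Asg ''out'' (EBool (Rd 6 (Plus (EMul (Rd 4 (C 0)) ''M'') (EMul (V ''k'') ''b''))))"

definition dynamic_program :: stm where
  "dynamic_program = (fill_bits ;; init ;; init_tables ;; For ''i'' (V ''m'') merge_step ;; answer)"


section \<open>Digit sums\<close>

lemma digit_of_power_sum:
  fixes b :: nat
  assumes "k < b"
  shows "((\<Sum>i<k. b ^ g i) div b ^ e) mod b = card {i. i < k \<and> g i = e}"
proof -
  have b: "0 < b" using assms by simp
  have split: "(\<Sum>i<k. b ^ g i) = (\<Sum>i | i < k \<and> g i < e. b ^ g i) + (\<Sum>i | i < k \<and> g i = e. b ^ g i)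
      + (\<Sum>i | i < k \<and> e < g i. b ^ g i)"
  proof -
    have "{..<k} = {i. i < k \<and> g i < e} \<union> {i. i < k \<and> g i = e} \<union> {i. i < k \<and> e < g i}" by auto
    then have "(\<Sum>i<k. b ^ g i) = (\<Sum>i\<in>{i. i < k \<and> g i < e} \<union> {i. i < k \<and> g i = e} \<union> {i. i < k \<and> e < g i}. b ^ g i)"
      by simp
    also have "\<dots> = (\<Sum>i\<in>{i. i < k \<and> g i < e} \<union> {i. i < k \<and> g i = e}. b ^ g i) + (\<Sum>i | i < k \<and> e < g i. b ^ g i)"
      by (intro sum.union_disjoint) auto
    also have "(\<Sum>i\<in>{i. i < k \<and> g i < e} \<union> {i. i < k \<and> g i = e}. b ^ g i) = (\<Sum>i | i < k \<and> g i < e. b ^ g i) + (\<Sum>i | i < k \<and> g i = e. b ^ g i)"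
      by (intro sum.union_disjoint) auto
    finally show ?thesis .
  qed
  have mid: "(\<Sum>i | i < k \<and> g i = e. b ^ g i) = b ^ e * card {i. i < k \<and> g i = e}"
    by (simp add: sum.cong)
  have "b ^ Suc e dvd (\<Sum>i | i < k \<and> e < g i. b ^ g i)"
    by (intro dvd_sum le_imp_power_dvd) auto
  then obtain R where "(\<Sum>i | i < k \<and> e < g i. b ^ g i) = b ^ Suc e * R" by (rule dvdE)
  then have R: "(\<Sum>i | i < k \<and> e < g i. b ^ g i) = b ^ e * (b * R)" by (simp add: algebra_simps)
  have low: "(\<Sum>i | i < k \<and> g i < e. b ^ g i) < b ^ e"
  proof (cases "e = 0")
    case True
    then show ?thesis by simp
  next
    case False
    then obtain d where d: "e = Suc d" by (cases e) auto
    have "(\<Sum>i | i < k \<and> g i < e. b ^ g i) \<le> (\<Sum>i | i < k \<and> g i < e. b ^ d)"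
      using b d by (intro sum_mono power_increasing) auto
    also have "\<dots> \<le> (\<Sum>i<k. b ^ d)"
      by (intro sum_mono2) auto
    also have "\<dots> = k * b ^ d" by simp
    also have "\<dots> < b ^ e" using assms b d by simp
    finally show ?thesis .
  qed
  have "{i. i < k \<and> g i = e} \<subseteq> {..<k}" by auto
  from card_mono[OF _ this] have card: "card {i. i < k \<and> g i = e} < b"
    using assms by simp
  let ?l = "\<Sum>i | i < k \<and> g i < e. b ^ g i" and ?c = "card {i. i < k \<and> g i = e}"
  have "(\<Sum>i<k. b ^ g i) = ?l + b ^ e * (?c + b * R)"
    unfolding split mid R by (simp add: algebra_simps)
  then have "(\<Sum>i<k. b ^ g i) div b ^ e = ?c + b * R"
    using low b by simp
  then show ?thesis using card by simp
qed

lemma power_sum_inj: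
  fixes b :: nat
  assumes "k < b" "(\<Sum>i<k. b ^ g i) = (\<Sum>i<k. b ^ h i)"
  obtains p where "p permutes {..<k}" "\<And>i. i < k \<Longrightarrow> g i = h (p i)"
proof -
  have "image_mset g (mset_set {..<k}) = image_mset h (mset_set {..<k})"
  proof (rule multiset_eqI)
    fix e
    have "count (image_mset f (mset_set {..<k})) e = card {i. i < k \<and> f i = e}" for f :: "nat \<Rightarrow> nat"
    proof -
      have "f -` {e} \<inter> {..<k} = {i. i < k \<and> f i = e}" by auto
      then show ?thesis by (simp add: count_image_mset)
    qed
    then show "count (image_mset g (mset_set {..<k})) e = count (image_mset h (mset_set {..<k})) e"
      using digit_of_power_sum[OF assms(1), of g e] digit_of_power_sum[OF assms(1), of h e] assms(2) by simp
  qed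
  from image_mset_eq_implies_permutes[OF finite_lessThan this] obtain p
    where "p permutes {..<k}" "\<forall>i\<in>{..<k}. g i = h (p i)" by blast
  with that show thesis by blast
qed

lemma power_sum_less:
  fixes b :: nat
  assumes "l < b" "\<And>i. i < l \<Longrightarrow> g i < D"
  shows "(\<Sum>i<l. b ^ g i) < b ^ D"
proof (cases "l = 0")
  case True
  then show ?thesis using assms by simp
next
  case False
  then obtain d where d: "D = Suc d" using assms(2)[of 0] by (cases D) auto
  have "(\<Sum>i<l. b ^ g i) \<le> (\<Sum>i<l. b ^ d)"
  proof (rule sum_mono)
    fix i assume "i \<in> {..<l}"
    then have "g i \<le> d" using assms(2)[of i] d by simp
    then show "b ^ g i \<le> b ^ d" using assms(1) by (intro power_increasing) auto
  qed
  also have "\<dots> < b ^ D" using assms(1) d by simp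
  finally show ?thesis .
qed

section \<open>Types of color classes\<close>

locale fall_dp =
  fixes n :: nat and E :: "nat \<Rightarrow> nat \<Rightarrow> bool"
  assumes E_sym: "E u v \<Longrightarrow> E v u"
    and E_irrefl: "\<not> E u u"
begin

definition twin :: "nat set \<Rightarrow> nat \<Rightarrow> nat \<Rightarrow> bool" where
  "twin S u v \<longleftrightarrow> (\<forall>x<n. x \<notin> S \<longrightarrow> E u x = E v x)"

definition firsts :: "nat set \<Rightarrow> nat set" where
  "firsts S = {v \<in> S. \<forall>y\<in>S. y < v \<longrightarrow> \<not> twin S y v}"

definition cls :: "nat set \<Rightarrow> nat \<Rightarrow> nat" where
  "cls S u = card {v \<in> firsts S. \<forall>y\<in>S. y \<le> v \<longrightarrow> \<not> twin S y u}"

lemma twin_refl [simp]: "twin S u u"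
  by (simp add: twin_def)

lemma twin_sym: "twin S u v \<Longrightarrow> twin S v u"
  by (simp add: twin_def)

lemma twin_trans: "twin S u v \<Longrightarrow> twin S v x \<Longrightarrow> twin S u x"
  by (simp add: twin_def)

lemma twin_mono: "twin S u v \<Longrightarrow> S \<subseteq> S' \<Longrightarrow> twin S' u v"
  by (auto simp: twin_def)

lemma ex_first:
  assumes "u \<in> S"
  obtains v where "v \<in> firsts S" "twin S v u" "\<forall>y\<in>S. twin S y u \<longrightarrow> v \<le> y"
proof
  let ?v = "LEAST v. v \<in> S \<and> twin S v u"
  have v: "?v \<in> S \<and> twin S ?v u" 
    by (rule LeastI[of "\<lambda>v. v \<in> S \<and> twin S v u" u]) (use assms in simp)
  have le: "?v \<le> y" if "y \<in> S" "twin S y u" for y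
    by (rule Least_le) (use that in simp)
  then show "\<forall>y\<in>S. twin S y u \<longrightarrow> ?v \<le> y" by blast
  show "twin S ?v u" using v ..
  show "?v \<in> firsts S"
    unfolding firsts_def using v le twin_trans by (auto simp: not_le[symmetric])
qed

lemma finite_firsts: "finite S \<Longrightarrow> finite (firsts S)"
  by (auto simp: firsts_def)

lemma cls_less:
  assumes "finite S" "u \<in> S"
  shows "cls S u < card (firsts S)"
proof -
  obtain v where v: "v \<in> firsts S" "twin S v u" using ex_first[OF assms(2)] by blast
  then have "v \<in> S" by (simp add: firsts_def)
  then show ?thesis unfolding cls_def
    using v finite_firsts[OF assms(1)] by (intro psubset_card_mono psubsetI) (blast, blast, blast)
qed

lemma cls_eq_iff:
  assumes "finite S" "u \<in> S" "v \<in> S"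
  shows "cls S u = cls S v \<longleftrightarrow> twin S u v"
proof
  assume "twin S u v"
  then have "twin S y u \<longleftrightarrow> twin S y v" for y by (meson twin_sym twin_trans)
  then show "cls S u = cls S v" unfolding cls_def by (simp only:)
next
  have less: "cls S u < cls S v"
    if uv: "u \<in> S" "v \<in> S" and a: "a \<in> firsts S" "twin S a u" "\<forall>y\<in>S. twin S y u \<longrightarrow> a \<le> y"
      and b: "\<forall>y\<in>S. twin S y v \<longrightarrow> b \<le> y" and ab: "a < b" for u v a b
  proof -
    have "a \<in> S" using a by (simp add: firsts_def)
    let ?U = "{z \<in> firsts S. \<forall>y\<in>S. y \<le> z \<longrightarrow> \<not> twin S y u}"
    let ?V = "{z \<in> firsts S. \<forall>y\<in>S. y \<le> z \<longrightarrow> \<not> twin S y v}"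
    have "?U \<subseteq> ?V"
    proof
      fix z assume z: "z \<in> ?U"
      then have "z < a" using a(2) \<open>a \<in> S\<close> by force
      then show "z \<in> ?V" using z ab b by force
    qed
    moreover have "a \<in> ?V" using a(1) ab b by force
    moreover have "a \<notin> ?U" using a(2) \<open>a \<in> S\<close> by auto
    ultimately show ?thesis unfolding cls_def
      using finite_firsts[OF assms(1)] by (intro psubset_card_mono) auto
  qed
  assume eq: "cls S u = cls S v"
  obtain a where a: "a \<in> firsts S" "twin S a u" "\<forall>y\<in>S. twin S y u \<longrightarrow> a \<le> y"
    using ex_first[OF assms(2)] by blast
  obtain b where b: "b \<in> firsts S" "twin S b v" "\<forall>y\<in>S. twin S y v \<longrightarrow> b \<le> y"
    using ex_first[OF assms(3)] by blast
  have "a = b"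
    using less[OF assms(2,3) a b(3)] less[OF assms(3,2) b a(3)] eq by (cases a b rule: linorder_cases) simp_all
  then show "twin S u v" using a b twin_sym twin_trans by blast
qed

lemma cls_eq_adj:
  assumes "finite S" "u \<in> S" "v \<in> S" "cls S u = cls S v" "x < n" "x \<notin> S"
  shows "E u x = E v x"
  using assms by (simp add: cls_eq_iff twin_def)

lemma cls_mono:
  assumes "finite S'" "S \<subseteq> S'" "u \<in> S" "v \<in> S" "cls S u = cls S v"
  shows "cls S' u = cls S' v"
  using assms cls_eq_iff[of S u v] cls_eq_iff[of S' u v] twin_mono[of S u v S']
  by (meson finite_subset subsetD)

definition undom :: "nat set \<Rightarrow> nat set \<Rightarrow> nat set" where
  "undom S X = {u \<in> S. u \<notin> X \<and> (\<forall>v\<in>X. \<not> E u v)}"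

text \<open>The classes of \<open>S\<close> that meet the color class \<open>X\<close>, and, shifted by \<open>W\<close>, those that contain
  a vertex which \<open>X\<close> leaves undominated.\<close>

definition type_set :: "nat \<Rightarrow> nat set \<Rightarrow> nat set \<Rightarrow> nat set" where
  "type_set W S X = cls S ` X \<union> (\<lambda>u. W + cls S u) ` undom S X"

abbreviation type_code :: "nat \<Rightarrow> nat set \<Rightarrow> nat set \<Rightarrow> nat" where
  "type_code W S X \<equiv> set_encode (type_set W S X)"

definition hit :: "nat set \<Rightarrow> nat set \<Rightarrow> nat \<Rightarrow> nat \<Rightarrow> nat \<Rightarrow> bool" where
  "hit S1 S2 p q u \<longleftrightarrow> (u \<in> S1 \<and> cls S1 u \<in> set_decode p) \<or> (u \<in> S2 \<and> cls S2 u \<in> set_decode q)"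

definition compatible :: "nat set \<Rightarrow> nat set \<Rightarrow> nat \<Rightarrow> nat \<Rightarrow> bool" where
  "compatible S1 S2 p q \<longleftrightarrow> (\<forall>u\<in>S1. \<forall>v\<in>S2. hit S1 S2 p q u \<longrightarrow> hit S1 S2 p q v \<longrightarrow> \<not> E u v)"

definition still_undom :: "nat \<Rightarrow> nat set \<Rightarrow> nat set \<Rightarrow> nat \<Rightarrow> nat \<Rightarrow> nat \<Rightarrow> bool" where
  "still_undom W S1 S2 p q u \<longleftrightarrow>
     (u \<in> S1 \<and> W + cls S1 u \<in> set_decode p \<and> (\<forall>v\<in>S2. hit S1 S2 p q v \<longrightarrow> \<not> E u v)) \<or>
     (u \<in> S2 \<and> W + cls S2 u \<in> set_decode q \<and> (\<forall>v\<in>S1. hit S1 S2 p q v \<longrightarrow> \<not> E u v))"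

definition merge_type :: "nat \<Rightarrow> nat set \<Rightarrow> nat set \<Rightarrow> nat \<Rightarrow> nat \<Rightarrow> nat" where
  "merge_type W S1 S2 p q = set_encode
     (cls (S1 \<union> S2) ` {u. hit S1 S2 p q u} \<union> (\<lambda>u. W + cls (S1 \<union> S2) u) ` {u. still_undom W S1 S2 p q u})"

lemma finite_type_set: "finite S \<Longrightarrow> X \<subseteq> S \<Longrightarrow> finite (type_set W S X)"
  by (auto simp: type_set_def undom_def intro: finite_subset)

lemma type_set_less: "X \<subseteq> S \<Longrightarrow> \<forall>u\<in>S. cls S u < W \<Longrightarrow> type_set W S X \<subseteq> {..<2 * W}"
  by (force simp: type_set_def undom_def)

lemma set_encode_less: "A \<subseteq> {..<m} \<Longrightarrow> set_encode A < 2 ^ m"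
proof -
  assume A: "A \<subseteq> {..<m}"
  then have "set_encode A \<le> (\<Sum>i<m. 2 ^ i)"
    unfolding set_encode_def by (intro sum_mono2) auto
  also have "\<dots> < 2 ^ m"
    by (induction m) auto
  finally show ?thesis .
qed

lemma type_code_less:
  assumes "X \<subseteq> S" "\<forall>u\<in>S. cls S u < W"
  shows "type_code W S X < 2 ^ (2 * W)"
  using type_set_less[OF assms] by (rule set_encode_less)

lemma hit_iff:
  assumes "finite S1" "finite S2" "S1 \<inter> S2 = {}" "X1 \<subseteq> S1" "X2 \<subseteq> S2"
    and W: "\<forall>u\<in>S1. cls S1 u < W" "\<forall>u\<in>S2. cls S2 u < W"
  shows "hit S1 S2 (type_code W S1 X1) (type_code W S2 X2) u \<longleftrightarrow>
    (u \<in> S1 \<and> (\<exists>x\<in>X1. cls S1 u = cls S1 x)) \<or> (u \<in> S2 \<and> (\<exists>x\<in>X2. cls S2 u = cls S2 x))"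
proof -
  have "cls S1 u \<in> type_set W S1 X1 \<longleftrightarrow> (\<exists>x\<in>X1. cls S1 u = cls S1 x)" if "u \<in> S1"
    using W(1) that by (auto simp: type_set_def)
  moreover have "cls S2 u \<in> type_set W S2 X2 \<longleftrightarrow> (\<exists>x\<in>X2. cls S2 u = cls S2 x)" if "u \<in> S2"
    using W(2) that by (auto simp: type_set_def)
  ultimately show ?thesis
    unfolding hit_def using assms finite_type_set by auto
qed

lemma shifted_mem_type_set:
  assumes "u \<in> S" "X \<subseteq> S" "\<forall>u\<in>S. cls S u < W"
  shows "W + cls S u \<in> type_set W S X \<longleftrightarrow> (\<exists>x\<in>undom S X. cls S u = cls S x)"
proof
  assume "W + cls S u \<in> type_set W S X"
  moreover have "W + cls S u \<notin> cls S ` X" using assms(2,3) by fastforce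
  ultimately show "\<exists>x\<in>undom S X. cls S u = cls S x" by (auto simp: type_set_def)
qed (auto simp: type_set_def)

lemma adj_hit:
  assumes "finite S1" "finite S2" "S1 \<inter> S2 = {}" "X1 \<subseteq> S1" "X2 \<subseteq> S2" "S1 \<subseteq> {..<n}" "S2 \<subseteq> {..<n}"
    and W: "\<forall>u\<in>S1. cls S1 u < W" "\<forall>u\<in>S2. cls S2 u < W"
  shows "u \<in> S1 \<Longrightarrow> (\<exists>v\<in>S2. hit S1 S2 (type_code W S1 X1) (type_code W S2 X2) v \<and> E u v) \<longleftrightarrow>
      (\<exists>v\<in>X2. E u v)"
    and "u \<in> S2 \<Longrightarrow> (\<exists>v\<in>S1. hit S1 S2 (type_code W S1 X1) (type_code W S2 X2) v \<and> E u v) \<longleftrightarrow>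
      (\<exists>v\<in>X1. E u v)"
proof -
  show "(\<exists>v\<in>S2. hit S1 S2 (type_code W S1 X1) (type_code W S2 X2) v \<and> E u v) \<longleftrightarrow> (\<exists>v\<in>X2. E u v)"
    if "u \<in> S1"
  proof
    assume "\<exists>v\<in>S2. hit S1 S2 (type_code W S1 X1) (type_code W S2 X2) v \<and> E u v"
    then obtain v x where v: "v \<in> S2" "E u v" "x \<in> X2" "cls S2 v = cls S2 x"
      using hit_iff[OF assms(1-5) W] assms(3) by auto
    have "E v u = E x u" using v that assms by (intro cls_eq_adj[of S2]) auto
    then show "\<exists>v\<in>X2. E u v" using v E_sym by blast
  next
    assume "\<exists>v\<in>X2. E u v"
    then show "\<exists>v\<in>S2. hit S1 S2 (type_code W S1 X1) (type_code W S2 X2) v \<and> E u v"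
      using hit_iff[OF assms(1-5) W] assms(5) by blast
  qed
  show "(\<exists>v\<in>S1. hit S1 S2 (type_code W S1 X1) (type_code W S2 X2) v \<and> E u v) \<longleftrightarrow> (\<exists>v\<in>X1. E u v)"
    if "u \<in> S2"
  proof
    assume "\<exists>v\<in>S1. hit S1 S2 (type_code W S1 X1) (type_code W S2 X2) v \<and> E u v"
    then obtain v x where v: "v \<in> S1" "E u v" "x \<in> X1" "cls S1 v = cls S1 x"
      using hit_iff[OF assms(1-5) W] assms(3) by auto
    have "E v u = E x u" using v that assms by (intro cls_eq_adj[of S1]) auto
    then show "\<exists>v\<in>X1. E u v" using v E_sym by blast
  next
    assume "\<exists>v\<in>X1. E u v"
    then show "\<exists>v\<in>S1. hit S1 S2 (type_code W S1 X1) (type_code W S2 X2) v \<and> E u v"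
      using hit_iff[OF assms(1-5) W] assms(4) by blast
  qed
qed

lemma compatible_iff:
  assumes "finite S1" "finite S2" "S1 \<inter> S2 = {}" "X1 \<subseteq> S1" "X2 \<subseteq> S2" "S1 \<subseteq> {..<n}" "S2 \<subseteq> {..<n}"
    and W: "\<forall>u\<in>S1. cls S1 u < W" "\<forall>u\<in>S2. cls S2 u < W"
  shows "compatible S1 S2 (type_code W S1 X1) (type_code W S2 X2) \<longleftrightarrow> (\<forall>u\<in>X1. \<forall>v\<in>X2. \<not> E u v)"
proof -
  let ?h = "hit S1 S2 (type_code W S1 X1) (type_code W S2 X2)"
  have "compatible S1 S2 (type_code W S1 X1) (type_code W S2 X2) \<longleftrightarrow>
      (\<forall>u\<in>S1. ?h u \<longrightarrow> \<not> (\<exists>v\<in>S2. ?h v \<and> E u v))"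
    unfolding compatible_def by blast
  also have "\<dots> \<longleftrightarrow> (\<forall>u\<in>S1. ?h u \<longrightarrow> \<not> (\<exists>v\<in>X2. E u v))"
    using adj_hit(1)[OF assms] by simp
  also have "\<dots> \<longleftrightarrow> (\<forall>v\<in>X2. \<not> (\<exists>u\<in>S1. ?h u \<and> E v u))"
    using E_sym by blast
  also have "\<dots> \<longleftrightarrow> (\<forall>v\<in>X2. \<not> (\<exists>u\<in>X1. E v u))"
    using adj_hit(2)[OF assms] assms(5) by (meson subsetD)
  also have "\<dots> \<longleftrightarrow> (\<forall>u\<in>X1. \<forall>v\<in>X2. \<not> E u v)"
    using E_sym by blast
  finally show ?thesis .
qed

lemma merge_type_eq:
  assumes "finite S1" "finite S2" "S1 \<inter> S2 = {}" "X1 \<subseteq> S1" "X2 \<subseteq> S2" "S1 \<subseteq> {..<n}" "S2 \<subseteq> {..<n}"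
    and W: "\<forall>u\<in>S1. cls S1 u < W" "\<forall>u\<in>S2. cls S2 u < W"
  shows "merge_type W S1 S2 (type_code W S1 X1) (type_code W S2 X2) = type_code W (S1 \<union> S2) (X1 \<union> X2)"
proof -
  let ?p = "type_code W S1 X1" and ?q = "type_code W S2 X2" and ?S = "S1 \<union> S2"
  have fin: "finite ?S" using assms by simp
  note hi = hit_iff[OF assms(1-5) W]
  have "cls ?S ` {u. hit S1 S2 ?p ?q u} = cls ?S ` (X1 \<union> X2)"
  proof (intro equalityI subsetI)
    fix c assume "c \<in> cls ?S ` {u. hit S1 S2 ?p ?q u}"
    then obtain u where u: "hit S1 S2 ?p ?q u" "c = cls ?S u" by auto
    from u(1)[unfolded hi] show "c \<in> cls ?S ` (X1 \<union> X2)"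
    proof (elim disjE conjE bexE)
      fix x assume "u \<in> S1" "x \<in> X1" "cls S1 u = cls S1 x"
      then have "cls ?S u = cls ?S x" using assms(4) by (intro cls_mono[OF fin, of S1]) auto
      then show ?thesis using u \<open>x \<in> X1\<close> by auto
    next
      fix x assume "u \<in> S2" "x \<in> X2" "cls S2 u = cls S2 x"
      then have "cls ?S u = cls ?S x" using assms(5) by (intro cls_mono[OF fin, of S2]) auto
      then show ?thesis using u \<open>x \<in> X2\<close> by auto
    qed
  next
    fix c assume "c \<in> cls ?S ` (X1 \<union> X2)"
    then show "c \<in> cls ?S ` {u. hit S1 S2 ?p ?q u}" using hi assms(4,5) by blast
  qed
  moreover have "(\<lambda>u. W + cls ?S u) ` {u. still_undom W S1 S2 ?p ?q u} =
      (\<lambda>u. W + cls ?S u) ` undom ?S (X1 \<union> X2)"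
  proof -
    have d1: "W + cls S1 u \<in> set_decode ?p \<longleftrightarrow> (\<exists>x\<in>undom S1 X1. cls S1 u = cls S1 x)" if "u \<in> S1" for u
      using shifted_mem_type_set[OF that assms(4) W(1)] finite_type_set[OF assms(1,4)] by simp
    have d2: "W + cls S2 u \<in> set_decode ?q \<longleftrightarrow> (\<exists>x\<in>undom S2 X2. cls S2 u = cls S2 x)" if "u \<in> S2" for u
      using shifted_mem_type_set[OF that assms(5) W(2)] finite_type_set[OF assms(2,5)] by simp
    have su: "still_undom W S1 S2 ?p ?q u \<longleftrightarrow>
       (u \<in> S1 \<and> (\<exists>x\<in>undom S1 X1. cls S1 u = cls S1 x) \<and> (\<forall>v\<in>X2. \<not> E u v)) \<or>
       (u \<in> S2 \<and> (\<exists>x\<in>undom S2 X2. cls S2 u = cls S2 x) \<and> (\<forall>v\<in>X1. \<not> E u v))" for u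
      unfolding still_undom_def using d1[of u] d2[of u] adj_hit[OF assms, of u] by blast
    show ?thesis
    proof (intro equalityI subsetI)
      fix c assume "c \<in> (\<lambda>u. W + cls ?S u) ` {u. still_undom W S1 S2 ?p ?q u}"
      then obtain u where u: "still_undom W S1 S2 ?p ?q u" "c = W + cls ?S u" by auto
      from u(1)[unfolded su] show "c \<in> (\<lambda>u. W + cls ?S u) ` undom ?S (X1 \<union> X2)"
      proof (elim disjE conjE bexE)
        fix x assume x: "u \<in> S1" "x \<in> undom S1 X1" "cls S1 u = cls S1 x" "\<forall>v\<in>X2. \<not> E u v"
        have xS: "x \<in> S1" using x by (simp add: undom_def)
        have "E u v = E x v" if "v \<in> X2" for v
          using x xS that assms by (intro cls_eq_adj[of S1]) auto
        then have "x \<in> undom ?S (X1 \<union> X2)" using x xS assms(3,5) by (auto simp: undom_def)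
        moreover have "cls ?S u = cls ?S x" using x xS by (intro cls_mono[OF fin, of S1]) auto
        ultimately show ?thesis using u by auto
      next
        fix x assume x: "u \<in> S2" "x \<in> undom S2 X2" "cls S2 u = cls S2 x" "\<forall>v\<in>X1. \<not> E u v"
        have xS: "x \<in> S2" using x by (simp add: undom_def)
        have "E u v = E x v" if "v \<in> X1" for v
          using x xS that assms by (intro cls_eq_adj[of S2]) auto
        then have "x \<in> undom ?S (X1 \<union> X2)" using x xS assms(3,4) by (auto simp: undom_def)
        moreover have "cls ?S u = cls ?S x" using x xS by (intro cls_mono[OF fin, of S2]) auto
        ultimately show ?thesis using u by auto
      qed
    next
      fix c assume "c \<in> (\<lambda>u. W + cls ?S u) ` undom ?S (X1 \<union> X2)"
      then obtain u where u: "u \<in> undom ?S (X1 \<union> X2)" "c = W + cls ?S u" by auto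
      have "still_undom W S1 S2 ?p ?q u" unfolding su using u(1) by (auto simp: undom_def)
      then show "c \<in> (\<lambda>u. W + cls ?S u) ` {u. still_undom W S1 S2 ?p ?q u}" using u by auto
    qed
  qed
  ultimately show ?thesis unfolding merge_type_def type_set_def by simp
qed

section \<open>Tables\<close>

definition proper :: "nat \<Rightarrow> nat set \<Rightarrow> (nat \<Rightarrow> nat) \<Rightarrow> bool" where
  "proper k S f \<longleftrightarrow> (\<forall>u\<in>S. f u < k) \<and> (\<forall>u\<in>S. \<forall>v\<in>S. E u v \<longrightarrow> f u \<noteq> f v)"

definition signature :: "nat \<Rightarrow> nat \<Rightarrow> nat \<Rightarrow> nat set \<Rightarrow> (nat \<Rightarrow> nat) \<Rightarrow> nat" where
  "signature W b k S f = (\<Sum>i<k. b ^ type_code W S {u \<in> S. f u = i})"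

definition table :: "nat \<Rightarrow> nat \<Rightarrow> nat \<Rightarrow> nat set \<Rightarrow> nat set" where
  "table W b k S = signature W b k S ` {f. proper k S f}"

lemma table_union:
  assumes "finite S1" "finite S2" "S1 \<inter> S2 = {}" "S1 \<subseteq> {..<n}" "S2 \<subseteq> {..<n}" "k < b"
    and W: "\<forall>u\<in>S1. cls S1 u < W" "\<forall>u\<in>S2. cls S2 u < W"
  shows "x \<in> table W b k (S1 \<union> S2) \<longleftrightarrow>
    (\<exists>x1\<in>table W b k S1. \<exists>x2\<in>table W b k S2. \<exists>p q.
       (\<forall>i<k. p i < 2 ^ (2 * W) \<and> q i < 2 ^ (2 * W) \<and> compatible S1 S2 (p i) (q i)) \<and>
       x1 = (\<Sum>i<k. b ^ p i) \<and> x2 = (\<Sum>i<k. b ^ q i) \<and>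
       x = (\<Sum>i<k. b ^ merge_type W S1 S2 (p i) (q i)))"
proof
  let ?S = "S1 \<union> S2"
  assume "x \<in> table W b k ?S"
  then obtain f where f: "proper k ?S f" "x = signature W b k ?S f" by (auto simp: table_def)
  let ?X1 = "\<lambda>i. {u \<in> S1. f u = i}" and ?X2 = "\<lambda>i. {u \<in> S2. f u = i}"
  let ?p = "\<lambda>i. type_code W S1 (?X1 i)" and ?q = "\<lambda>i. type_code W S2 (?X2 i)"
  have "signature W b k S1 f \<in> table W b k S1" "signature W b k S2 f \<in> table W b k S2"
    using f(1) by (auto simp: table_def proper_def)
  moreover have "compatible S1 S2 (?p i) (?q i)" for i
  proof -
    have "\<forall>u\<in>?X1 i. \<forall>v\<in>?X2 i. \<not> E u v" using f(1) by (fastforce simp: proper_def)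
    then show ?thesis using compatible_iff[OF assms(1-3), of "?X1 i" "?X2 i" W] assms(4,5) W by simp
  qed
  moreover have "?p i < 2 ^ (2 * W)" "?q i < 2 ^ (2 * W)" for i
    using W by (auto intro: type_code_less)
  moreover have "x = (\<Sum>i<k. b ^ merge_type W S1 S2 (?p i) (?q i))"
  proof -
    have "?X1 i \<union> ?X2 i = {u \<in> ?S. f u = i}" for i by auto
    then show ?thesis using merge_type_eq[OF assms(1-3), of "?X1 _" "?X2 _"] assms(4,5) W f(2)
      by (simp add: signature_def)
  qed
  ultimately show "\<exists>x1\<in>table W b k S1. \<exists>x2\<in>table W b k S2. \<exists>p q.
       (\<forall>i<k. p i < 2 ^ (2 * W) \<and> q i < 2 ^ (2 * W) \<and> compatible S1 S2 (p i) (q i)) \<and>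
       x1 = (\<Sum>i<k. b ^ p i) \<and> x2 = (\<Sum>i<k. b ^ q i) \<and>
       x = (\<Sum>i<k. b ^ merge_type W S1 S2 (p i) (q i))"
    by (intro bexI[of _ "signature W b k S1 f"] bexI[of _ "signature W b k S2 f"] exI[of _ ?p] exI[of _ ?q])
      (simp_all add: signature_def)
next
  let ?S = "S1 \<union> S2"
  assume "\<exists>x1\<in>table W b k S1. \<exists>x2\<in>table W b k S2. \<exists>p q.
       (\<forall>i<k. p i < 2 ^ (2 * W) \<and> q i < 2 ^ (2 * W) \<and> compatible S1 S2 (p i) (q i)) \<and>
       x1 = (\<Sum>i<k. b ^ p i) \<and> x2 = (\<Sum>i<k. b ^ q i) \<and>
       x = (\<Sum>i<k. b ^ merge_type W S1 S2 (p i) (q i))"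
  then obtain x1 x2 p q where t: "x1 \<in> table W b k S1" "x2 \<in> table W b k S2"
    and pq: "\<forall>i<k. p i < 2 ^ (2 * W) \<and> q i < 2 ^ (2 * W) \<and> compatible S1 S2 (p i) (q i)"
    and x12: "x1 = (\<Sum>i<k. b ^ p i)" "x2 = (\<Sum>i<k. b ^ q i)"
    and x: "x = (\<Sum>i<k. b ^ merge_type W S1 S2 (p i) (q i))"
    by blast
  from t obtain f1 f2 where f: "proper k S1 f1" "proper k S2 f2"
    and "x1 = signature W b k S1 f1" "x2 = signature W b k S2 f2"
    unfolding table_def by blast
  with x12 have s1: "signature W b k S1 f1 = (\<Sum>i<k. b ^ p i)" and s2: "signature W b k S2 f2 = (\<Sum>i<k. b ^ q i)"
    by simp_all
  have comp: "\<And>i. i < k \<Longrightarrow> compatible S1 S2 (p i) (q i)" using pq by blast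
  obtain \<pi> where \<pi>: "\<pi> permutes {..<k}" "\<And>i. i < k \<Longrightarrow> p i = type_code W S1 {u \<in> S1. f1 u = \<pi> i}"
    using power_sum_inj[OF assms(6) s1[symmetric, unfolded signature_def]] by metis
  obtain \<rho> where \<rho>: "\<rho> permutes {..<k}" "\<And>i. i < k \<Longrightarrow> q i = type_code W S2 {u \<in> S2. f2 u = \<rho> i}"
    using power_sum_inj[OF assms(6) s2[symmetric, unfolded signature_def]] by metis
  define f where "f u = (if u \<in> S1 then inv \<pi> (f1 u) else inv \<rho> (f2 u))" for u
  have X1: "{u \<in> S1. f u = i} = {u \<in> S1. f1 u = \<pi> i}" for i
    using permutes_inverses[OF \<pi>(1)] by (auto simp: f_def)
  have X2: "{u \<in> S2. f u = i} = {u \<in> S2. f2 u = \<rho> i}" for i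
  proof -
    have "f u = i \<longleftrightarrow> f2 u = \<rho> i" if "u \<in> S2" for u
    proof -
      have "u \<notin> S1" using that assms(3) by auto
      then show ?thesis using permutes_inv_eq[OF \<rho>(1)] by (auto simp: f_def)
    qed
    then show ?thesis by blast
  qed
  have range: "f u < k" if "u \<in> ?S" for u
    using that f permutes_in_image[OF permutes_inv[OF \<pi>(1)]] permutes_in_image[OF permutes_inv[OF \<rho>(1)]]
    by (auto simp: f_def proper_def)
  have cross: "f u \<noteq> f v" if "u \<in> S1" "v \<in> S2" "E u v" for u v
  proof
    assume eq: "f u = f v"
    have "f u < k" using range that by simp
    then have "compatible S1 S2 (type_code W S1 {u' \<in> S1. f u' = f u}) (type_code W S2 {u' \<in> S2. f u' = f u})"
      using comp[of "f u"] \<pi>(2) \<rho>(2) X1 X2 by simp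
    then have "\<forall>u'\<in>{u' \<in> S1. f u' = f u}. \<forall>v\<in>{u' \<in> S2. f u' = f u}. \<not> E u' v"
      using compatible_iff[OF assms(1-3), of "{u' \<in> S1. f u' = f u}" "{u' \<in> S2. f u' = f u}"] assms(4,5) W
      by simp
    then show False using that eq by auto
  qed
  have "f u \<noteq> f v" if "u \<in> ?S" "v \<in> ?S" "E u v" for u v
  proof -
    have inj: "inv \<pi> a = inv \<pi> b \<longleftrightarrow> a = b" "inv \<rho> a = inv \<rho> b \<longleftrightarrow> a = b" for a b
      using permutes_inverses[OF \<pi>(1)] permutes_inverses[OF \<rho>(1)] by metis+
    consider "u \<in> S1" "v \<in> S1" | "u \<in> S2" "v \<in> S2" | "u \<in> S1" "v \<in> S2" | "u \<in> S2" "v \<in> S1"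
      using \<open>u \<in> ?S\<close> \<open>v \<in> ?S\<close> by blast
    then show ?thesis
    proof cases
      case 1
      then show ?thesis using f that inj by (simp add: f_def proper_def)
    next
      case 2
      then have "u \<notin> S1" "v \<notin> S1" using assms(3) by auto
      then show ?thesis using 2 f that inj by (simp add: f_def proper_def)
    next
      case 3
      then show ?thesis using cross that by blast
    next
      case 4
      then show ?thesis using cross[of v u] that E_sym by metis
    qed
  qed
  then have "proper k ?S f" using range by (simp add: proper_def)
  moreover have "x = signature W b k ?S f"
    unfolding x signature_def
  proof (intro sum.cong refl)
    fix i assume "i \<in> {..<k}"
    then have "merge_type W S1 S2 (p i) (q i) = type_code W ?S ({u \<in> S1. f u = i} \<union> {u \<in> S2. f u = i})"
      using \<pi>(2) \<rho>(2) X1 X2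
        merge_type_eq[OF assms(1-3), of "{u \<in> S1. f u = i}" "{u \<in> S2. f u = i}"] assms(4,5) W by simp
    moreover have "{u \<in> S1. f u = i} \<union> {u \<in> S2. f u = i} = {u \<in> ?S. f u = i}" by auto
    ultimately show "b ^ merge_type W S1 S2 (p i) (q i) = b ^ type_code W ?S {u \<in> ?S. f u = i}" by simp
  qed
  ultimately show "x \<in> table W b k ?S" by (auto simp: table_def)
qed

lemma firsts_singleton: "firsts {v} = {v}"
  by (auto simp: firsts_def)

lemma cls_singleton: "cls {v} v = 0"
  using cls_less[of "{v}" v] by (simp add: firsts_singleton)

lemma table_singleton:
  "table W b k {v} = (if k = 0 then {} else {b ^ 1 + (k - 1) * b ^ (2 ^ W)})"
proof (cases "k = 0")
  case True
  then show ?thesis by (auto simp: table_def proper_def)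
next
  case False
  have sig: "signature W b k {v} f = b ^ 1 + (k - 1) * b ^ (2 ^ W)" if "f v < k" for f
  proof -
    have "type_code W {v} {v} = 1"
      by (simp add: type_set_def undom_def cls_singleton set_encode_def cong: conj_cong)
    moreover have "type_code W {v} {} = 2 ^ W"
      by (simp add: type_set_def undom_def cls_singleton set_encode_def)
    ultimately have "b ^ type_code W {v} {u \<in> {v}. f u = i} = (if i = f v then b ^ 1 else b ^ (2 ^ W))" for i
      by (cases "f v = i") (simp_all add: Collect_conv_if conj_commute cong: conj_cong)
    then have "signature W b k {v} f = (\<Sum>i<k. if i = f v then b ^ 1 else b ^ (2 ^ W))"
      by (simp add: signature_def)
    also have "\<dots> = (\<Sum>i\<in>insert (f v) ({..<k} - {f v}). if i = f v then b ^ 1 else b ^ (2 ^ W))"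
      using that by (intro sum.cong) auto
    also have "\<dots> = b ^ 1 + (\<Sum>i\<in>{..<k} - {f v}. b ^ (2 ^ W))"
      by (subst sum.insert) (auto intro: sum.cong)
    finally show ?thesis using that by simp
  qed
  have "proper k {v} f \<longleftrightarrow> f v < k" for f by (auto simp: proper_def E_irrefl)
  moreover have "\<exists>f. f v < k" using False by (intro exI[of _ "\<lambda>_. 0"]) simp
  ultimately show ?thesis using False sig by (auto simp: table_def)
qed

definition dominating_coloring :: "nat \<Rightarrow> (nat \<Rightarrow> nat) \<Rightarrow> bool" where
  "dominating_coloring k f \<longleftrightarrow> proper k {..<n} f \<and>
     (\<forall>u<n. \<forall>i<k. i \<noteq> f u \<longrightarrow> (\<exists>v<n. E u v \<and> f v = i))"

lemma cls_UNIV: "u < n \<Longrightarrow> cls {..<n} u = 0"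
proof -
  assume u: "u < n"
  have "twin {..<n} y v" for y v by (simp add: twin_def)
  then have "firsts {..<n} = {0}" using u by (fastforce simp: firsts_def)
  then show ?thesis using cls_less[of "{..<n}" u] u by simp
qed

lemma table_accepts:
  assumes "0 < n" "k < b" "0 < W"
  shows "k * b \<in> table W b k {..<n} \<longleftrightarrow> (\<exists>f. dominating_coloring k f)"
proof -
  have ty: "type_code W {..<n} X = (if X = {} then 0 else 1) + (if undom {..<n} X = {} then 0 else 2 ^ W)"
    if "X \<subseteq> {..<n}" for X
  proof -
    have "cls {..<n} ` X = (if X = {} then {} else {0})"
      using that cls_UNIV by (force simp: image_def)
    moreover have "(\<lambda>u. W + cls {..<n} u) ` undom {..<n} X = (if undom {..<n} X = {} then {} else {W})"
      using cls_UNIV by (force simp: image_def undom_def)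
    ultimately show ?thesis using assms(3) by (simp add: type_set_def set_encode_def)
  qed
  have one: "type_code W {..<n} X = 1 \<longleftrightarrow> undom {..<n} X = {}" if "X \<subseteq> {..<n}" for X
  proof -
    have "X = {} \<Longrightarrow> undom {..<n} X \<noteq> {}" using assms(1) by (auto simp: undom_def)
    moreover have "(2::nat) ^ W \<noteq> 1" using assms(3) by (cases W) auto
    ultimately show ?thesis using ty[OF that] by auto
  qed
  have "k * b \<in> table W b k {..<n} \<longleftrightarrow> (\<exists>f. proper k {..<n} f \<and>
      (\<forall>i<k. type_code W {..<n} {u \<in> {..<n}. f u = i} = 1))"
  proof
    assume "k * b \<in> table W b k {..<n}"
    then obtain f where f: "proper k {..<n} f" and s: "k * b = signature W b k {..<n} f" by (auto simp: table_def)
    have "(\<Sum>i<k. b ^ type_code W {..<n} {u \<in> {..<n}. f u = i}) = (\<Sum>i<k. b ^ (\<lambda>_. 1::nat) i)"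
      using s by (simp add: signature_def)
    from power_sum_inj[OF assms(2) this] have "\<forall>i<k. type_code W {..<n} {u \<in> {..<n}. f u = i} = 1"
      by metis
    then show "\<exists>f. proper k {..<n} f \<and> (\<forall>i<k. type_code W {..<n} {u \<in> {..<n}. f u = i} = 1)"
      using f by blast
  next
    assume "\<exists>f. proper k {..<n} f \<and> (\<forall>i<k. type_code W {..<n} {u \<in> {..<n}. f u = i} = 1)"
    then obtain f where f: "proper k {..<n} f" "\<forall>i<k. type_code W {..<n} {u \<in> {..<n}. f u = i} = 1" by blast
    then have "signature W b k {..<n} f = k * b" by (simp add: signature_def)
    then show "k * b \<in> table W b k {..<n}" using f(1) unfolding table_def by (metis imageI mem_Collect_eq)
  qed
  also have "\<dots> \<longleftrightarrow> (\<exists>f. dominating_coloring k f)"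
  proof -
    have one': "type_code W {..<n} {u \<in> {..<n}. f u = i} = 1 \<longleftrightarrow> undom {..<n} {u \<in> {..<n}. f u = i} = {}" for f i
      by (rule one) auto
    have ud: "undom {..<n} {u \<in> {..<n}. f u = i} = {} \<longleftrightarrow> (\<forall>u<n. i \<noteq> f u \<longrightarrow> (\<exists>v<n. E u v \<and> f v = i))" for f i
      by (auto simp: undom_def)
    then have "(\<forall>i<k. type_code W {..<n} {u \<in> {..<n}. f u = i} = 1) \<longleftrightarrow>
        (\<forall>u<n. \<forall>i<k. i \<noteq> f u \<longrightarrow> (\<exists>v<n. E u v \<and> f v = i))" for f
      unfolding one' ud by blast
    then show ?thesis by (simp add: dominating_coloring_def)
  qed
  finally show ?thesis .
qed

end


section \<open>Sums of prescribed weights\<close>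

lemma reachable_sums:
  fixes w :: "'a \<Rightarrow> nat"
  assumes J: "\<And>x. x < L \<Longrightarrow> J x \<longleftrightarrow> x = 0 \<or> (\<exists>a\<in>A. w a \<le> x \<and> J (x - w a))"
    and pos: "\<And>a. a \<in> A \<Longrightarrow> 0 < w a" and "x < L"
  shows "J x \<longleftrightarrow> (\<exists>l a. (\<forall>i<l. a i \<in> A) \<and> x = (\<Sum>i<l::nat. w (a i)))"
  using assms(3)
proof (induction x rule: less_induct)
  case (less x)
  show ?case
  proof
    assume "J x"
    then consider "x = 0" | a where "a \<in> A" "w a \<le> x" "J (x - w a)"
      using J[OF less.prems] by blast
    then show "\<exists>l a. (\<forall>i<l. a i \<in> A) \<and> x = (\<Sum>i<l::nat. w (a i))"
    proof cases
      case 1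
      then show ?thesis by (intro exI[of _ 0]) simp
    next
      case (2 a)
      have "x - w a < x" using pos[OF 2(1)] 2(2) by simp
      then have "\<exists>l c. (\<forall>i<l. c i \<in> A) \<and> x - w a = (\<Sum>i<l::nat. w (c i))"
        using less.IH[of "x - w a"] less.prems 2(3) by simp
      then obtain l c where lc: "\<forall>i<l. c i \<in> A" "x - w a = (\<Sum>i<l::nat. w (c i))"
        by blast
      define c' where "c' i = (if i < l then c i else a)" for i
      have "(\<Sum>i<Suc l. w (c' i)) = (\<Sum>i<l. w (c i)) + w a"
        by (simp add: c'_def)
      then have "x = (\<Sum>i<Suc l. w (c' i))" using lc(2) 2(2) by linarith
      moreover have "\<forall>i<Suc l. c' i \<in> A" using lc(1) 2(1) by (simp add: c'_def)
      ultimately show ?thesis by blast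
    qed
  next
    assume "\<exists>l a. (\<forall>i<l. a i \<in> A) \<and> x = (\<Sum>i<l::nat. w (a i))"
    then obtain l a where la: "\<forall>i<l. a i \<in> A" "x = (\<Sum>i<l::nat. w (a i))" by blast
    show "J x"
    proof (cases l)
      case 0
      then show ?thesis using la J[OF less.prems] by simp
    next
      case (Suc l')
      have x: "x = (\<Sum>i<l'. w (a i)) + w (a l')" and A: "a l' \<in> A" using la Suc by auto
      have "x - w (a l') < x" using pos[OF A] x by simp
      moreover have "\<exists>l c. (\<forall>i<l. c i \<in> A) \<and> x - w (a l') = (\<Sum>i<l::nat. w (c i))"
        using la(1) Suc x by (intro exI[of _ l'] exI[of _ a]) auto
      ultimately have "J (x - w (a l'))" using less.IH[of "x - w (a l')"] less.prems by simp
      moreover have "w (a l') \<le> x" using x by simp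
      ultimately show ?thesis using J[OF less.prems] A by blast
    qed
  qed
qed

lemma add_mult_eq_iff:
  fixes M :: nat
  assumes "x < M" "y < M"
  shows "x + M * a = y + M * c \<longleftrightarrow> x = y \<and> a = c"
proof
  assume eq: "x + M * a = y + M * c"
  have "(x + M * a) mod M = x" "(y + M * c) mod M = y" "(x + M * a) div M = a" "(y + M * c) div M = c"
    using assms by simp_all
  then show "x = y \<and> a = c" using eq by metis
qed simp

text \<open>A step with types \<open>p\<close>, \<open>q\<close> contributes one unit to a digit of each of the first three
  numbers and one to the step counter \<open>k\<close>, which keeps the digits below \<open>b\<close>, so that no carries occur.\<close>

lemma reachable_steps:
  fixes b D :: nat and r :: "nat \<Rightarrow> nat \<Rightarrow> nat"
  defines "M \<equiv> b ^ D"
  defines "w \<equiv> \<lambda>(p, q). b ^ p + M * (b ^ q + M * (b ^ r p q + M))"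
  assumes A: "\<And>p q. (p, q) \<in> A \<Longrightarrow> p < D \<and> q < D \<and> r p q < D"
    and J: "\<And>x. x < M * (M * (M * b)) \<Longrightarrow> J x \<longleftrightarrow> x = 0 \<or> (\<exists>a\<in>A. w a \<le> x \<and> J (x - w a))"
    and k: "k < b" and x: "x1 < M" "x2 < M" "x3 < M"
  shows "J (x1 + M * (x2 + M * (x3 + M * k))) \<longleftrightarrow>
    (\<exists>p q. (\<forall>i<k. (p i, q i) \<in> A) \<and> x1 = (\<Sum>i<k. b ^ p i) \<and> x2 = (\<Sum>i<k. b ^ q i) \<and>
      x3 = (\<Sum>i<k. b ^ r (p i) (q i)))"
proof -
  let ?x = "x1 + M * (x2 + M * (x3 + M * k))"
  have b: "0 < b" and M: "0 < M" using k by (auto simp: M_def)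
  have up: "y + M * z < M * c" if "y < M" "z < c" for y z c
  proof -
    have "y + M * z < M * Suc z" using that by simp
    also have "\<dots> \<le> M * c" using that by (intro mult_le_mono2) simp
    finally show ?thesis .
  qed
  have L: "?x < M * (M * (M * b))" using x k by (intro up)
  have sum: "(\<Sum>i<l. w (a i)) = (\<Sum>i<l. b ^ fst (a i)) + M * ((\<Sum>i<l. b ^ snd (a i)) +
      M * ((\<Sum>i<l. b ^ r (fst (a i)) (snd (a i))) + M * l))" for l :: nat and a
    by (simp add: w_def case_prod_beta sum.distrib sum_distrib_left algebra_simps)
  have pos: "0 < w a" if "a \<in> A" for a
    using b by (simp add: w_def case_prod_beta)
  have "J ?x \<longleftrightarrow> (\<exists>l a. (\<forall>i<l. a i \<in> A) \<and> ?x = (\<Sum>i<l::nat. w (a i)))"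
    by (rule reachable_sums[OF J pos L])
  also have "\<dots> \<longleftrightarrow> (\<exists>a. (\<forall>i<k. a i \<in> A) \<and> x1 = (\<Sum>i<k. b ^ fst (a i)) \<and>
      x2 = (\<Sum>i<k. b ^ snd (a i)) \<and> x3 = (\<Sum>i<k. b ^ r (fst (a i)) (snd (a i))))" (is "?L \<longleftrightarrow> ?R")
  proof
    assume ?L
    then obtain l a where a: "\<forall>i<l. a i \<in> A" and eq: "?x = (\<Sum>i<l::nat. w (a i))" by blast
    have "M * (M * (M * l)) \<le> ?x" unfolding eq sum by (simp add: algebra_simps)
    also have "?x < M * (M * (M * Suc k))"
      using x by (intro up) simp_all
    finally have "l < Suc k" using M by (simp del: mult_Suc_right)
    then have "l < b" using k by simp
    moreover have aD: "fst (a i) < D \<and> snd (a i) < D \<and> r (fst (a i)) (snd (a i)) < D" if "i < l" for i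
      using A[of "fst (a i)" "snd (a i)"] a that by simp
    ultimately have "(\<Sum>i<l. b ^ fst (a i)) < M" "(\<Sum>i<l. b ^ snd (a i)) < M"
      "(\<Sum>i<l. b ^ r (fst (a i)) (snd (a i))) < M"
      unfolding M_def using aD by (auto intro!: power_sum_less)
    then have "x1 = (\<Sum>i<l. b ^ fst (a i)) \<and> x2 = (\<Sum>i<l. b ^ snd (a i)) \<and>
        x3 = (\<Sum>i<l. b ^ r (fst (a i)) (snd (a i))) \<and> k = l"
      using eq x M unfolding sum by (simp add: add_mult_eq_iff)
    then show ?R using a by blast
  next
    assume ?R
    then obtain a where "\<forall>i<k. a i \<in> A" "x1 = (\<Sum>i<k. b ^ fst (a i))"
      "x2 = (\<Sum>i<k. b ^ snd (a i))" "x3 = (\<Sum>i<k. b ^ r (fst (a i)) (snd (a i)))" by blast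
    then show ?L by (intro exI[of _ k] exI[of _ a]) (simp only: sum simp_thms)
  qed
  also have "\<dots> \<longleftrightarrow> (\<exists>p q. (\<forall>i<k. (p i, q i) \<in> A) \<and> x1 = (\<Sum>i<k. b ^ p i) \<and> x2 = (\<Sum>i<k. b ^ q i) \<and>
      x3 = (\<Sum>i<k. b ^ r (p i) (q i)))"
  proof
    assume "\<exists>a. (\<forall>i<k. a i \<in> A) \<and> x1 = (\<Sum>i<k. b ^ fst (a i)) \<and>
      x2 = (\<Sum>i<k. b ^ snd (a i)) \<and> x3 = (\<Sum>i<k. b ^ r (fst (a i)) (snd (a i)))"
    then obtain a where "\<forall>i<k. a i \<in> A" "x1 = (\<Sum>i<k. b ^ fst (a i))"
      "x2 = (\<Sum>i<k. b ^ snd (a i))" "x3 = (\<Sum>i<k. b ^ r (fst (a i)) (snd (a i)))" by blast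
    then show "\<exists>p q. (\<forall>i<k. (p i, q i) \<in> A) \<and> x1 = (\<Sum>i<k. b ^ p i) \<and> x2 = (\<Sum>i<k. b ^ q i) \<and>
      x3 = (\<Sum>i<k. b ^ r (p i) (q i))"
      by (intro exI[of _ "\<lambda>i. fst (a i)"] exI[of _ "\<lambda>i. snd (a i)"]) simp
  next
    assume "\<exists>p q. (\<forall>i<k. (p i, q i) \<in> A) \<and> x1 = (\<Sum>i<k. b ^ p i) \<and> x2 = (\<Sum>i<k. b ^ q i) \<and>
      x3 = (\<Sum>i<k. b ^ r (p i) (q i))"
    then obtain p q where "\<forall>i<k. (p i, q i) \<in> A" "x1 = (\<Sum>i<k. b ^ p i)" "x2 = (\<Sum>i<k. b ^ q i)"
      "x3 = (\<Sum>i<k. b ^ r (p i) (q i))" by blast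
    then show "\<exists>a. (\<forall>i<k. a i \<in> A) \<and> x1 = (\<Sum>i<k. b ^ fst (a i)) \<and>
      x2 = (\<Sum>i<k. b ^ snd (a i)) \<and> x3 = (\<Sum>i<k. b ^ r (fst (a i)) (snd (a i)))"
      by (intro exI[of _ "\<lambda>i. (p i, q i)"]) simp
  qed
  finally show ?thesis .
qed

context fall_dp
begin

lemma merge_type_less:
  assumes "\<forall>u\<in>S1 \<union> S2. cls (S1 \<union> S2) u < W"
  shows "merge_type W S1 S2 p q < 2 ^ (2 * W)"
  unfolding merge_type_def
proof (rule set_encode_less)
  have "u \<in> S1 \<union> S2" if "hit S1 S2 p q u \<or> still_undom W S1 S2 p q u" for u
    using that by (auto simp: hit_def still_undom_def)
  then have "cls (S1 \<union> S2) u < W" if "hit S1 S2 p q u \<or> still_undom W S1 S2 p q u" for u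
    using that assms by blast
  then show "cls (S1 \<union> S2) ` {u. hit S1 S2 p q u} \<union>
      (\<lambda>u. W + cls (S1 \<union> S2) u) ` {u. still_undom W S1 S2 p q u} \<subseteq> {..<2 * W}"
    by fastforce
qed

lemma table_less:
  assumes "k < b" "\<forall>u\<in>S. cls S u < W" "x \<in> table W b k S"
  shows "x < b ^ (2 ^ (2 * W))"
  using assms(3) unfolding table_def signature_def
  by (auto intro!: power_sum_less[OF assms(1)] type_code_less[OF _ assms(2)])

lemma table_union_reachable:
  assumes S: "finite S1" "finite S2" "S1 \<inter> S2 = {}" "S1 \<subseteq> {..<n}" "S2 \<subseteq> {..<n}" and k: "k < b"
    and W: "\<forall>u\<in>S1. cls S1 u < W" "\<forall>u\<in>S2. cls S2 u < W" "\<forall>u\<in>S1 \<union> S2. cls (S1 \<union> S2) u < W"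
  defines "D \<equiv> 2 ^ (2 * W)"
  defines "M \<equiv> b ^ D"
  defines "w \<equiv> \<lambda>(p, q). b ^ p + M * (b ^ q + M * (b ^ merge_type W S1 S2 p q + M))"
  assumes J: "\<And>x. x < M * (M * (M * b)) \<Longrightarrow> J x \<longleftrightarrow> x = 0 \<or>
      (\<exists>p<D. \<exists>q<D. compatible S1 S2 p q \<and> w (p, q) \<le> x \<and> J (x - w (p, q)))"
    and x: "x < M"
  shows "x \<in> table W b k (S1 \<union> S2) \<longleftrightarrow> (\<exists>x1<M. \<exists>x2<M. x1 \<in> table W b k S1 \<and> x2 \<in> table W b k S2 \<and>
    J (x1 + M * (x2 + M * (x + M * k))))"
proof -
  define A where "A = {(p, q). p < D \<and> q < D \<and> compatible S1 S2 p q}"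
  have J': "J y \<longleftrightarrow> y = 0 \<or> (\<exists>a\<in>A. w a \<le> y \<and> J (y - w a))" if "y < M * (M * (M * b))" for y
    unfolding J[OF that] by (auto simp: A_def)
  have A: "p < D \<and> q < D \<and> merge_type W S1 S2 p q < D" if "(p, q) \<in> A" for p q
    using that merge_type_less[OF W(3)] by (simp add: A_def D_def)
  note reach = reachable_steps[of A D "merge_type W S1 S2" b, folded M_def, folded w_def, OF A J' k _ _ x]
  have less: "x1 < M" if "x1 \<in> table W b k S1 \<or> x1 \<in> table W b k S2" for x1
    using that table_less[OF k W(1)] table_less[OF k W(2)] unfolding M_def D_def by blast
  show ?thesis
    unfolding table_union[OF S k W(1,2)]
  proof (intro iffI; elim bexE exE conjE)
    fix x1 x2 p q
    assume "x1 \<in> table W b k S1" "x2 \<in> table W b k S2"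
      "\<forall>i<k. p i < 2 ^ (2 * W) \<and> q i < 2 ^ (2 * W) \<and> compatible S1 S2 (p i) (q i)"
      "x1 = (\<Sum>i<k. b ^ p i)" "x2 = (\<Sum>i<k. b ^ q i)" "x = (\<Sum>i<k. b ^ merge_type W S1 S2 (p i) (q i))"
    moreover from this have "J (x1 + M * (x2 + M * (x + M * k)))"
      using reach[of x1 x2] less by (auto simp: A_def D_def)
    ultimately show "\<exists>x1<M. \<exists>x2<M. x1 \<in> table W b k S1 \<and> x2 \<in> table W b k S2 \<and> J (x1 + M * (x2 + M * (x + M * k)))"
      using less by blast
  next
    fix x1 x2
    assume t: "x1 < M" "x2 < M" "x1 \<in> table W b k S1" "x2 \<in> table W b k S2" "J (x1 + M * (x2 + M * (x + M * k)))"
    then obtain p q where "\<forall>i<k. (p i, q i) \<in> A" "x1 = (\<Sum>i<k. b ^ p i)" "x2 = (\<Sum>i<k. b ^ q i)"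
      "x = (\<Sum>i<k. b ^ merge_type W S1 S2 (p i) (q i))"
      using reach[of x1 x2] by blast
    then show "\<exists>x1\<in>table W b k S1. \<exists>x2\<in>table W b k S2. \<exists>p q.
       (\<forall>i<k. p i < 2 ^ (2 * W) \<and> q i < 2 ^ (2 * W) \<and> compatible S1 S2 (p i) (q i)) \<and>
       x1 = (\<Sum>i<k. b ^ p i) \<and> x2 = (\<Sum>i<k. b ^ q i) \<and>
       x = (\<Sum>i<k. b ^ merge_type W S1 S2 (p i) (q i))"
      using t by (intro bexI[of _ x1] bexI[of _ x2] exI[of _ p] exI[of _ q]) (auto simp: A_def D_def)
  qed
qed

lemma card_firsts_Union:
  assumes "finite K" "\<And>A. A \<in> K \<Longrightarrow> finite A"
  shows "card (firsts (\<Union>K)) \<le> (\<Sum>A\<in>K. card (A // {(u, v). u \<in> A \<and> v \<in> A \<and> twin A u v}))"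
proof -
  let ?R = "\<lambda>A. {(u, v). u \<in> A \<and> v \<in> A \<and> twin A u v}"
  define home where "home v = (SOME A. A \<in> K \<and> v \<in> A)" for v
  have home: "home v \<in> K \<and> v \<in> home v" if "v \<in> \<Union>K" for v
  proof -
    from that have "\<exists>A. A \<in> K \<and> v \<in> A" by blast
    then show ?thesis unfolding home_def by (rule someI_ex)
  qed
  let ?f = "\<lambda>v. (home v, ?R (home v) `` {v})"
  have sub: "firsts (\<Union>K) \<subseteq> \<Union>K" by (auto simp: firsts_def)
  have "inj_on ?f (firsts (\<Union>K))"
  proof (rule inj_onI)
    fix u v assume uv: "u \<in> firsts (\<Union>K)" "v \<in> firsts (\<Union>K)" "?f u = ?f v"
    then have hu: "u \<in> home u" "home u \<in> K" and "v \<in> home v"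
      using home[of u] home[of v] sub by (meson subsetD)+
    then have hv: "v \<in> home u" using uv(3) by simp
    have hh: "home u = home v" and im: "?R (home u) `` {u} = ?R (home v) `` {v}"
      using uv(3) unfolding prod.inject by (rule conjunct1, rule conjunct2)
    have "v \<in> ?R (home v) `` {v}" using hv hh by simp
    then have "v \<in> ?R (home u) `` {u}" unfolding im .
    then have "twin (home u) u v" by simp
    then have "twin (\<Union>K) u v" by (rule twin_mono) (rule Union_upper[OF hu(2)])
    moreover have "\<not> (u < v \<and> twin (\<Union>K) u v)" "\<not> (v < u \<and> twin (\<Union>K) v u)"
      using uv(1,2) unfolding firsts_def by blast+
    ultimately show "u = v" using twin_sym by (metis linorder_neqE_nat)
  qed
  moreover have "?f ` firsts (\<Union>K) \<subseteq> (SIGMA A:K. A // ?R A)"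
  proof (intro image_subsetI SigmaI)
    fix v assume "v \<in> firsts (\<Union>K)"
    then have "home v \<in> K \<and> v \<in> home v" using home sub by (meson subsetD)
    then show "home v \<in> K" "?R (home v) `` {v} \<in> home v // ?R (home v)" 
      by (simp only:, intro quotientI, simp only:)
  qed
  moreover have "finite (SIGMA A:K. A // ?R A)"
    using assms by (intro finite_SigmaI finite_quotient) auto
  ultimately have "card (firsts (\<Union>K)) \<le> card (SIGMA A:K. A // ?R A)"
    by (rule card_inj_on_le)
  also have "\<dots> = (\<Sum>A\<in>K. card (A // ?R A))"
    using assms by (intro card_SigmaI ballI finite_quotient) auto
  finally show ?thesis .
qed

end


section \<open>Correctness of the dynamic program\<close>

definition comps :: "(nat \<times> nat) list \<Rightarrow> nat \<Rightarrow> nat" where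
  "comps ms = foldl (\<lambda>f (a, c) u. if f u = c then a else f u) (\<lambda>u. u) ms"

lemma comps_Nil [simp]: "comps [] u = u"
  by (simp add: comps_def)

lemma comps_snoc [simp]: "comps (ms @ [(a, c)]) u = (if comps ms u = c then a else comps ms u)"
  by (simp add: comps_def)

lemma comps_take_Suc:
  "i < length ms \<Longrightarrow> comps (take (Suc i) ms) u =
     (if comps (take i ms) u = snd (ms ! i) then fst (ms ! i) else comps (take i ms) u)"
  using comps_snoc[of "take i ms" "fst (ms ! i)" "snd (ms ! i)"] by (simp add: take_Suc_conv_app_nth)

lemma sum_of_bool_card: "(\<Sum>i<m. of_bool (Q i)) = card {i. i < (m::nat) \<and> Q i}"
proof -
  have "(\<Sum>i<m. of_bool (Q i)) = (\<Sum>i | i < m \<and> Q i. 1::nat)"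
    by (rule sum.mono_neutral_cong_right) auto
  then show ?thesis by simp
qed

lemma sum_if_set_encode: "(\<Sum>i<m. if Q i then 2 ^ i else 0) = set_encode {i. i < m \<and> Q i}"
proof -
  have "(\<Sum>i<m. if Q i then 2 ^ i else 0) = (\<Sum>i | i < m \<and> Q i. 2 ^ i :: nat)"
    by (rule sum.mono_neutral_cong_right) auto
  then show ?thesis by (simp add: set_encode_def)
qed

context fall_dp
begin

definition fiber :: "(nat \<Rightarrow> nat) \<Rightarrow> nat \<Rightarrow> nat set" where
  "fiber f l = {u. u < n \<and> f u = l}"

lemma finite_fiber [simp]: "finite (fiber f l)"
  by (simp add: fiber_def)

lemma fiber_sub [simp]: "fiber f l \<subseteq> {..<n}"
  by (auto simp: fiber_def)

lemma fiber_cong: "(\<And>u. u < n \<Longrightarrow> f u = g u) \<Longrightarrow> fiber f l = fiber g l"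
  by (auto simp: fiber_def)

definition has_graph :: "(reg \<Rightarrow> nat) \<Rightarrow> arrays \<Rightarrow> bool" where
  "has_graph r h \<longleftrightarrow> r ''n'' = n \<and> (\<forall>u<n. \<forall>v<n. h 16 (u * n + v) = of_bool (E u v))"

lemma has_graph_upd [simp]:
  "x \<noteq> ''n'' \<Longrightarrow> has_graph (r(x := a)) h \<longleftrightarrow> has_graph r h"
  "j \<noteq> 16 \<Longrightarrow> has_graph r (h(j := f)) \<longleftrightarrow> has_graph r h"
  by (auto simp: has_graph_def)

lemma eval_adj:
  assumes "has_graph r h" "u \<noteq> ''*''" "v \<noteq> ''*''" "r u < n" "r v < n"
  shows "eval (adj u v) r h = of_bool (E (r u) (r v))"
  using assms by (auto simp: adj_def EMul_def has_graph_def mult.commute)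

lemma holds_adj:
  assumes "has_graph r h" "u \<noteq> ''*''" "v \<noteq> ''*''" "r u < n" "r v < n"
  shows "holds (adj u v) r h \<longleftrightarrow> E (r u) (r v)"
  using eval_adj[OF assms] by (simp add: holds_def)

lemma holds_same:
  "holds (same u v) r h \<longleftrightarrow> h 10 (r u) = h 10 (r v)"
  by (simp add: same_def)

lemma holds_twin_exp:
  assumes "has_graph r h" "u \<noteq> ''*''" "v \<noteq> ''*''" "u \<noteq> ''q''" "v \<noteq> ''q''" "r u < n" "r v < n"
  shows "holds (twin_exp u v) r h \<longleftrightarrow> twin (fiber (h 10) (h 10 (r v))) (r u) (r v)"
proof -
  have n: "r ''n'' = n" using assms(1) by (simp add: has_graph_def)
  have "holds (twin_exp u v) r h \<longleftrightarrow> (\<forall>q<n. h 10 q = h 10 (r v) \<or> E (r u) q = E (r v) q)"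
    unfolding twin_exp_def using assms n by (simp add: holds_same eval_adj of_bool_eq_iff)
  then show ?thesis by (auto simp: twin_def fiber_def)
qed

lemma holds_first_exp:
  assumes "has_graph r h" "r ''s'' < n"
  shows "holds first_exp r h \<longleftrightarrow> r ''s'' \<in> firsts (fiber (h 10) (h 10 (r ''s'')))"
proof -
  have n: "r ''n'' = n" using assms(1) by (simp add: has_graph_def)
  have "holds first_exp r h \<longleftrightarrow> (\<forall>y<n. h 10 y = h 10 (r ''s'') \<and> y < r ''s'' \<longrightarrow>
      \<not> twin (fiber (h 10) (h 10 (r ''s''))) y (r ''s''))"
    unfolding first_exp_def using assms n by (auto simp: holds_same holds_twin_exp)
  then show ?thesis using assms(2) by (auto simp: firsts_def fiber_def)
qed

lemma eval_cls_exp: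
  assumes "has_graph r h" "r ''u'' < n"
  shows "eval cls_exp r h = cls (fiber (h 10) (h 10 (r ''u''))) (r ''u'')"
proof -
  have n: "r ''n'' = n" using assms(1) by (simp add: has_graph_def)
  let ?S = "fiber (h 10) (h 10 (r ''u''))"
  have "eval cls_exp r h = card {s. s < n \<and> (h 10 s = h 10 (r ''u'') \<and> s \<in> firsts (fiber (h 10) (h 10 s))) \<and>
      (\<forall>y<n. h 10 y = h 10 (r ''u'') \<longrightarrow> s < y \<or> \<not> twin ?S y (r ''u''))}"
    unfolding cls_exp_def sum_of_bool_card[symmetric] using assms n
    by (auto simp: holds_same holds_first_exp holds_twin_exp intro!: sum.cong)
  also have "{s. s < n \<and> (h 10 s = h 10 (r ''u'') \<and> s \<in> firsts (fiber (h 10) (h 10 s))) \<and>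
      (\<forall>y<n. h 10 y = h 10 (r ''u'') \<longrightarrow> s < y \<or> \<not> twin ?S y (r ''u''))} =
      {v \<in> firsts ?S. \<forall>y\<in>?S. y \<le> v \<longrightarrow> \<not> twin ?S y (r ''u'')}"
    by (auto simp: firsts_def fiber_def not_less)
  finally show ?thesis by (simp add: cls_def)
qed

lemma run_update:
  assumes "has_graph r h"
  obtains f g where
    "run update (r, h) = (r(''a'' := h 2 (r ''i''), ''c'' := h 3 (r ''i'')), h(10 := f, 11 := g))"
    "\<And>u. u < n \<Longrightarrow> f u = (if h 4 u = h 3 (r ''i'') then h 2 (r ''i'') else h 4 u)"
    "\<And>u. u < n \<Longrightarrow> g u = cls (fiber f (f u)) u"
proof -
  let ?r = "r(''a'' := h 2 (r ''i''), ''c'' := h 3 (r ''i''))"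
  have n: "r ''n'' = n" and G: "has_graph ?r h" using assms by (simp_all add: has_graph_def)
  obtain f where f: "run (For ''u'' (V ''n'') (Sto 10 (V ''u'') (Cond (EEq (Rd 4 (V ''u'')) (V ''c'')) (V ''a'') (Rd 4 (V ''u''))))) (?r, h)
      = (?r, h(10 := f))" "\<And>u. u < n \<Longrightarrow> f u = (if h 4 u = h 3 (r ''i'') then h 2 (r ''i'') else h 4 u)"
    by (rule run_fill_range[where x = "''u''" and r = ?r and h = h and b = "V ''n''" and j = 10 and m = n
        and g = "\<lambda>u. if h 4 u = h 3 (r ''i'') then h 2 (r ''i'') else h 4 u"]) (use n in auto)
  obtain g where g: "run (For ''u'' (V ''n'') (Sto 11 (V ''u'') cls_exp)) (?r, h(10 := f)) = (?r, (h(10 := f))(11 := g))"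
    "\<And>u. u < n \<Longrightarrow> g u = cls (fiber f (f u)) u"
  proof (rule run_fill_range[where x = "''u''" and r = ?r and h = "h(10 := f)" and b = "V ''n''" and j = 11 and m = n
        and g = "\<lambda>u. cls (fiber f (f u)) u" and e = cls_exp])
    fix i f' assume "i < n"
    then show "eval cls_exp (?r(''u'' := i)) (h(10 := f, 11 := f')) = cls (fiber f (f i)) i"
      using eval_cls_exp[of "?r(''u'' := i)" "h(10 := f, 11 := f')"] G by simp
  qed (use n in auto)
  show thesis
    by (rule that[of f g]) (simp_all add: update_def f g)
qed

lemma run_commit:
  assumes "has_graph r h"
  obtains f g where "run commit (r, h) = (r, h(4 := f, 5 := g))"
    "\<And>u. u < n \<Longrightarrow> f u = h 10 u" "\<And>u. u < n \<Longrightarrow> g u = h 11 u"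
proof -
  have n: "r ''n'' = n" using assms by (simp add: has_graph_def)
  obtain f where f: "run (For ''u'' (V ''n'') (Sto 4 (V ''u'') (Rd 10 (V ''u'')))) (r, h) = (r, h(4 := f))"
    "\<And>u. u < n \<Longrightarrow> f u = h 10 u"
    by (rule run_fill_range[where x = "''u''" and r = r and h = h and b = "V ''n''" and j = 4 and m = n
        and g = "h 10"]) (use n in auto)
  obtain g where g: "run (For ''u'' (V ''n'') (Sto 5 (V ''u'') (Rd 11 (V ''u'')))) (r, h(4 := f)) = (r, (h(4 := f))(5 := g))"
    "\<And>u. u < n \<Longrightarrow> g u = h 11 u"
    by (rule run_fill_range[where x = "''u''" and r = r and h = "h(4 := f)" and b = "V ''n''" and j = 5 and m = n
        and g = "h 11"]) (use n in auto)
  show thesis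
    by (rule that[of f g]) (simp_all add: commit_def f g)
qed

lemma run_init:
  assumes "has_graph r h"
  obtains f g where "run init (r, h) = (r, h(4 := f, 5 := g))"
    "\<And>u. u < n \<Longrightarrow> f u = u" "\<And>u. u < n \<Longrightarrow> g u = 0"
proof -
  have n: "r ''n'' = n" using assms by (simp add: has_graph_def)
  obtain f where f: "run (For ''u'' (V ''n'') (Sto 4 (V ''u'') (V ''u''))) (r, h) = (r, h(4 := f))"
    "\<And>u. u < n \<Longrightarrow> f u = u"
    by (rule run_fill_range[where x = "''u''" and r = r and h = h and b = "V ''n''" and j = 4 and m = n
        and g = "\<lambda>u. u"]) (use n in auto)
  obtain g where g: "run (For ''u'' (V ''n'') (Sto 5 (V ''u'') (C 0))) (r, h(4 := f)) = (r, (h(4 := f))(5 := g))"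
    "\<And>u. u < n \<Longrightarrow> g u = 0"
    by (rule run_fill_range[where x = "''u''" and r = r and h = "h(4 := f)" and b = "V ''n''" and j = 5 and m = n
        and g = "\<lambda>_. 0"]) (use n in auto)
  show thesis
    by (rule that[of f g]) (simp_all add: init_def f g)
qed

definition stage :: "(nat \<times> nat) list \<Rightarrow> nat \<Rightarrow> arrays \<Rightarrow> bool" where
  "stage ms i h \<longleftrightarrow> (\<forall>u<n. h 4 u = comps (take i ms) u) \<and>
     (\<forall>u<n. h 5 u = cls (fiber (comps (take i ms)) (comps (take i ms) u)) u)"

definition has_merges :: "(nat \<times> nat) list \<Rightarrow> (reg \<Rightarrow> nat) \<Rightarrow> arrays \<Rightarrow> bool" where
  "has_merges ms r h \<longleftrightarrow> r ''m'' = length ms \<and> (\<forall>i<length ms. h 2 i = fst (ms ! i) \<and> h 3 i = snd (ms ! i))"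

lemma has_merges_upd [simp]:
  "x \<noteq> ''m'' \<Longrightarrow> has_merges ms (r(x := a)) h \<longleftrightarrow> has_merges ms r h"
  "j \<noteq> 2 \<Longrightarrow> j \<noteq> 3 \<Longrightarrow> has_merges ms r (h(j := f)) \<longleftrightarrow> has_merges ms r h"
  by (auto simp: has_merges_def)

lemma stage_init:
  assumes "\<And>u. u < n \<Longrightarrow> h 4 u = u" "\<And>u. u < n \<Longrightarrow> h 5 u = 0"
  shows "stage ms 0 h"
proof -
  have "fiber (comps []) u = {u}" if "u < n" for u using that by (auto simp: fiber_def)
  then show ?thesis using assms by (simp add: stage_def cls_singleton)
qed

lemma stage_Suc:
  assumes "stage ms i h" "i < length ms" "has_merges ms r h"
    and f: "\<And>u. u < n \<Longrightarrow> f u = (if h 4 u = h 3 i then h 2 i else h 4 u)"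
    and g: "\<And>u. u < n \<Longrightarrow> g u = cls (fiber f (f u)) u"
    and h': "\<And>u. u < n \<Longrightarrow> h' 4 u = f u" "\<And>u. u < n \<Longrightarrow> h' 5 u = g u"
  shows "stage ms (Suc i) h'"
proof -
  have f': "f u = comps (take (Suc i) ms) u" if "u < n" for u
    using assms(1-3) f[OF that] that by (simp add: comps_take_Suc stage_def has_merges_def)
  then have "fiber f l = fiber (comps (take (Suc i) ms)) l" for l by (rule fiber_cong)
  then show ?thesis using f' g h' by (simp add: stage_def)
qed

definition width_ok :: "(nat \<times> nat) list \<Rightarrow> nat \<Rightarrow> nat \<Rightarrow> bool" where
  "width_ok ms j W \<longleftrightarrow> (\<forall>i\<le>j. \<forall>u<n. cls (fiber (comps (take i ms)) (comps (take i ms) u)) u < W)"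

lemma run_max:
  assumes "r ''n'' = n"
  obtains W where "run (For ''u'' (V ''n'') (Asg ''W'' (Plus (V ''W'') (Minus (Plus (Rd 5 (V ''u'')) (C 1)) (V ''W''))))) (r, h)
      = (r(''W'' := W), h)"
    "r ''W'' \<le> W" "\<And>u. u < n \<Longrightarrow> h 5 u < W" "\<And>B. r ''W'' \<le> B \<Longrightarrow> (\<And>u. u < n \<Longrightarrow> h 5 u < B) \<Longrightarrow> W \<le> B"
proof -
  let ?s = "Asg ''W'' (Plus (V ''W'') (Minus (Plus (Rd 5 (V ''u'')) (C 1)) (V ''W'')))"
  define P where "P i r1 h1 \<longleftrightarrow> h1 = h \<and> (\<exists>W. (\<forall>v. r1(''u'' := v) = r(''W'' := W, ''u'' := v)) \<and> r ''W'' \<le> W \<and>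
      (\<forall>u<i. h 5 u < W) \<and> (\<forall>B. r ''W'' \<le> B \<longrightarrow> (\<forall>u<i. h 5 u < B) \<longrightarrow> W \<le> B))"
    for i and r1 :: "reg \<Rightarrow> nat" and h1 :: arrays
  have P0: "P 0 r h" unfolding P_def by (auto intro: exI[of _ "r ''W''"])
  have PS: "P (Suc i) (fst (run ?s (r1(''u'' := i), h1))) (snd (run ?s (r1(''u'' := i), h1)))"
    if "i < n" "P i r1 h1" for i r1 h1
  proof -
    from that(2) obtain W where h1: "h1 = h" and r1: "\<And>v. r1(''u'' := v) = r(''W'' := W, ''u'' := v)"
      and W: "r ''W'' \<le> W" "\<forall>u<i. h 5 u < W" "\<forall>B. r ''W'' \<le> B \<longrightarrow> (\<forall>u<i. h 5 u < B) \<longrightarrow> W \<le> B"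
      unfolding P_def by blast
    define W' where "W' = W + (Suc (h 5 i) - W)"
    have runeq: "run ?s (r1(''u'' := i), h1) = (r(''W'' := W', ''u'' := i), h)"
      unfolding r1 h1 by (simp add: W'_def fun_upd_twist)
    have "r ''W'' \<le> W'" "\<forall>u<Suc i. h 5 u < W'"
      using W(1,2) by (auto simp: W'_def less_Suc_eq)
    moreover have "W' \<le> B" if "r ''W'' \<le> B" "\<forall>u<Suc i. h 5 u < B" for B
    proof -
      have "W \<le> B" "h 5 i < B" using W(3) that by auto
      then show ?thesis by (simp add: W'_def)
    qed
    ultimately show ?thesis unfolding P_def runeq fst_conv snd_conv
      by (intro conjI refl exI[of _ W'] allI impI) simp_all
  qed
  obtain r1 h1 where P: "P n r1 h1" and run: "run (For ''u'' (V ''n'') ?s) (r, h) = (r1(''u'' := r ''u''), h1)"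
    using run_For_invariant[where P = P and x = "''u''" and s = ?s and b = "V ''n''" and m = n, OF _ P0 PS] assms by auto
  from P obtain W where W: "h1 = h" "\<And>v. r1(''u'' := v) = r(''W'' := W, ''u'' := v)" "r ''W'' \<le> W"
    "\<forall>u<n. h 5 u < W" "\<forall>B. r ''W'' \<le> B \<longrightarrow> (\<forall>u<n. h 5 u < B) \<longrightarrow> W \<le> B" unfolding P_def by blast
  have "r(''W'' := W, ''u'' := r ''u'') = r(''W'' := W)" by auto
  then show thesis using that[of W] W run by auto
qed

lemma run_find_width:
  assumes "has_graph r h" "has_merges ms r h"
  obtains W r1 h1 where "run find_width (r, h) = (r1, h1)" "r1 ''W'' = W" "0 < W" "width_ok ms (length ms) W"
    "\<And>B. 0 < B \<Longrightarrow> width_ok ms (length ms) B \<Longrightarrow> W \<le> B"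
    "has_graph r1 h1" "has_merges ms r1 h1" "r1 ''k'' = r ''k''"
proof -
  let ?r = "r(''W'' := 1)"
  let ?max = "For ''u'' (V ''n'') (Asg ''W'' (Plus (V ''W'') (Minus (Plus (Rd 5 (V ''u'')) (C 1)) (V ''W''))))"
  let ?s = "update ;; commit ;; ?max"
  obtain f g where fg: "run init (?r, h) = (?r, h(4 := f, 5 := g))"
    "\<And>u. u < n \<Longrightarrow> f u = u" "\<And>u. u < n \<Longrightarrow> g u = 0"
    using run_init[of ?r h] assms(1) by auto
  define P where "P i r1 h1 \<longleftrightarrow> has_graph r1 h1 \<and> has_merges ms r1 h1 \<and> r1 ''k'' = r ''k'' \<and> stage ms i h1 \<and>
      0 < r1 ''W'' \<and> width_ok ms i (r1 ''W'') \<and> (\<forall>B>0. width_ok ms i B \<longrightarrow> r1 ''W'' \<le> B)" for i r1 h1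
  have "stage ms 0 (h(4 := f, 5 := g))" using fg(2,3) by (intro stage_init) auto
  then have P0: "P 0 ?r (h(4 := f, 5 := g))"
    using assms fg(3) by (simp add: P_def width_ok_def stage_def)
  have PS: "P (Suc i) (fst (run ?s (r1(''i'' := i), h1))) (snd (run ?s (r1(''i'' := i), h1)))"
    if i: "i < length ms" and P: "P i r1 h1" for i r1 h1
  proof -
    let ?r1 = "r1(''i'' := i)"
    let ?r2 = "?r1(''a'' := h1 2 i, ''c'' := h1 3 i)"
    have "has_graph ?r1 h1" using P by (simp add: P_def)
    from run_update[OF this] obtain f g where
      u0: "run update (?r1, h1) = (?r1(''a'' := h1 2 (?r1 ''i''), ''c'' := h1 3 (?r1 ''i'')), h1(10 := f, 11 := g))"
      "\<And>u. u < n \<Longrightarrow> f u = (if h1 4 u = h1 3 (?r1 ''i'') then h1 2 (?r1 ''i'') else h1 4 u)"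
      "\<And>u. u < n \<Longrightarrow> g u = cls (fiber f (f u)) u" by blast
    have ri: "?r1 ''i'' = i" by simp
    note u = u0[unfolded ri]
    obtain f' g' where c: "run commit (?r2, h1(10 := f, 11 := g)) = (?r2, h1(10 := f, 11 := g, 4 := f', 5 := g'))"
      "\<And>u. u < n \<Longrightarrow> f' u = f u" "\<And>u. u < n \<Longrightarrow> g' u = g u"
      using run_commit[of ?r2 "h1(10 := f, 11 := g)"] P by (auto simp: P_def)
    let ?h2 = "h1(10 := f, 11 := g, 4 := f', 5 := g')"
    have st: "stage ms (Suc i) ?h2"
      by (rule stage_Suc[where h = h1 and r = r1 and f = f and g = g]) (use P i u c in \<open>auto simp: P_def\<close>)
    obtain W where m: "run ?max (?r2, ?h2) = (?r2(''W'' := W), ?h2)" "?r2 ''W'' \<le> W"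
      "\<And>u. u < n \<Longrightarrow> ?h2 5 u < W" "\<And>B. ?r2 ''W'' \<le> B \<Longrightarrow> (\<And>u. u < n \<Longrightarrow> ?h2 5 u < B) \<Longrightarrow> W \<le> B"
      by (rule run_max[of ?r2 ?h2]) (use P in \<open>auto simp: P_def has_graph_def\<close>)
    have run: "run ?s (?r1, h1) = (?r2(''W'' := W), ?h2)"
      using u(1) c(1) m(1) by simp
    have h5: "?h2 5 v = cls (fiber (comps (take (Suc i) ms)) (comps (take (Suc i) ms) v)) v" if "v < n" for v
      using st that unfolding stage_def by blast
    have P': "width_ok ms i (r1 ''W'')" "\<And>B. 0 < B \<Longrightarrow> width_ok ms i B \<Longrightarrow> r1 ''W'' \<le> B" "0 < r1 ''W''"
      using P unfolding P_def by blast+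
    have split: "width_ok ms (Suc i) B \<longleftrightarrow> width_ok ms i B \<and> (\<forall>v<n. ?h2 5 v < B)" for B
      using h5 unfolding width_ok_def by (auto simp: le_Suc_eq)
    have W1: "r1 ''W'' \<le> W" using m(2) by simp
    have "width_ok ms i W" using P'(1) W1 unfolding width_ok_def by (meson less_le_trans)
    then have a: "width_ok ms (Suc i) W" unfolding split using m(3) by blast
    have b: "W \<le> B" if "0 < B" "width_ok ms (Suc i) B" for B
      using m(4)[of B] P'(2)[of B] that unfolding split by simp
    have "0 < W" using P'(3) W1 by simp
    then show ?thesis unfolding run fst_conv snd_conv P_def using P st a b
      by (auto simp: P_def)
  qed
  obtain r1 h1 where P: "P (length ms) r1 h1"
    and run: "run (For ''i'' (V ''m'') ?s) (?r, h(4 := f, 5 := g)) = (r1(''i'' := ?r ''i''), h1)"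
    using run_For_invariant[where P = P and x = "''i''" and s = ?s and b = "V ''m''" and m = "length ms", OF _ P0 PS]
      assms(2) by (auto simp: has_merges_def)
  show thesis
    by (rule that[of "r1(''i'' := ?r ''i'')" h1 "r1 ''W''"])
      (use P run fg(1) in \<open>auto simp: find_width_def P_def\<close>)
qed

end


inductive_set reach :: "('a \<Rightarrow> nat) \<Rightarrow> 'a set \<Rightarrow> nat set" for w A where
  reach_0: "0 \<in> reach w A"
| reach_step: "x \<in> reach w A \<Longrightarrow> a \<in> A \<Longrightarrow> x + w a \<in> reach w A"

lemma reach_iff: "x \<in> reach w A \<longleftrightarrow> x = 0 \<or> (\<exists>a\<in>A. w a \<le> x \<and> x - w a \<in> reach w A)"
proof
  assume "x \<in> reach w A"
  then show "x = 0 \<or> (\<exists>a\<in>A. w a \<le> x \<and> x - w a \<in> reach w A)"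
  proof cases
    case (reach_step y a)
    then show ?thesis by (intro disjI2 bexI[of _ a]) simp_all
  qed simp
next
  assume "x = 0 \<or> (\<exists>a\<in>A. w a \<le> x \<and> x - w a \<in> reach w A)"
  then show "x \<in> reach w A"
  proof (elim disjE bexE conjE)
    fix a assume "a \<in> A" "w a \<le> x" "x - w a \<in> reach w A"
    then show ?thesis using reach_step[of "x - w a" w A a] by simp
  qed (simp add: reach_0)
qed

lemma run_powers:
  assumes "r ''g'' = 1" "r y = m"
    and e: "\<And>c v h'. eval e (r(''g'' := c, ''x'' := v)) h' = c * q"
  obtains f where "run (For ''x'' (V y) (Sto j (V ''x'') (V ''g'') ;; Asg ''g'' e)) (r, h) = (r(''g'' := q ^ m), h(j := f))"
    "\<And>i. i < m \<Longrightarrow> f i = q ^ i"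
proof -
  let ?s = "Sto j (V ''x'') (V ''g'') ;; Asg ''g'' e"
  define P where "P i r1 h1 \<longleftrightarrow> (\<forall>v. r1(''x'' := v) = r(''g'' := q ^ i, ''x'' := v)) \<and>
      (\<exists>f. h1 = h(j := f) \<and> (\<forall>y<i. f y = q ^ y))" for i and r1 :: "reg \<Rightarrow> nat" and h1 :: arrays
  have "r(''g'' := 1) = r" using assms(1) by auto
  then have P0: "P 0 r h" unfolding P_def by (auto intro: exI[of _ "h j"])
  have PS: "P (Suc i) (fst (run ?s (r1(''x'' := i), h1))) (snd (run ?s (r1(''x'' := i), h1)))"
    if "P i r1 h1" for i r1 h1
  proof -
    from that obtain f where r1: "\<And>v. r1(''x'' := v) = r(''g'' := q ^ i, ''x'' := v)"
      and f: "h1 = h(j := f)" "\<forall>y<i. f y = q ^ y" unfolding P_def by blast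
    have e': "eval e (r(''x'' := v, ''g'' := c)) h' = c * q" for c v h'
      using e[of c v h'] by (simp add: fun_upd_twist)
    have run: "run ?s (r1(''x'' := i), h1) = (r(''g'' := q ^ Suc i, ''x'' := i), h(j := f(i := q ^ i)))"
      unfolding r1 f(1) by (simp add: e' fun_upd_twist mult.commute)
    show ?thesis unfolding P_def run fst_conv snd_conv
      using f(2) by (intro conjI allI exI[of _ "f(i := q ^ i)"]) (auto simp: less_Suc_eq)
  qed
  obtain r1 h1 where P: "P m r1 h1" and run: "run (For ''x'' (V y) ?s) (r, h) = (r1(''x'' := r ''x''), h1)"
    using run_For_invariant[where P = P and x = "''x''" and s = ?s and b = "V y" and m = m, OF _ P0 PS] assms(2) by auto
  from P obtain f where f: "\<And>v. r1(''x'' := v) = r(''g'' := q ^ m, ''x'' := v)" "h1 = h(j := f)"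
    "\<forall>y<m. f y = q ^ y" unfolding P_def by blast
  have "r(''g'' := q ^ m, ''x'' := r ''x'') = r(''g'' := q ^ m)" by auto
  with f run show thesis by (intro that[of f]) auto
qed

lemma run_powers1: "run powers1 (r, h) = (r(''W2'' := 2 * r ''W'', ''g'' := 1, ''b'' := r ''n'' + 1), h)"
  by (simp add: powers1_def mult_2)

lemma run_powers2:
  assumes "r ''g'' = 1"
  obtains f where "run powers2 (r, h) = (r(''D'' := 2 ^ r ''W2'', ''g'' := 1), h(8 := f))"
    "\<And>i. i < r ''W2'' \<Longrightarrow> f i = 2 ^ i"
proof -
  obtain f where f: "run (For ''x'' (V ''W2'') (Sto 8 (V ''x'') (V ''g'') ;; Asg ''g'' (Plus (V ''g'') (V ''g'')))) (r, h)
      = (r(''g'' := 2 ^ r ''W2''), h(8 := f))" "\<And>i. i < r ''W2'' \<Longrightarrow> f i = 2 ^ i"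
    by (rule run_powers[where y = "''W2''" and r = r and e = "Plus (V ''g'') (V ''g'')" and q = 2 and j = 8 and h = h, OF assms refl]) auto
  show thesis
    by (rule that[of f]) (simp_all add: powers2_def f fun_upd_twist)
qed

lemma run_powers3:
  assumes "r ''g'' = 1"
  obtains f x where "run powers3 (r, h) = (r(''g'' := x, ''M'' := r ''b'' ^ r ''D''), h(9 := f))"
    "\<And>i. i < r ''D'' \<Longrightarrow> f i = r ''b'' ^ i"
proof -
  obtain f where f: "run (For ''x'' (V ''D'') (Sto 9 (V ''x'') (V ''g'') ;; Asg ''g'' (EMul (V ''g'') ''b''))) (r, h)
      = (r(''g'' := r ''b'' ^ r ''D''), h(9 := f))" "\<And>i. i < r ''D'' \<Longrightarrow> f i = r ''b'' ^ i"
    by (rule run_powers[where y = "''D''" and r = r and e = "EMul (V ''g'') ''b''" and q = "r ''b''" and j = 9 and h = h, OF assms refl]) (auto simp: EMul_def)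
  show thesis
    by (rule that[of "r ''b'' ^ r ''D''" f]) (simp_all add: powers3_def f)
qed

lemma run_powers4: "run powers4 (r, h) = (r(''L'' := r ''M'' * (r ''M'' * (r ''M'' * r ''b''))), h)"
  by (simp add: powers4_def EMul_def)

lemma set_decode_recurrence:
  "y \<in> set_decode x \<longleftrightarrow> (if x < 2 ^ y then False else if x < 2 ^ y + 2 ^ y then True
     else y \<in> set_decode (x - (2 ^ y + 2 ^ y)))"
proof -
  have "x div 2 ^ y = 1" if "2 ^ y \<le> x" "x < 2 ^ y + 2 ^ y"
    using that by (intro div_nat_eqI) auto
  moreover have "x div 2 ^ y = (x - (2 ^ y + 2 ^ y)) div 2 ^ y + 2" if "2 ^ y + 2 ^ y \<le> x"
  proof -
    have "x = (x - (2 ^ y + 2 ^ y)) + 2 * 2 ^ y" using that by simp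
    then show ?thesis by (metis div_mult_self1 add.commute power_not_zero zero_neq_numeral)
  qed
  ultimately show ?thesis by (auto simp: set_decode_def)
qed

context fall_dp
begin

definition env :: "nat \<Rightarrow> nat \<Rightarrow> (reg \<Rightarrow> nat) \<Rightarrow> arrays \<Rightarrow> bool" where
  "env k W r h \<longleftrightarrow> has_graph r h \<and> r ''k'' = k \<and> r ''W'' = W \<and> r ''W2'' = 2 * W \<and> r ''D'' = 2 ^ (2 * W) \<and>
     r ''b'' = n + 1 \<and> r ''M'' = (n + 1) ^ 2 ^ (2 * W) \<and> r ''L'' = r ''M'' * (r ''M'' * (r ''M'' * (n + 1))) \<and>
     (\<forall>x<2 * W. h 8 x = 2 ^ x) \<and> (\<forall>x<2 ^ (2 * W). h 9 x = (n + 1) ^ x)"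

definition bits :: "nat \<Rightarrow> arrays \<Rightarrow> bool" where
  "bits W h \<longleftrightarrow> (\<forall>x<2 ^ (2 * W). \<forall>y<2 * W. h 13 (x * (2 * W) + y) = of_bool (y \<in> set_decode x))"

lemma env_upd [simp]:
  "x \<notin> {''n'', ''k'', ''W'', ''W2'', ''D'', ''b'', ''M'', ''L''} \<Longrightarrow> env k W (r(x := a)) h \<longleftrightarrow> env k W r h"
  "j \<notin> {8, 9, 16} \<Longrightarrow> env k W r (h(j := f)) \<longleftrightarrow> env k W r h"
  by (auto simp: env_def)

lemma bits_upd [simp]: "j \<noteq> 13 \<Longrightarrow> bits W (h(j := f)) \<longleftrightarrow> bits W h"
  by (auto simp: bits_def)

lemma run_fill_bits:
  assumes "env k W r h"
  obtains f where "run fill_bits (r, h) = (r, h(13 := f))" "bits W (h(13 := f))"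
proof -
  have r: "r ''W2'' = 2 * W" "r ''D'' = 2 ^ (2 * W)" and h8: "\<And>x. x < 2 * W \<Longrightarrow> h 8 x = 2 ^ x"
    using assms by (auto simp: env_def)
  obtain f where f: "run fill_bits (r, h) = (r, h(13 := f))"
    "\<And>x y. x < 2 ^ (2 * W) \<Longrightarrow> y < 2 * W \<Longrightarrow> f (x * (2 * W) + y) = of_bool (y \<in> set_decode x)"
    unfolding fill_bits_def
  proof (rule run_fill_matrix[where x = "''x''" and y = "''y''" and bx = "''D''" and mx = "2 ^ (2 * W)"
        and bw = "''W2''" and my = "2 * W" and j = 13 and r = r and h = h
        and g = "\<lambda>x y. of_bool (y \<in> set_decode x)"])
    fix x y :: nat and f' :: "nat \<Rightarrow> nat"
    assume xy: "x < 2 ^ (2 * W)" "y < 2 * W"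
      and IH: "\<And>l l'. l < x \<Longrightarrow> l' < 2 * W \<Longrightarrow> f' (l * (2 * W) + l') = of_bool (l' \<in> set_decode l)"
    show "eval bit_recurrence (r(''x'' := x, ''y'' := y)) (h(13 := f')) = of_bool (y \<in> set_decode x)"
    proof (cases "x < 2 ^ y + 2 ^ y")
      case True
      then show ?thesis using xy r h8 by (subst set_decode_recurrence) (simp add: bit_recurrence_def)
    next
      case False
      moreover have "(0::nat) < 2 ^ y" by simp
      ultimately have "x - (2 ^ y + 2 ^ y) < x" "\<not> x < 2 ^ y" by linarith+
      with IH[OF this(1) xy(2)] show ?thesis using xy r h8 False
        by (subst set_decode_recurrence) (simp add: bit_recurrence_def EMul_def mult.commute)
    qed
  qed (use r in auto)
  show thesis
    by (rule that[OF f(1)]) (use f(2) in \<open>simp add: bits_def\<close>)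
qed

definition tables_ok :: "nat \<Rightarrow> nat \<Rightarrow> (nat \<Rightarrow> nat) \<Rightarrow> arrays \<Rightarrow> bool" where
  "tables_ok k W c h \<longleftrightarrow> (\<forall>l. fiber c l \<noteq> {} \<longrightarrow> (\<forall>x<(n + 1) ^ 2 ^ (2 * W).
     h 6 (l * (n + 1) ^ 2 ^ (2 * W) + x) \<noteq> 0 \<longleftrightarrow> x \<in> table W (n + 1) k (fiber c l)))"

lemma run_init_tables:
  assumes "env k W r h" "0 < W" "0 < k"
  obtains f where "run init_tables (r, h) = (r, h(6 := f))" "tables_ok k W (\<lambda>u. u) (h(6 := f))"
proof -
  let ?M = "(n + 1) ^ 2 ^ (2 * W)"
  have r: "r ''n'' = n" "r ''k'' = k" "r ''W'' = W" "r ''M'' = ?M" "r ''b'' = n + 1" and h8: "h 8 W = 2 ^ W"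
    and h9: "h 9 (2 ^ W) = (n + 1) ^ 2 ^ W"
    using assms by (auto simp: env_def has_graph_def)
  obtain f where f: "run init_tables (r, h) = (r, h(6 := f))"
    "\<And>x y. x < n \<Longrightarrow> y < ?M \<Longrightarrow> f (x * ?M + y) = of_bool (y + (n + 1) ^ 2 ^ W = n + 1 + k * (n + 1) ^ 2 ^ W)"
    unfolding init_tables_def
    by (rule run_fill_matrix[where x = "''x''" and y = "''y''" and bx = "''n''" and mx = n
        and bw = "''M''" and my = ?M and j = 6 and r = r and h = h
        and g = "\<lambda>x y. of_bool (y + (n + 1) ^ 2 ^ W = n + 1 + k * (n + 1) ^ 2 ^ W)"])
      (use r h8 h9 in \<open>auto simp: EMul_def\<close>)
  have eq: "y + p = n + 1 + k * p \<longleftrightarrow> y = (n + 1) ^ 1 + (k - 1) * p" for y p :: nat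
    using assms(3) by (cases k) auto
  have "tables_ok k W (\<lambda>u. u) (h(6 := f))"
    unfolding tables_ok_def
  proof (intro allI impI)
    fix l x assume l: "fiber (\<lambda>u. u) l \<noteq> {}" and x: "x < ?M"
    then have "l < n" "fiber (\<lambda>u. u) l = {l}" by (auto simp: fiber_def)
    then show "(h(6 := f)) 6 (l * ?M + x) \<noteq> 0 \<longleftrightarrow> x \<in> table W (n + 1) k (fiber (\<lambda>u. u) l)"
      using f(2)[OF \<open>l < n\<close> x] assms(3) unfolding eq by (simp add: table_singleton)
  qed
  then show thesis using that f(1) by blast
qed

lemma eval_bit_exp:
  assumes "env k W r h" "bits W h" "x \<noteq> ''*''" "r x < 2 ^ (2 * W)" "eval e r h < 2 * W"
  shows "holds (bit_exp x e) r h \<longleftrightarrow> eval e r h \<in> set_decode (r x)"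
proof -
  have "r ''W2'' = 2 * W" using assms by (simp add: env_def)
  then show ?thesis using assms by (simp add: bit_exp_def EMul_def bits_def mult.commute)
qed

definition joining :: "nat \<Rightarrow> nat \<Rightarrow> (reg \<Rightarrow> nat) \<Rightarrow> arrays \<Rightarrow> bool" where
  "joining k W r h \<longleftrightarrow> env k W r h \<and> bits W h \<and> r ''a'' \<noteq> r ''c'' \<and>
     (\<forall>u<n. h 5 u = cls (fiber (h 4) (h 4 u)) u \<and> h 5 u < W) \<and>
     (\<forall>u<n. h 11 u = cls (fiber (h 10) (h 10 u)) u \<and> h 11 u < W) \<and>
     (\<forall>u<n. h 10 u = (if h 4 u = r ''c'' then r ''a'' else h 4 u))"

lemma joining_upd [simp]:
  "x \<notin> {''n'', ''k'', ''W'', ''W2'', ''D'', ''b'', ''M'', ''L'', ''a'', ''c''} \<Longrightarrow>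
     joining k W (r(x := a)) h \<longleftrightarrow> joining k W r h"
  "j \<notin> {4, 5, 8, 9, 10, 11, 13, 16} \<Longrightarrow> joining k W r (h(j := f)) \<longleftrightarrow> joining k W r h"
  by (auto simp: joining_def)

lemma joining_fibers:
  assumes "joining k W r h"
  shows "u \<in> fiber (h 4) l \<Longrightarrow> h 5 u = cls (fiber (h 4) l) u" "u < n \<Longrightarrow> h 5 u < W"
    "fiber (h 4) (r ''a'') \<inter> fiber (h 4) (r ''c'') = {}"
    "fiber (h 10) (r ''a'') = fiber (h 4) (r ''a'') \<union> fiber (h 4) (r ''c'')"
    "l \<noteq> r ''a'' \<Longrightarrow> l \<noteq> r ''c'' \<Longrightarrow> fiber (h 10) l = fiber (h 4) l"
    "fiber (h 10) (r ''c'') = {}"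
    "u \<in> fiber (h 4) (r ''a'') \<union> fiber (h 4) (r ''c'') \<Longrightarrow>
       h 11 u = cls (fiber (h 4) (r ''a'') \<union> fiber (h 4) (r ''c'')) u"
    "u < n \<Longrightarrow> h 11 u < W"
proof -
  show c: "fiber (h 10) (r ''a'') = fiber (h 4) (r ''a'') \<union> fiber (h 4) (r ''c'')"
    using assms by (auto simp: joining_def fiber_def)
  show "h 11 u = cls (fiber (h 4) (r ''a'') \<union> fiber (h 4) (r ''c'')) u"
    if "u \<in> fiber (h 4) (r ''a'') \<union> fiber (h 4) (r ''c'')"
  proof -
    have "u < n" "h 10 u = r ''a''" using that unfolding c[symmetric] by (auto simp: fiber_def)
    then show ?thesis using assms c by (auto simp: joining_def)
  qed
qed (use assms in \<open>auto simp: joining_def fiber_def\<close>)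

lemma holds_hit_exp:
  assumes J: "joining k W r h" and u: "u \<noteq> ''*''" "r u < n" "r ''p'' < 2 ^ (2 * W)" "r ''q'' < 2 ^ (2 * W)"
  shows "holds (hit_exp u) r h \<longleftrightarrow> hit (fiber (h 4) (r ''a'')) (fiber (h 4) (r ''c'')) (r ''p'') (r ''q'') (r u)"
proof -
  have "h 5 (r u) < 2 * W" using joining_fibers(2)[OF J u(2)] by simp
  moreover have "env k W r h" "bits W h" using J by (simp_all add: joining_def)
  ultimately show ?thesis
    using u joining_fibers(1)[OF J, of "r u" "h 4 (r u)"]
    by (auto simp: hit_exp_def hit_def eval_bit_exp fiber_def)
qed

lemma holds_compatible_exp:
  assumes J: "joining k W r h" and u: "r ''p'' < 2 ^ (2 * W)" "r ''q'' < 2 ^ (2 * W)"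
  shows "holds compatible_exp r h \<longleftrightarrow>
    compatible (fiber (h 4) (r ''a'')) (fiber (h 4) (r ''c'')) (r ''p'') (r ''q'')"
proof -
  have G: "has_graph r h" and n: "r ''n'' = n" using J by (simp_all add: joining_def env_def has_graph_def)
  have 1: "holds (hit_exp ''u'') (r(''u'' := u, ''v'' := v)) h \<longleftrightarrow> hit (fiber (h 4) (r ''a'')) (fiber (h 4) (r ''c'')) (r ''p'') (r ''q'') u"
    "holds (hit_exp ''v'') (r(''u'' := u, ''v'' := v)) h \<longleftrightarrow> hit (fiber (h 4) (r ''a'')) (fiber (h 4) (r ''c'')) (r ''p'') (r ''q'') v"
    "holds (adj ''u'' ''v'') (r(''u'' := u, ''v'' := v)) h \<longleftrightarrow> E u v"
    if "u < n" "v < n" for u v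
    using holds_hit_exp[of k W "r(''u'' := u, ''v'' := v)" h "''u''"]
      holds_hit_exp[of k W "r(''u'' := u, ''v'' := v)" h "''v''"]
      holds_adj[of "r(''u'' := u, ''v'' := v)" h "''u''" "''v''"] that J u G by simp_all
  then show ?thesis
    unfolding compatible_exp_def compatible_def by (auto simp: n fiber_def)
qed

lemma holds_still_undom_exp:
  assumes J: "joining k W r h" and u: "r ''p'' < 2 ^ (2 * W)" "r ''q'' < 2 ^ (2 * W)" "r ''u'' < n"
  shows "holds still_undom_exp r h \<longleftrightarrow>
    still_undom W (fiber (h 4) (r ''a'')) (fiber (h 4) (r ''c'')) (r ''p'') (r ''q'') (r ''u'')"
proof -
  have G: "has_graph r h" and n: "r ''n'' = n" and W: "r ''W'' = W" and B: "env k W r h" "bits W h"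
    using J by (simp_all add: joining_def env_def has_graph_def)
  have 1: "holds (hit_exp ''v'') (r(''v'' := v)) h \<longleftrightarrow> hit (fiber (h 4) (r ''a'')) (fiber (h 4) (r ''c'')) (r ''p'') (r ''q'') v"
    "holds (adj ''u'' ''v'') (r(''v'' := v)) h \<longleftrightarrow> E (r ''u'') v"
    if "v < n" for v
    using holds_hit_exp[of k W "r(''v'' := v)" h "''v''"]
      holds_adj[of "r(''v'' := v)" h "''u''" "''v''"] that J u G by simp_all
  have "W + h 5 (r ''u'') < 2 * W" using joining_fibers(2)[OF J u(3)] by simp
  then have 2: "holds (bit_exp x (Plus (V ''W'') (Rd 5 (V ''u'')))) r h \<longleftrightarrow> W + h 5 (r ''u'') \<in> set_decode (r x)"
    if "x \<in> {''p'', ''q''}" for x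
    using eval_bit_exp[OF B, of x "Plus (V ''W'') (Rd 5 (V ''u''))"] u that W by auto
  have 3: "h 5 (r ''u'') = cls (fiber (h 4) (h 4 (r ''u''))) (r ''u'')"
    using joining_fibers(1)[OF J] u(3) by (simp add: fiber_def)
  show ?thesis
    unfolding still_undom_exp_def still_undom_def using 1 2 3 u(3) by (auto simp: n fiber_def)
qed

lemma eval_merge_exp:
  assumes J: "joining k W r h" and u: "r ''p'' < 2 ^ (2 * W)" "r ''q'' < 2 ^ (2 * W)"
  shows "eval merge_exp r h = merge_type W (fiber (h 4) (r ''a'')) (fiber (h 4) (r ''c'')) (r ''p'') (r ''q'')"
proof -
  let ?S1 = "fiber (h 4) (r ''a'')" and ?S2 = "fiber (h 4) (r ''c'')"
  let ?hit = "hit ?S1 ?S2 (r ''p'') (r ''q'')" and ?und = "still_undom W ?S1 ?S2 (r ''p'') (r ''q'')"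
  have n: "r ''n'' = n" and W: "r ''W'' = W" "r ''W2'' = 2 * W" and h8: "\<And>x. x < 2 * W \<Longrightarrow> h 8 x = 2 ^ x"
    using J by (simp_all add: joining_def env_def has_graph_def)
  have sub: "u \<in> ?S1 \<union> ?S2" if "?hit u \<or> ?und u" for u using that by (auto simp: hit_def still_undom_def)
  have lt: "u < n" if "?hit u \<or> ?und u" for u using sub[OF that] by (auto simp: fiber_def)
  have 1: "holds (hit_exp ''u'') (r(''s'' := s, ''u'' := u)) h \<longleftrightarrow> ?hit u"
    "holds still_undom_exp (r(''s'' := s, ''u'' := u)) h \<longleftrightarrow> ?und u" if "u < n" for s u
    using holds_hit_exp[of k W "r(''s'' := s, ''u'' := u)" h "''u''"]
      holds_still_undom_exp[of k W "r(''s'' := s, ''u'' := u)" h] that J u by simp_all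
  have "eval merge_exp r h = (\<Sum>s<2 * W. if \<exists>u<n. (?hit u \<and> h 11 u = s) \<or> (?und u \<and> W + h 11 u = s) then 2 ^ s else 0)"
    unfolding merge_exp_def eval.simps(1,7) W(2) by (intro sum.cong refl) (simp add: 1 h8 n W(1) cong: conj_cong)
  also have "\<dots> = set_encode {s. s < 2 * W \<and> (\<exists>u<n. (?hit u \<and> h 11 u = s) \<or> (?und u \<and> W + h 11 u = s))}"
    by (rule sum_if_set_encode)
  also have "{s. s < 2 * W \<and> (\<exists>u<n. (?hit u \<and> h 11 u = s) \<or> (?und u \<and> W + h 11 u = s))} =
      cls (?S1 \<union> ?S2) ` {u. ?hit u} \<union> (\<lambda>u. W + cls (?S1 \<union> ?S2) u) ` {u. ?und u}"
  proof -
    have c: "h 11 u = cls (?S1 \<union> ?S2) u" "h 11 u < W" if "?hit u \<or> ?und u" for u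
      using joining_fibers(7)[OF J sub[OF that]] joining_fibers(8)[OF J lt[OF that]] by metis+
    show ?thesis
    proof (intro equalityI subsetI)
      fix s assume "s \<in> {s. s < 2 * W \<and> (\<exists>u<n. (?hit u \<and> h 11 u = s) \<or> (?und u \<and> W + h 11 u = s))}"
      then show "s \<in> cls (?S1 \<union> ?S2) ` {u. ?hit u} \<union> (\<lambda>u. W + cls (?S1 \<union> ?S2) u) ` {u. ?und u}"
        using c by auto
    next
      fix s assume "s \<in> cls (?S1 \<union> ?S2) ` {u. ?hit u} \<union> (\<lambda>u. W + cls (?S1 \<union> ?S2) u) ` {u. ?und u}"
      then obtain u where "(?hit u \<and> s = cls (?S1 \<union> ?S2) u) \<or> (?und u \<and> s = W + cls (?S1 \<union> ?S2) u)" by auto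
      then show "s \<in> {s. s < 2 * W \<and> (\<exists>u<n. (?hit u \<and> h 11 u = s) \<or> (?und u \<and> W + h 11 u = s))}"
        using c[of u] lt[of u] by auto
    qed
  qed
  finally show ?thesis by (simp add: merge_type_def)
qed

definition weight :: "nat \<Rightarrow> nat set \<Rightarrow> nat set \<Rightarrow> nat \<times> nat \<Rightarrow> nat" where
  "weight W S1 S2 = (\<lambda>(p, q). (n + 1) ^ p + (n + 1) ^ 2 ^ (2 * W) * ((n + 1) ^ q +
     (n + 1) ^ 2 ^ (2 * W) * ((n + 1) ^ merge_type W S1 S2 p q + (n + 1) ^ 2 ^ (2 * W))))"

lemma weight_pos: "0 < weight W S1 S2 a"
  by (simp add: weight_def case_prod_beta)

lemma run_fill_weights:
  assumes J: "joining k W r h"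
  obtains f where "run fill_weights (r, h) = (r, h(12 := f))"
    "\<And>p q. p < 2 ^ (2 * W) \<Longrightarrow> q < 2 ^ (2 * W) \<Longrightarrow> f (p * 2 ^ (2 * W) + q) =
       (if compatible (fiber (h 4) (r ''a'')) (fiber (h 4) (r ''c'')) p q
        then weight W (fiber (h 4) (r ''a'')) (fiber (h 4) (r ''c'')) (p, q) else 0)"
proof -
  let ?S1 = "fiber (h 4) (r ''a'')" and ?S2 = "fiber (h 4) (r ''c'')"
  have r: "r ''D'' = 2 ^ (2 * W)" "r ''M'' = (n + 1) ^ 2 ^ (2 * W)" and h9: "\<And>x. x < 2 ^ (2 * W) \<Longrightarrow> h 9 x = (n + 1) ^ x"
    using J by (auto simp: env_def joining_def)
  show thesis
    unfolding fill_weights_def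
  proof (rule run_fill_matrix[where x = "''p''" and y = "''q''" and bx = "''D''" and mx = "2 ^ (2 * W)"
        and bw = "''D''" and my = "2 ^ (2 * W)" and j = 12 and r = r and h = h
        and g = "\<lambda>p q. if compatible ?S1 ?S2 p q then weight W ?S1 ?S2 (p, q) else 0"
        and e = "Cond compatible_exp weight_exp (C 0)"])
    fix p q :: nat and f' :: "nat \<Rightarrow> nat" assume pq: "p < 2 ^ (2 * W)" "q < 2 ^ (2 * W)"
    let ?r = "\<lambda>v v'. r(''p'' := p, ''q'' := q, ''*'' := v, ''*'' := v')" and ?h = "h(12 := f')"
    have "joining k W (r(''p'' := p, ''q'' := q)) ?h" using J by simp
    from holds_compatible_exp[OF this] pq have 1: "holds compatible_exp (r(''p'' := p, ''q'' := q)) ?h \<longleftrightarrow> compatible ?S1 ?S2 p q"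
      by simp
    have "joining k W (?r v v') ?h" for v v' using J by simp
    from eval_merge_exp[OF this] pq have 2: "eval merge_exp (?r v v') ?h = merge_type W ?S1 ?S2 p q" for v v'
      by simp
    have "cls (?S1 \<union> ?S2) u < W" if u: "u \<in> ?S1 \<union> ?S2" for u
    proof -
      have "u < n" using u by (auto simp: fiber_def)
      from joining_fibers(7)[OF J u] joining_fibers(8)[OF J this] show ?thesis by metis
    qed
    then have "merge_type W ?S1 ?S2 p q < 2 ^ (2 * W)" by (intro merge_type_less) blast
    then show "eval (Cond compatible_exp weight_exp (C 0)) (r(''p'' := p, ''q'' := q)) ?h =
        (if compatible ?S1 ?S2 p q then weight W ?S1 ?S2 (p, q) else 0)"
      using 1 2 pq r h9 by (simp add: weight_exp_def EMul_def weight_def)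
  qed (use r that[unfolded fill_weights_def] in auto)
qed

lemma run_fill_reachable:
  assumes E: "env k W r h"
    and w: "\<And>p q. p < 2 ^ (2 * W) \<Longrightarrow> q < 2 ^ (2 * W) \<Longrightarrow> h 12 (p * 2 ^ (2 * W) + q) = (if ok p q then w (p, q) else 0)"
    and pos: "\<And>a. 0 < w a"
  obtains f where "run fill_reachable (r, h) = (r, h(7 := f))"
    "\<And>x. x < r ''L'' \<Longrightarrow> f x \<noteq> 0 \<longleftrightarrow> x = 0 \<or> (\<exists>p<2 ^ (2 * W). \<exists>q<2 ^ (2 * W). ok p q \<and> w (p, q) \<le> x \<and> f (x - w (p, q)) \<noteq> 0)"
proof -
  let ?D = "2 ^ (2 * W)"
  have r: "r ''D'' = ?D" using E by (auto simp: env_def)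
  define A where "A = {(p, q). p < ?D \<and> q < ?D \<and> ok p q}"
  have rec: "x \<in> reach w A \<longleftrightarrow> x = 0 \<or> (\<exists>p<?D. \<exists>q<?D. ok p q \<and> w (p, q) \<le> x \<and> x - w (p, q) \<in> reach w A)" for x
    by (subst reach_iff) (auto simp: A_def)
  obtain f where f: "run fill_reachable (r, h) = (r, h(7 := f))" "\<And>x. x < r ''L'' \<Longrightarrow> f x = of_bool (x \<in> reach w A)"
    unfolding fill_reachable_def
  proof (rule run_fill_range[where x = "''x''" and r = r and h = h and b = "V ''L''" and j = 7 and m = "r ''L''"
        and g = "\<lambda>x. of_bool (x \<in> reach w A)"])
    fix x :: nat and f' :: "nat \<Rightarrow> nat" assume IH: "\<And>x'. x' < x \<Longrightarrow> f' x' = of_bool (x' \<in> reach w A)"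
    have w_at: "eval weight_at (r(''x'' := x, ''p'' := p, ''q'' := q)) (h(7 := f')) = (if ok p q then w (p, q) else 0)"
      "holds weight_at (r(''x'' := x, ''p'' := p, ''q'' := q)) (h(7 := f')) \<longleftrightarrow> ok p q"
      if "p < ?D" "q < ?D" for p q
      using w[OF that] r pos[of "(p, q)"] by (simp_all add: weight_at_def EMul_def mult.commute)
    have f': "0 < f' (x - w (p, q)) \<longleftrightarrow> x - w (p, q) \<in> reach w A" if "w (p, q) \<le> x" for p q
      using IH[of "x - w (p, q)"] pos[of "(p, q)"] that by simp
    show "eval (EBool reachable_exp) (r(''x'' := x)) (h(7 := f')) = of_bool (x \<in> reach w A)"
      by (subst rec) (simp add: reachable_exp_def r w_at f' not_less cong: conj_cong)
  qed auto
  show thesis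
  proof (rule that[OF f(1)])
    fix x assume x: "x < r ''L''"
    have fr: "f y \<noteq> 0 \<longleftrightarrow> y \<in> reach w A" if "y \<le> x" for y
      using f(2)[of y] x that by simp
    show "f x \<noteq> 0 \<longleftrightarrow> x = 0 \<or> (\<exists>p<?D. \<exists>q<?D. ok p q \<and> w (p, q) \<le> x \<and> f (x - w (p, q)) \<noteq> 0)"
      unfolding fr[OF order_refl] fr[OF diff_le_self] by (rule rec)
  qed
qed

lemma run_join_tables:
  assumes E: "env k W r h"
  defines "M \<equiv> (n + 1) ^ 2 ^ (2 * W)"
  obtains f g where "run join_tables (r, h) = (r, h(14 := g, 6 := f))"
    "\<And>z. z < M \<Longrightarrow> f (r ''a'' * M + z) \<noteq> 0 \<longleftrightarrow> (\<exists>x<M. \<exists>y<M. h 6 (r ''a'' * M + x) \<noteq> 0 \<and> h 6 (r ''c'' * M + y) \<noteq> 0 \<and>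
       h 7 (x + M * (y + M * (z + M * k))) \<noteq> 0)"
    "\<And>l z. l \<noteq> r ''a'' \<Longrightarrow> z < M \<Longrightarrow> f (l * M + z) = h 6 (l * M + z)"
proof -
  have r: "r ''M'' = M" "r ''k'' = k" using E by (auto simp: env_def M_def)
  let ?P = "\<lambda>z. \<exists>x<M. \<exists>y<M. (h 6 (r ''a'' * M + x) \<noteq> 0 \<and> h 6 (r ''c'' * M + y) \<noteq> 0) \<and>
       h 7 (x + M * (y + M * (z + M * k))) \<noteq> 0"
  obtain g where g: "run (For ''z'' (V ''M'') (Sto 14 (V ''z'') (EBool joined_exp))) (r, h) = (r, h(14 := g))"
    "\<And>z. z < M \<Longrightarrow> g z = of_bool (?P z)"
  proof (rule run_fill_range[where x = "''z''" and r = r and h = h and b = "V ''M''" and j = 14 and m = M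
        and g = "\<lambda>z. of_bool (?P z)"])
    fix z :: nat and f' :: "nat \<Rightarrow> nat"
    show "eval (EBool joined_exp) (r(''z'' := z)) (h(14 := f')) = of_bool (?P z)"
      using r by (simp add: joined_exp_def EMul_def mult.commute)
  qed (use r in auto)
  let ?c = "\<lambda>z. r ''a'' * M + z"
  obtain f where f: "run (For ''z'' (V ''M'') (Sto 6 (Plus (EMul (V ''a'') ''M'') (V ''z'')) (Rd 14 (V ''z'')))) (r, h(14 := g))
      = (r, (h(14 := g))(6 := f))" "\<And>z. z < M \<Longrightarrow> f (?c z) = g z" "\<And>y. y \<notin> ?c ` {..<M} \<Longrightarrow> f y = (h(14 := g)) 6 y"
    by (rule run_fill[where x = "''z''" and r = r and h = "h(14 := g)" and b = "V ''M''" and j = 6 and m = M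
        and c = ?c and g = g and a = "Plus (EMul (V ''a'') ''M'') (V ''z'')" and e = "Rd 14 (V ''z'')"])
      (use r in \<open>auto simp: EMul_def inj_on_def mult.commute\<close>)
  have "l * M + z \<notin> ?c ` {..<M}" if "l \<noteq> r ''a''" "z < M" for l z
  proof
    assume "l * M + z \<in> ?c ` {..<M}"
    then obtain z' where "z' < M" "l * M + z = r ''a'' * M + z'" by auto
    then show False using add_mult_eq_iff[of z M z' l "r ''a''"] that by (simp add: mult.commute add.commute)
  qed
  then have other: "f (l * M + z) = h 6 (l * M + z)" if "l \<noteq> r ''a''" "z < M" for l z
    using f(3)[of "l * M + z"] that by simp
  have "run join_tables (r, h) = (r, h(14 := g, 6 := f))"
    unfolding join_tables_def by (simp add: g(1) f(1))
  then show thesis using that[of g f] f(2) g(2) other by auto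
qed

definition valid_merges :: "(nat \<times> nat) list \<Rightarrow> bool" where
  "valid_merges ms \<longleftrightarrow> (\<forall>i<length ms. fst (ms ! i) \<noteq> snd (ms ! i) \<and>
     fiber (comps (take i ms)) (fst (ms ! i)) \<noteq> {} \<and> fiber (comps (take i ms)) (snd (ms ! i)) \<noteq> {})"

lemma run_merge_step:
  assumes E: "env k W r h" "bits W h" and ms: "has_merges ms r h" "i < length ms" "r ''i'' = i"
    and st: "stage ms i h" and T: "tables_ok k W (comps (take i ms)) h"
    and v: "valid_merges ms" and W: "width_ok ms (length ms) W" and k: "k < n + 1"
  obtains h1 where "run merge_step (r, h) = (r(''a'' := fst (ms ! i), ''c'' := snd (ms ! i)), h1)"
    "env k W r h1" "bits W h1" "has_merges ms r h1" "stage ms (Suc i) h1"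
    "tables_ok k W (comps (take (Suc i) ms)) h1"
proof -
  define a c where "a = fst (ms ! i)" and "c = snd (ms ! i)"
  let ?C = "comps (take i ms)" and ?C' = "comps (take (Suc i) ms)"
  define r1 where "r1 = r(''a'' := a, ''c'' := c)"
  have G: "has_graph r h" using E by (simp add: env_def)
  have ac: "h 2 i = a" "h 3 i = c" "a \<noteq> c" "fiber ?C a \<noteq> {}" "fiber ?C c \<noteq> {}"
    using ms v by (auto simp: has_merges_def valid_merges_def a_def c_def)
  obtain f g where fg: "run update (r, h) = (r1, h(10 := f, 11 := g))"
    "\<And>u. u < n \<Longrightarrow> f u = (if h 4 u = c then a else h 4 u)"
    "\<And>u. u < n \<Longrightarrow> g u = cls (fiber f (f u)) u"
    by (rule run_update[OF G]) (use ac ms(3) in \<open>simp add: r1_def\<close>)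
  have h4: "h 4 u = ?C u" if "u < n" for u using st that by (simp add: stage_def)
  have F: "fiber (h 4) l = fiber ?C l" for l by (rule fiber_cong[OF h4])
  have fC: "f u = ?C' u" if "u < n" for u
    using fg(2)[OF that] h4[OF that] comps_take_Suc[OF ms(2), of u] by (simp add: a_def c_def)
  have F': "fiber f l = fiber ?C' l" for l by (rule fiber_cong[OF fC])
  define h1 where "h1 = h(10 := f, 11 := g)"
  have J: "joining k W r1 h1"
    unfolding joining_def
  proof (intro conjI allI impI)
    show "h1 5 u = cls (fiber (h1 4) (h1 4 u)) u" if "u < n" for u
      using st that by (simp add: stage_def h1_def F)
    show "h1 5 u < W" if "u < n" for u
      using st W that ms(2) by (simp add: stage_def h1_def width_ok_def)
    show "h1 11 u < W" if "u < n" for u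
      using W that ms(2) by (simp add: h1_def fg(3) F' fC width_ok_def)
  qed (use E ac fg in \<open>simp_all add: r1_def h1_def\<close>)
  let ?S1 = "fiber ?C a" and ?S2 = "fiber ?C c"
  have h1: "h1 4 = h 4" "r1 ''a'' = a" "r1 ''c'' = c" by (simp_all add: h1_def r1_def)
  note fib = joining_fibers[OF J, unfolded h1 F]
  have F10: "fiber (h1 10) l = fiber ?C' l" for l by (simp add: h1_def F')
  define D where "D = (2::nat) ^ (2 * W)"
  define M where "M = (n + 1) ^ 2 ^ (2 * W)"
  obtain e where e: "run fill_weights (r1, h1) = (r1, h1(12 := e))"
    "\<And>p q. p < 2 ^ (2 * W) \<Longrightarrow> q < 2 ^ (2 * W) \<Longrightarrow> e (p * 2 ^ (2 * W) + q) =
       (if compatible ?S1 ?S2 p q then weight W ?S1 ?S2 (p, q) else 0)"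
    by (rule run_fill_weights[OF J, unfolded h1 F]) (rule that)
  define h2 where "h2 = h1(12 := e)"
  have E2: "env k W r1 h2" using J by (simp add: joining_def h2_def)
  have e2: "h2 12 (p * 2 ^ (2 * W) + q) = (if compatible ?S1 ?S2 p q then weight W ?S1 ?S2 (p, q) else 0)"
    if "p < 2 ^ (2 * W)" "q < 2 ^ (2 * W)" for p q
    by (simp add: h2_def e(2)[OF that])
  obtain j where j: "run fill_reachable (r1, h2) = (r1, h2(7 := j))"
    "\<And>x. x < r1 ''L'' \<Longrightarrow> j x \<noteq> 0 \<longleftrightarrow> x = 0 \<or> (\<exists>p<2 ^ (2 * W). \<exists>q<2 ^ (2 * W). compatible ?S1 ?S2 p q \<and>
        weight W ?S1 ?S2 (p, q) \<le> x \<and> j (x - weight W ?S1 ?S2 (p, q)) \<noteq> 0)"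
    by (rule run_fill_reachable[OF E2 e2 weight_pos]) (assumption | rule that)+
  define h3 where "h3 = h2(7 := j)"
  have E3: "env k W r1 h3" using E2 by (simp add: h3_def)
  obtain t t' where t: "run join_tables (r1, h3) = (r1, h3(14 := t', 6 := t))"
    "\<And>z. z < M \<Longrightarrow> t (a * M + z) \<noteq> 0 \<longleftrightarrow> (\<exists>x<M. \<exists>y<M. h3 6 (a * M + x) \<noteq> 0 \<and> h3 6 (c * M + y) \<noteq> 0 \<and>
       h3 7 (x + M * (y + M * (z + M * k))) \<noteq> 0)"
    "\<And>l z. l \<noteq> a \<Longrightarrow> z < M \<Longrightarrow> t (l * M + z) = h3 6 (l * M + z)"
    by (rule run_join_tables[OF E3, unfolded h1, folded M_def]) (rule that)
  define h4' where "h4' = h3(14 := t', 6 := t)"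
  have E4: "env k W r1 h4'" using E3 by (simp add: h4'_def)
  then have "has_graph r1 h4'" by (simp add: env_def)
  then obtain f' g' where c': "run commit (r1, h4') = (r1, h4'(4 := f', 5 := g'))"
    "\<And>u. u < n \<Longrightarrow> f' u = h4' 10 u" "\<And>u. u < n \<Longrightarrow> g' u = h4' 11 u"
    by (rule run_commit) (rule that)
  define h5 where "h5 = h4'(4 := f', 5 := g')"
  have run: "run merge_step (r, h) = (r1, h5)"
    by (simp add: merge_step_def fg(1) e(1) j(1) t(1) c'(1)
        flip: h1_def h2_def h3_def h4'_def h5_def)
  have st': "stage ms (Suc i) h5"
    by (rule stage_Suc[OF st ms(2,1), of f g])
      (use fg c' ac in \<open>auto simp: h5_def h4'_def h3_def h2_def h1_def\<close>)
  have h6: "h3 6 = h 6" "h5 6 = t" "h3 7 = j" by (simp_all add: h5_def h4'_def h3_def h2_def h1_def)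
  have T': "tables_ok k W ?C' h5"
    unfolding tables_ok_def M_def[symmetric]
  proof (intro allI impI)
    fix l x assume l: "fiber ?C' l \<noteq> {}" and x: "x < M"
    show "h5 6 (l * M + x) \<noteq> 0 \<longleftrightarrow> x \<in> table W (n + 1) k (fiber ?C' l)"
    proof (cases "l = a")
      case False
      have "l \<noteq> c" using l fib(6) F10 by auto
      then have same: "fiber ?C' l = fiber ?C l" using fib(5)[of l] False F10 by simp
      then show ?thesis using T l x t(3)[OF False x] unfolding tables_ok_def M_def[symmetric] h6 by simp
    next
      case True
      have un: "fiber ?C' a = ?S1 \<union> ?S2" using fib(4) F10 by simp
      have T1: "h 6 (a * M + y) \<noteq> 0 \<longleftrightarrow> y \<in> table W (n + 1) k ?S1" "h 6 (c * M + y) \<noteq> 0 \<longleftrightarrow> y \<in> table W (n + 1) k ?S2"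
        if "y < M" for y
        using T ac(4,5) that unfolding tables_ok_def M_def[symmetric] by blast+
      have cl: "\<forall>u\<in>?S1. cls ?S1 u < W" "\<forall>u\<in>?S2. cls ?S2 u < W"
        using W ms(2) by (auto simp: width_ok_def fiber_def)
      have "cls (fiber ?C' a) u < W" if "u \<in> fiber ?C' a" for u
        using W ms(2) that unfolding width_ok_def by (force simp: fiber_def)
      then have cl': "\<forall>u\<in>?S1 \<union> ?S2. cls (?S1 \<union> ?S2) u < W" unfolding un by blast
      have L: "r1 ''L'' = M * (M * (M * (n + 1)))" using E2 by (simp add: env_def M_def)
      have "x \<in> table W (n + 1) k (?S1 \<union> ?S2) \<longleftrightarrow> (\<exists>x1<M. \<exists>x2<M. x1 \<in> table W (n + 1) k ?S1 \<and>
          x2 \<in> table W (n + 1) k ?S2 \<and> j (x1 + M * (x2 + M * (x + M * k))) \<noteq> 0)"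
        unfolding M_def
        by (rule table_union_reachable[OF finite_fiber finite_fiber fib(3) fiber_sub fiber_sub k cl cl',
              where J = "\<lambda>y. j y \<noteq> 0"])
          (rule j(2)[unfolded L weight_def M_def], assumption, rule x[unfolded M_def])
      then show ?thesis unfolding True un h6 t(2)[OF x] using T1 by blast
    qed
  qed
  show thesis
  proof (rule that[of h5])
    show "env k W r h5" "bits W h5" "has_merges ms r h5"
      using E ms(1) by (simp_all add: h5_def h4'_def h3_def h2_def h1_def)
  qed (use run st' T' in \<open>simp_all add: r1_def a_def c_def\<close>)
qed

lemma run_dynamic_program:
  assumes E: "env k W r h" and ms: "has_merges ms r h" "valid_merges ms"
    and W: "width_ok ms (length ms) W" "0 < W" and k: "0 < k" "k < n + 1" and n: "0 < n"
    and final: "\<And>u. u < n \<Longrightarrow> comps ms u = comps ms 0"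
  shows "fst (run dynamic_program (r, h)) ''out'' = of_bool (\<exists>f. dominating_coloring k f)"
proof -
  obtain b where b: "run fill_bits (r, h) = (r, h(13 := b))" "bits W (h(13 := b))"
    by (rule run_fill_bits[OF E]) (rule that)
  have "has_graph r (h(13 := b))" using E by (simp add: env_def)
  then obtain f g where fg: "run init (r, h(13 := b)) = (r, h(13 := b, 4 := f, 5 := g))"
    "\<And>u. u < n \<Longrightarrow> f u = u" "\<And>u. u < n \<Longrightarrow> g u = 0" by (rule run_init) (rule that)
  have "env k W r (h(13 := b, 4 := f, 5 := g))" using E by simp
  then obtain t where t: "run init_tables (r, h(13 := b, 4 := f, 5 := g)) = (r, h(13 := b, 4 := f, 5 := g, 6 := t))"
    "tables_ok k W (\<lambda>u. u) (h(13 := b, 4 := f, 5 := g, 6 := t))"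
    using W(2) k(1) by (rule run_init_tables) (rule that)
  let ?h = "h(13 := b, 4 := f, 5 := g, 6 := t)"
  define P where "P i r1 h1 \<longleftrightarrow> env k W r1 h1 \<and> bits W h1 \<and> has_merges ms r1 h1 \<and> stage ms i h1 \<and>
      tables_ok k W (comps (take i ms)) h1" for i r1 h1
  have C0: "comps (take 0 ms) = (\<lambda>u. u)" by auto
  have "stage ms 0 ?h" using fg by (intro stage_init) auto
  then have P0: "P 0 r ?h" using E b(2) ms(1) t(2) unfolding P_def C0 by simp
  have PS: "P (Suc i) (fst (run merge_step (r1(''i'' := i), h1))) (snd (run merge_step (r1(''i'' := i), h1)))"
    if i: "i < length ms" and P: "P i r1 h1" for i r1 h1
  proof -
    from P have "env k W (r1(''i'' := i)) h1" "bits W h1" "has_merges ms (r1(''i'' := i)) h1" "stage ms i h1"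
      "tables_ok k W (comps (take i ms)) h1" by (simp_all add: P_def)
    then obtain h2 where "run merge_step (r1(''i'' := i), h1) = (r1(''i'' := i, ''a'' := fst (ms ! i), ''c'' := snd (ms ! i)), h2)"
      "env k W (r1(''i'' := i)) h2" "bits W h2" "has_merges ms (r1(''i'' := i)) h2" "stage ms (Suc i) h2"
      "tables_ok k W (comps (take (Suc i) ms)) h2"
      using run_merge_step[of k W "r1(''i'' := i)" h1 ms i] i ms(2) W(1) k(2) by auto
    then show ?thesis by (simp add: P_def)
  qed
  obtain r1 h1 where P: "P (length ms) r1 h1"
    and run: "run (For ''i'' (V ''m'') merge_step) (r, ?h) = (r1(''i'' := r ''i''), h1)"
    using run_For_invariant[where P = P and x = "''i''" and s = merge_step and b = "V ''m''" and m = "length ms", OF _ P0 PS]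
      ms(1) by (auto simp: has_merges_def)
  define M where "M = (n + 1) ^ 2 ^ (2 * W)"
  have r1: "r1 ''M'' = M" "r1 ''b'' = n + 1" "r1 ''k'' = k" using P by (auto simp: P_def env_def M_def)
  have "h1 4 0 = comps ms 0" using P n by (simp add: P_def stage_def)
  then have out: "fst (run dynamic_program (r, h)) ''out'' = of_bool (h1 6 (comps ms 0 * M + k * (n + 1)) \<noteq> 0)"
    by (simp add: dynamic_program_def b(1) fg(1) t(1) run answer_def r1 EMul_def mult.commute)
  have fib: "fiber (comps ms) (comps ms 0) = {..<n}" using final by (auto simp: fiber_def)
  moreover have "k * (n + 1) < M"
  proof -
    have "k * (n + 1) < (n + 1) ^ 2" unfolding power2_eq_square by (rule mult_strict_right_mono[OF k(2)]) simp
    also have "\<dots> \<le> M" unfolding M_def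
      using W(2) power_increasing[of 1 "2 * W" "2::nat"] by (intro power_increasing) auto
    finally show ?thesis .
  qed
  moreover have "tables_ok k W (comps ms) h1" using P by (simp add: P_def)
  ultimately have "h1 6 (comps ms 0 * M + k * (n + 1)) \<noteq> 0 \<longleftrightarrow> k * (n + 1) \<in> table W (n + 1) k {..<n}"
    using n fib unfolding tables_ok_def M_def[symmetric] by force
  then show ?thesis unfolding out using table_accepts[OF n k(2) W(2)] by simp
qed

end


section \<open>From the decomposition tree to a list of merges\<close>

locale decomposition =
  fixes G :: "nat graph" and T :: "nat rtree" and \<delta> :: "nat \<Rightarrow> nat" and n N w :: nat
  assumes graph: "simple_graph G" and verts: "verts G = {..<n}" and nodes: "nodes T = {..<N}"
    and decomposition: "rooted_branch_decomposition G T \<delta>" and width: "module_width G T \<delta> = w"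
begin

definition E :: "nat \<Rightarrow> nat \<Rightarrow> bool" where
  "E u v \<longleftrightarrow> {u, v} \<in> edges G"

sublocale fall_dp n E
proof
  show "E v u" if "E u v" for u v using that by (simp add: E_def insert_commute)
  show "\<not> E u u" for u using graph by (auto simp: E_def simple_graph_def)
qed

abbreviation below :: "nat \<Rightarrow> nat set" where
  "below t \<equiv> verts_below G T \<delta> t"

lemma tree: "rooted_tree T" and bij: "bij_betw \<delta> {..<n} (leaves T)"
  using decomposition verts by (simp_all add: rooted_branch_decomposition_def)

lemma root_node: "root T < N" and parent_root: "parent T (root T) = root T"
  using tree nodes by (auto simp: rooted_tree_def)

lemma parent_node: "t < N \<Longrightarrow> parent T t < N"
  using tree nodes by (auto simp: rooted_tree_def)

lemma reaches_root: "t < N \<Longrightarrow> \<exists>i. (parent T ^^ i) t = root T"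
  using tree nodes by (auto simp: rooted_tree_def)

lemma funpow_parent_node: "t < N \<Longrightarrow> (parent T ^^ i) t < N"
  by (induction i) (auto intro: parent_node)

lemma children_iff: "s \<in> children T t \<longleftrightarrow> s < N \<and> s \<noteq> root T \<and> parent T s = t"
  by (simp add: children_def nodes)

lemma finite_children [simp]: "finite (children T t)"
  by (rule finite_subset[of _ "{..<N}"]) (auto simp: children_iff)

lemma card_children: "t < N \<Longrightarrow> card (children T t) \<le> 3"
proof -
  assume "t < N"
  then have "tree_degree T t \<le> 3" using decomposition nodes by (simp add: rooted_branch_decomposition_def)
  then show ?thesis by (simp add: tree_degree_def)
qed

lemma leaf: "u < n \<Longrightarrow> \<delta> u < N \<and> children T (\<delta> u) = {}"
  using bij nodes by (auto simp: bij_betw_def leaves_def)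

lemma leaf_inj: "u < n \<Longrightarrow> v < n \<Longrightarrow> \<delta> u = \<delta> v \<Longrightarrow> u = v"
  using bij by (auto simp: bij_betw_def inj_on_def)

lemma leafE: "t < N \<Longrightarrow> children T t = {} \<Longrightarrow> \<exists>u<n. t = \<delta> u"
proof -
  assume "t < N" "children T t = {}"
  then have "t \<in> leaves T" by (simp add: leaves_def nodes)
  then have "t \<in> \<delta> ` {..<n}" using bij by (simp add: bij_betw_def)
  then show ?thesis by auto
qed

lemma subtree_iff: "s \<in> subtree_nodes T t \<longleftrightarrow> s < N \<and> (\<exists>i. (parent T ^^ i) s = t)"
  by (simp add: subtree_nodes_def nodes)

lemma subtree_unfold: "t < N \<Longrightarrow> subtree_nodes T t = insert t (\<Union>s\<in>children T t. subtree_nodes T s)"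
proof (intro equalityI subsetI)
  fix x assume t: "t < N" and "x \<in> subtree_nodes T t"
  then have x: "x < N" and ex: "\<exists>i. (parent T ^^ i) x = t" by (auto simp: subtree_iff)
  define i where "i = (LEAST i. (parent T ^^ i) x = t)"
  have i: "(parent T ^^ i) x = t" unfolding i_def using ex by (rule LeastI_ex)
  have least: "(parent T ^^ j) x \<noteq> t" if "j < i" for j
    using not_less_Least[of j "\<lambda>i. (parent T ^^ i) x = t"] that by (simp add: i_def)
  show "x \<in> insert t (\<Union>s\<in>children T t. subtree_nodes T s)"
  proof (cases i)
    case 0
    then show ?thesis using i by simp
  next
    case (Suc j)
    let ?s = "(parent T ^^ j) x"
    have "parent T ?s = t" using i Suc by simp
    moreover have "?s < N" using x by (rule funpow_parent_node)
    moreover have "?s \<noteq> root T" using least[of j] Suc calculation(1) parent_root by auto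
    ultimately have "?s \<in> children T t" by (simp add: children_iff)
    then show ?thesis using x by (auto simp: subtree_iff)
  qed
next
  fix x assume t: "t < N" and "x \<in> insert t (\<Union>s\<in>children T t. subtree_nodes T s)"
  then show "x \<in> subtree_nodes T t"
  proof (elim insertE UN_E)
    assume "x = t"
    then show ?thesis using t by (auto simp: subtree_iff intro: exI[of _ 0])
  next
    fix s assume s: "s \<in> children T t" "x \<in> subtree_nodes T s"
    then obtain i where "(parent T ^^ i) x = s" by (auto simp: subtree_iff)
    then have "(parent T ^^ Suc i) x = t" using s by (simp add: children_iff)
    then show ?thesis using s unfolding subtree_iff by blast
  qed
qed

lemma below_iff: "u \<in> below t \<longleftrightarrow> u < n \<and> \<delta> u \<in> subtree_nodes T t"
  by (simp add: verts_below_def verts)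

lemma below_children: "t < N \<Longrightarrow> children T t \<noteq> {} \<Longrightarrow> below t = (\<Union>s\<in>children T t. below s)"
  using leaf by (auto simp: below_iff subtree_unfold)

lemma below_leaf: "u < n \<Longrightarrow> below (\<delta> u) = {u}"
  using leaf leaf_inj by (auto simp: below_iff subtree_unfold)

lemma below_root: "below (root T) = {..<n}"
  using leaf reaches_root by (auto simp: below_iff subtree_iff)

lemma finite_below [simp]: "finite (below t)"
  by (rule finite_subset[of _ "{..<n}"]) (auto simp: below_iff)

lemma subtree_closed:
  assumes "\<forall>s\<in>Y. children T s \<subseteq> Y" "s \<in> Y" "x \<in> subtree_nodes T s"
  shows "x \<in> Y"
proof -
  have "x \<in> Y" if "(parent T ^^ i) x = s" "x < N" for x i
    using that
  proof (induction i arbitrary: x)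
    case 0
    then show ?case using assms by simp
  next
    case (Suc i)
    then have p: "parent T x \<in> Y" using Suc.IH[of "parent T x"] parent_node by (simp add: funpow_swap1)
    show ?case
    proof (cases "x = root T")
      case True
      then show ?thesis using p parent_root by simp
    next
      case False
      then have "x \<in> children T (parent T x)" using Suc.prems by (simp add: children_iff)
      then show ?thesis using assms(1) p by blast
    qed
  qed
  then show ?thesis using assms(3) by (auto simp: subtree_iff)
qed

lemma tops_disjoint:
  assumes Y: "\<forall>s\<in>Y. children T s \<subseteq> Y" and s: "s \<in> Y" "parent T s \<notin> Y" "s' \<in> Y" "parent T s' \<notin> Y" "s \<noteq> s'"
  shows "below s \<inter> below s' = {}"
proof -
  have False if s: "s \<in> Y" "parent T s \<notin> Y" "s' \<in> Y" "s \<noteq> s'" and x: "x < N" "(parent T ^^ i) x = s"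
    "(parent T ^^ j) x = s'" "i \<le> j" for s s' x i j
  proof -
    have "i \<noteq> j" using s x by auto
    then obtain d where d: "j = d + Suc i" using x(4) by (metis add.commute add_Suc_right le_imp_less_or_eq less_imp_Suc_add)
    have "(parent T ^^ d) (parent T s) = s'" using x(2,3) unfolding d funpow_add by simp
    moreover have "parent T s < N" using x(1,2) funpow_parent_node parent_node by blast
    ultimately have "parent T s \<in> subtree_nodes T s'" by (auto simp: subtree_iff)
    then show False using subtree_closed[OF Y s(3)] s(2) by blast
  qed
  then have "\<not> (u \<in> below s \<and> u \<in> below s')" for u
    unfolding below_iff subtree_iff using s by (metis nat_le_linear)
  then show ?thesis by blast
qed

lemma all_nodes:
  assumes "X \<subseteq> {..<N}" and step: "\<And>p. p < N \<Longrightarrow> children T p \<subseteq> X \<Longrightarrow> p \<in> X"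
  shows "X = {..<N}"
proof (rule ccontr)
  assume "X \<noteq> {..<N}"
  then have ne: "{..<N} - X \<noteq> {}" using assms(1) by blast
  define d where "d t = (LEAST i. (parent T ^^ i) t = root T)" for t
  have "Max (d ` ({..<N} - X)) \<in> d ` ({..<N} - X)" using ne by (intro Max_in) auto
  then obtain p where p: "p \<in> {..<N} - X" and dp: "d p = Max (d ` ({..<N} - X))" by (metis imageE)
  have max: "\<forall>s\<in>{..<N} - X. d s \<le> d p" unfolding dp by (intro ballI Max_ge) auto
  have "s \<in> X" if s: "s \<in> children T p" for s
  proof (rule ccontr)
    assume "s \<notin> X"
    then have "d s \<le> d p" using max s by (auto simp: children_iff)
    have "s < N" "s \<noteq> root T" "parent T s = p" using s by (auto simp: children_iff)
    have ds: "(parent T ^^ d s) s = root T"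
      unfolding d_def using reaches_root[OF \<open>s < N\<close>] by (rule LeastI_ex)
    with \<open>s \<noteq> root T\<close> obtain i where i: "d s = Suc i" by (cases "d s") auto
    then have "(parent T ^^ i) p = root T" using ds \<open>parent T s = p\<close> by (simp add: funpow_swap1)
    then have "d p \<le> i" unfolding d_def by (rule Least_le)
    then show False using i \<open>d s \<le> d p\<close> by simp
  qed
  then show False using step p by auto
qed

lemma twin_rel_eq: "twin_rel G S = {(u, v). u \<in> S \<and> v \<in> S \<and> twin S u v}"
proof -
  have "nbhd G u \<inter> (verts G - S) = {x. x < n \<and> x \<notin> S \<and> E u x}" for u
    by (auto simp: nbhd_def verts E_def)
  moreover have "{x. x < n \<and> x \<notin> S \<and> E u x} = {x. x < n \<and> x \<notin> S \<and> E v x} \<longleftrightarrow> twin S u v" for u v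
    unfolding twin_def by blast
  ultimately show ?thesis by (simp add: twin_rel_def)
qed

lemma card_classes: "t < N \<Longrightarrow> card (below t // {(u, v). u \<in> below t \<and> v \<in> below t \<and> twin (below t) u v}) \<le> w"
  unfolding twin_rel_eq[symmetric] width[symmetric] module_width_def nodes
  by (intro Max_ge) auto

lemma card_firsts_children:
  assumes "p < N" "S \<subseteq> children T p"
  shows "card (firsts (\<Union>(below ` S))) \<le> 3 * w"
proof -
  have fin: "finite S" using assms(2) finite_children finite_subset by blast
  have "card (firsts (\<Union>(below ` S))) \<le> (\<Sum>A\<in>below ` S. card (A // {(u, v). u \<in> A \<and> v \<in> A \<and> twin A u v}))"
    using fin by (intro card_firsts_Union) auto
  also have "\<dots> \<le> (\<Sum>A\<in>below ` S. w)"
    using assms by (intro sum_mono) (auto simp: children_iff intro!: card_classes)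
  also have "\<dots> = card (below ` S) * w" by simp
  also have "\<dots> \<le> 3 * w"
    using card_image_le[OF fin, of below] card_mono[OF finite_children assms(2)] card_children[OF assms(1)]
    by (intro mult_le_mono1) simp
  finally show ?thesis .
qed

definition narrow :: "(nat \<times> nat) list \<Rightarrow> bool" where
  "narrow ms \<longleftrightarrow> (\<forall>i\<le>length ms. \<forall>u<n.
     card (firsts (fiber (comps (take i ms)) (comps (take i ms) u))) \<le> 3 * w + 1)"

lemma fiber_snoc:
  "a \<noteq> c \<Longrightarrow> fiber (comps (ms @ [(a, c)])) l =
     (if l = a then fiber (comps ms) a \<union> fiber (comps ms) c else if l = c then {} else fiber (comps ms) l)"
  by (auto simp: fiber_def)

lemma valid_merges_snoc:
  assumes "valid_merges ms" "a \<noteq> c" "fiber (comps ms) a \<noteq> {}" "fiber (comps ms) c \<noteq> {}"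
  shows "valid_merges (ms @ [(a, c)])"
  using assms by (auto simp: valid_merges_def nth_append less_Suc_eq)

lemma narrow_snoc:
  assumes "narrow ms" "a \<noteq> c" "card (firsts (fiber (comps ms) a \<union> fiber (comps ms) c)) \<le> 3 * w"
  shows "narrow (ms @ [(a, c)])"
  unfolding narrow_def
proof (intro allI impI)
  fix i u assume i: "i \<le> length (ms @ [(a, c)])" and u: "u < n"
  show "card (firsts (fiber (comps (take i (ms @ [(a, c)]))) (comps (take i (ms @ [(a, c)])) u))) \<le> 3 * w + 1"
  proof (cases "i = Suc (length ms)")
    case False
    then show ?thesis using assms(1) i u by (simp add: narrow_def)
  next
    case True
    have "card (firsts (fiber (comps ms) (comps ms u))) \<le> 3 * w + 1"
      using assms(1) u unfolding narrow_def by (metis order_refl take_all)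
    then show ?thesis using assms(2,3) True by (simp add: fiber_snoc)
  qed
qed

text \<open>\<open>X\<close> is the set of nodes that have been left, \<open>v\<close> the number of leaves that have been
  started. If \<open>A\<close> holds then the subtree of \<open>t\<close> is complete and its vertices carry the label \<open>l\<close>.
  The label (plus one) of the completed part below another node \<open>p\<close> is \<open>ptr p\<close>.\<close>

definition inv :: "nat set \<Rightarrow> (nat \<times> nat) list \<Rightarrow> nat \<Rightarrow> bool \<Rightarrow> nat \<Rightarrow> nat \<Rightarrow> (nat \<Rightarrow> nat) \<Rightarrow> (nat \<Rightarrow> nat) \<Rightarrow> bool" where
  "inv X ms v A t l cnt ptr \<longleftrightarrow> X \<subseteq> {..<N} \<and> v \<le> n \<and>
     (\<forall>p<N. cnt p = card (children T p - X)) \<and>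
     (\<forall>s\<in>X. children T s \<subseteq> X) \<and>
     (\<forall>p<N. children T p \<subseteq> X \<longrightarrow> p \<notin> X \<longrightarrow> (A \<and> p = t) \<or> (\<exists>u. v \<le> u \<and> u < n \<and> p = \<delta> u)) \<and>
     (A \<longrightarrow> t < N \<and> t \<notin> X \<and> children T t \<subseteq> X \<and> fiber (comps ms) l = below t \<and>
        fiber (comps ms) l \<noteq> {} \<and> (\<forall>u. v \<le> u \<longrightarrow> u < n \<longrightarrow> \<delta> u \<noteq> t)) \<and>
     (\<forall>u. v \<le> u \<longrightarrow> u < n \<longrightarrow> fiber (comps ms) u = {u} \<and> \<delta> u \<notin> X) \<and>
     (\<forall>p<N. p \<notin> X \<longrightarrow> children T p \<inter> X = {} \<longrightarrow> ptr p = 0) \<and>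
     (\<forall>p<N. p \<notin> X \<longrightarrow> children T p \<inter> X \<noteq> {} \<longrightarrow> \<not> (A \<and> p = t) \<longrightarrow> ptr p \<noteq> 0 \<and>
        fiber (comps ms) (ptr p - 1) = \<Union>(below ` (children T p \<inter> X)) \<and> fiber (comps ms) (ptr p - 1) \<noteq> {}) \<and>
     (root T \<in> X \<longrightarrow> (\<exists>l. fiber (comps ms) l = {..<n})) \<and>
     valid_merges ms \<and> narrow ms"

lemma invD:
  "inv X ms v A t l cnt ptr \<Longrightarrow> X \<subseteq> {..<N}"
  "inv X ms v A t l cnt ptr \<Longrightarrow> v \<le> n"
  "inv X ms v A t l cnt ptr \<Longrightarrow> \<forall>p<N. cnt p = card (children T p - X)"
  "inv X ms v A t l cnt ptr \<Longrightarrow> \<forall>s\<in>X. children T s \<subseteq> X"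
  "inv X ms v A t l cnt ptr \<Longrightarrow> \<forall>p<N. children T p \<subseteq> X \<longrightarrow> p \<notin> X \<longrightarrow> (A \<and> p = t) \<or> (\<exists>u. v \<le> u \<and> u < n \<and> p = \<delta> u)"
  "inv X ms v A t l cnt ptr \<Longrightarrow> A \<longrightarrow> t < N \<and> t \<notin> X \<and> children T t \<subseteq> X \<and> fiber (comps ms) l = below t \<and>
        fiber (comps ms) l \<noteq> {} \<and> (\<forall>u. v \<le> u \<longrightarrow> u < n \<longrightarrow> \<delta> u \<noteq> t)"
  "inv X ms v A t l cnt ptr \<Longrightarrow> \<forall>u. v \<le> u \<longrightarrow> u < n \<longrightarrow> fiber (comps ms) u = {u} \<and> \<delta> u \<notin> X"
  "inv X ms v A t l cnt ptr \<Longrightarrow> \<forall>p<N. p \<notin> X \<longrightarrow> children T p \<inter> X = {} \<longrightarrow> ptr p = 0"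
  "inv X ms v A t l cnt ptr \<Longrightarrow> \<forall>p<N. p \<notin> X \<longrightarrow> children T p \<inter> X \<noteq> {} \<longrightarrow> \<not> (A \<and> p = t) \<longrightarrow> ptr p \<noteq> 0 \<and>
        fiber (comps ms) (ptr p - 1) = \<Union>(below ` (children T p \<inter> X)) \<and> fiber (comps ms) (ptr p - 1) \<noteq> {}"
  "inv X ms v A t l cnt ptr \<Longrightarrow> root T \<in> X \<longrightarrow> (\<exists>l. fiber (comps ms) l = {..<n})"
  "inv X ms v A t l cnt ptr \<Longrightarrow> valid_merges ms"
  "inv X ms v A t l cnt ptr \<Longrightarrow> narrow ms"
  unfolding inv_def by (elim conjE, assumption)+

lemma invI:
  assumes "X \<subseteq> {..<N}"
    "v \<le> n"
    "\<forall>p<N. cnt p = card (children T p - X)"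
    "\<forall>s\<in>X. children T s \<subseteq> X"
    "\<forall>p<N. children T p \<subseteq> X \<longrightarrow> p \<notin> X \<longrightarrow> (A \<and> p = t) \<or> (\<exists>u. v \<le> u \<and> u < n \<and> p = \<delta> u)"
    "A \<longrightarrow> t < N \<and> t \<notin> X \<and> children T t \<subseteq> X \<and> fiber (comps ms) l = below t \<and>
        fiber (comps ms) l \<noteq> {} \<and> (\<forall>u. v \<le> u \<longrightarrow> u < n \<longrightarrow> \<delta> u \<noteq> t)"
    "\<forall>u. v \<le> u \<longrightarrow> u < n \<longrightarrow> fiber (comps ms) u = {u} \<and> \<delta> u \<notin> X"
    "\<forall>p<N. p \<notin> X \<longrightarrow> children T p \<inter> X = {} \<longrightarrow> ptr p = 0"
    "\<forall>p<N. p \<notin> X \<longrightarrow> children T p \<inter> X \<noteq> {} \<longrightarrow> \<not> (A \<and> p = t) \<longrightarrow> ptr p \<noteq> 0 \<and>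
        fiber (comps ms) (ptr p - 1) = \<Union>(below ` (children T p \<inter> X)) \<and> fiber (comps ms) (ptr p - 1) \<noteq> {}"
    "root T \<in> X \<longrightarrow> (\<exists>l. fiber (comps ms) l = {..<n})"
    "valid_merges ms"
    "narrow ms"
  shows "inv X ms v A t l cnt ptr"
  unfolding inv_def by (intro conjI; fact)

lemma inv_init:
  assumes "\<And>p. p < N \<Longrightarrow> cnt p = card (children T p)" "\<And>p. p < N \<Longrightarrow> ptr p = 0"
  shows "inv {} [] 0 False t l cnt ptr"
proof -
  have fib: "fiber (comps []) u = {u}" if "u < n" for u using that by (auto simp: fiber_def)
  have "narrow []"
    using fib firsts_singleton by (simp add: narrow_def)
  moreover have "\<exists>u. 0 \<le> u \<and> u < n \<and> p = \<delta> u" if "p < N" "children T p \<subseteq> {}" for p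
    using leafE[of p] that by simp
  moreover have "valid_merges []" by (simp add: valid_merges_def)
  ultimately show ?thesis unfolding inv_def using assms fib by simp
qed

lemma inv_start:
  assumes I: "inv X ms v False t l cnt ptr" and v: "v < n"
  shows "inv X ms (Suc v) True (\<delta> v) v cnt ptr"
proof -
  note D = invD[OF I]
  have v': "fiber (comps ms) v = {v}" "\<delta> v \<notin> X" using D(7) v by simp_all
  have "(\<delta> v = p) \<or> (\<exists>u\<ge>Suc v. u < n \<and> p = \<delta> u)" if "\<exists>u\<ge>v. u < n \<and> p = \<delta> u" for p
    using that by (metis Suc_leI le_neq_implies_less)
  then have rdy: "\<forall>p<N. children T p \<subseteq> X \<longrightarrow> p \<notin> X \<longrightarrow> (True \<and> p = \<delta> v) \<or> (\<exists>u. Suc v \<le> u \<and> u < n \<and> p = \<delta> u)"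
    using D(5) by metis
  have "\<forall>u. Suc v \<le> u \<longrightarrow> u < n \<longrightarrow> \<delta> u \<noteq> \<delta> v" using leaf_inj[of _ v] v by fastforce
  then have act: "True \<longrightarrow> \<delta> v < N \<and> \<delta> v \<notin> X \<and> children T (\<delta> v) \<subseteq> X \<and> fiber (comps ms) v = below (\<delta> v) \<and>
      fiber (comps ms) v \<noteq> {} \<and> (\<forall>u. Suc v \<le> u \<longrightarrow> u < n \<longrightarrow> \<delta> u \<noteq> \<delta> v)"
    using v' leaf[OF v] below_leaf[OF v] by simp
  show ?thesis
    by (rule invI[OF D(1) _ D(3,4) rdy act _ D(8) _ D(10,11,12)]) (use v D(7,9) in auto)
qed

lemma inv_root:
  assumes I: "inv X ms v True t l cnt ptr" and t: "t = root T"
  shows "inv (insert t X) ms v False t' l' cnt ptr"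
proof -
  have ch: "t \<notin> children T p" for p using t by (simp add: children_iff)
  have int: "children T p \<inter> insert t X = children T p \<inter> X" "children T p - insert t X = children T p - X"
    "children T p \<subseteq> insert t X \<longleftrightarrow> children T p \<subseteq> X" for p
    using ch[of p] by auto
  note D = invD[OF I]
  have l: "fiber (comps ms) l = {..<n}" and tt: "t < N" "children T t \<subseteq> X" "\<forall>u. v \<le> u \<longrightarrow> u < n \<longrightarrow> \<delta> u \<noteq> t"
    using D(6) t below_root by simp_all
  show ?thesis
  proof (rule invI, unfold int)
    show "\<forall>s\<in>insert t X. children T s \<subseteq> X" using D(4) tt(2) by blast
    show "\<forall>p<N. children T p \<subseteq> X \<longrightarrow> p \<notin> insert t X \<longrightarrow> (False \<and> p = t') \<or> (\<exists>u. v \<le> u \<and> u < n \<and> p = \<delta> u)"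
      using D(5) by blast
    show "\<forall>u. v \<le> u \<longrightarrow> u < n \<longrightarrow> fiber (comps ms) u = {u} \<and> \<delta> u \<notin> insert t X"
      using D(7) tt(3) by blast
    show "\<forall>p<N. p \<notin> insert t X \<longrightarrow> children T p \<inter> X \<noteq> {} \<longrightarrow> \<not> (False \<and> p = t') \<longrightarrow> ptr p \<noteq> 0 \<and>
        fiber (comps ms) (ptr p - 1) = \<Union>(below ` (children T p \<inter> X)) \<and> fiber (comps ms) (ptr p - 1) \<noteq> {}"
      using D(9) by blast
    show "insert t X \<subseteq> {..<N}" using D(1) tt(1) by blast
    show "\<forall>p<N. p \<notin> insert t X \<longrightarrow> children T p \<inter> X = {} \<longrightarrow> ptr p = 0" using D(8) by blast
    show "root T \<in> insert t X \<longrightarrow> (\<exists>l. fiber (comps ms) l = {..<n})" using l by blast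
  qed (rule D(2) D(3) D(11) D(12) | simp)+
qed

lemma inv_climb:
  assumes I: "inv X ms v True t l cnt ptr" and t: "t \<noteq> root T"
  defines "p \<equiv> parent T t"
  defines "ms' \<equiv> (if ptr p = 0 then ms else ms @ [(ptr p - 1, l)])"
    and "ptr' \<equiv> (if ptr p = 0 then ptr(p := Suc l) else ptr)"
    and "cnt' \<equiv> cnt(p := cnt p - 1)"
  shows "cnt' p \<noteq> 0 \<Longrightarrow> inv (insert t X) ms' v False t' l' cnt' ptr'"
    and "cnt' p = 0 \<Longrightarrow> inv (insert t X) ms' v True p (ptr' p - 1) cnt' ptr'"
proof -
  let ?X = "insert t X"
  note D = invD[OF I]
  note X = D(1-4) and fresh = D(7) and p0 = D(8) and ms = D(11,12)
  have tt: "t < N" "t \<notin> X" "children T t \<subseteq> X" "fiber (comps ms) l = below t" "fiber (comps ms) l \<noteq> {}"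
      "\<forall>u. v \<le> u \<longrightarrow> u < n \<longrightarrow> \<delta> u \<noteq> t"
    using D(6) by blast+
  have rdy: "\<forall>p<N. children T p \<subseteq> X \<longrightarrow> p \<notin> X \<longrightarrow> p = t \<or> (\<exists>u. v \<le> u \<and> u < n \<and> p = \<delta> u)"
    using D(5) by blast
  have p1: "\<forall>p<N. p \<notin> X \<longrightarrow> children T p \<inter> X \<noteq> {} \<longrightarrow> p \<noteq> t \<longrightarrow> ptr p \<noteq> 0 \<and>
        fiber (comps ms) (ptr p - 1) = \<Union>(below ` (children T p \<inter> X)) \<and> fiber (comps ms) (ptr p - 1) \<noteq> {}"
    using D(9) by blast
  have tp: "t \<in> children T p" using t tt(1) by (simp add: children_iff p_def)
  have pN: "p < N" using tt(1) parent_node by (simp add: p_def)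
  have pX: "p \<notin> X" using X(4) tp tt(2) by blast
  have pt: "p \<noteq> t" using tp tt(2,3) by blast
  have rX: "root T \<notin> X"
  proof
    assume "root T \<in> X"
    then have "t \<in> X" using subtree_closed[OF X(4)] tt(1) reaches_root by (auto simp: subtree_iff)
    then show False using tt(2) by simp
  qed
  have uniq: "t \<in> children T q \<longleftrightarrow> q = p" for q using tp by (auto simp: children_iff)
  have Xcl: "\<forall>s\<in>?X. children T s \<subseteq> ?X" using X(4) tt(3) by blast
  have int_p: "children T p \<inter> ?X = insert t (children T p \<inter> X)" using tp by auto
  have int: "children T q \<inter> ?X = children T q \<inter> X" "children T q - ?X = children T q - X"
    "children T q \<subseteq> ?X \<longleftrightarrow> children T q \<subseteq> X" if "q \<noteq> p" for q
    using uniq[of q] that by auto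
  have disj: "\<Union>(below ` (children T q \<inter> ?X)) \<inter> \<Union>(below ` (children T q' \<inter> ?X)) = {}"
    if "q \<notin> ?X" "q' \<notin> ?X" "q \<noteq> q'" for q q'
  proof -
    have "below s \<inter> below s' = {}" if "s \<in> children T q \<inter> ?X" "s' \<in> children T q' \<inter> ?X" for s s'
      using that \<open>q \<notin> ?X\<close> \<open>q' \<notin> ?X\<close> \<open>q \<noteq> q'\<close>
      by (intro tops_disjoint[OF Xcl]) (auto simp: children_iff)
    then show ?thesis by blast
  qed
  have disj_t: "below t \<inter> \<Union>(below ` (children T p \<inter> X)) = {}"
  proof -
    have "below t \<inter> below s = {}" if "s \<in> children T p \<inter> X" for s
      using that pX pt tt(2) p_def
      by (intro tops_disjoint[OF Xcl]) (auto simp: children_iff)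
    then show ?thesis by blast
  qed
  have fresh_below: "u \<notin> below s" if "v \<le> u" "u < n" "s \<in> ?X" for u s
  proof
    assume "u \<in> below s"
    then have "\<delta> u \<in> ?X" using subtree_closed[OF Xcl that(3)] by (simp add: below_iff)
    then show False using fresh tt(6) that by auto
  qed
  have main: "ptr' p \<noteq> 0 \<and> fiber (comps ms') (ptr' p - 1) = \<Union>(below ` (children T p \<inter> ?X)) \<and>
      fiber (comps ms') (ptr' p - 1) \<noteq> {} \<and> valid_merges ms' \<and> narrow ms' \<and>
      (\<forall>l'. fiber (comps ms) l' \<noteq> {} \<longrightarrow> fiber (comps ms) l' \<inter> \<Union>(below ` (children T p \<inter> ?X)) = {} \<longrightarrow>
        fiber (comps ms') l' = fiber (comps ms) l')"
  proof (cases "ptr p = 0")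
    case True
    then have "children T p \<inter> X = {}" using p1 pN pX pt by blast
    then show ?thesis using True tt(4,5) ms int_p by (simp add: ms'_def ptr'_def)
  next
    case False
    let ?a = "ptr p - 1"
    have "children T p \<inter> X \<noteq> {}" using p0[rule_format, OF pN pX] False by blast
    then have a: "fiber (comps ms) ?a = \<Union>(below ` (children T p \<inter> X))" "fiber (comps ms) ?a \<noteq> {}"
      using p1[rule_format, OF pN pX _ pt] by blast+
    have al: "?a \<noteq> l" using disj_t a tt(4) by auto
    have un: "fiber (comps ms) ?a \<union> fiber (comps ms) l = \<Union>(below ` (children T p \<inter> ?X))"
      unfolding int_p a(1) tt(4) by auto
    have "card (firsts (fiber (comps ms) ?a \<union> fiber (comps ms) l)) \<le> 3 * w"
      unfolding un by (rule card_firsts_children[OF pN]) auto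
    then have "narrow ms'" "valid_merges ms'"
      using False narrow_snoc[OF ms(2) al] valid_merges_snoc[OF ms(1) al a(2) tt(5)] by (simp_all add: ms'_def)
    moreover have fs: "fiber (comps ms') l' = (if l' = ?a then \<Union>(below ` (children T p \<inter> ?X)) else
        if l' = l then {} else fiber (comps ms) l')" for l'
      using False fiber_snoc[OF al, of ms l'] un by (simp add: ms'_def)
    moreover have "\<Union>(below ` (children T p \<inter> ?X)) \<noteq> {}" using a(2) un by blast
    moreover have "fiber (comps ms') l' = fiber (comps ms) l'"
      if "fiber (comps ms) l' \<noteq> {}" "fiber (comps ms) l' \<inter> \<Union>(below ` (children T p \<inter> ?X)) = {}" for l'
    proof -
      have "fiber (comps ms) ?a \<subseteq> \<Union>(below ` (children T p \<inter> ?X))" "fiber (comps ms) l \<subseteq> \<Union>(below ` (children T p \<inter> ?X))"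
        using un by blast+
      then have "l' \<noteq> ?a" "l' \<noteq> l" using that by blast+
      then show ?thesis by (simp add: fs)
    qed
    ultimately show ?thesis using False by (simp add: ptr'_def)
  qed
  have XN: "?X \<subseteq> {..<N}" using X(1) tt(1) by simp
  have cnt: "\<forall>q<N. cnt' q = card (children T q - ?X)"
  proof (intro allI impI)
    fix q assume q: "q < N"
    show "cnt' q = card (children T q - ?X)"
    proof (cases "q = p")
      case True
      have "children T p - ?X = (children T p - X) - {t}" by auto
      then show ?thesis using True X(3) pN tp tt(2) by (simp add: cnt'_def)
    next
      case False
      then show ?thesis using X(3) q int(2)[OF False] by (simp add: cnt'_def)
    qed
  qed
  have fresh': "\<forall>u. v \<le> u \<longrightarrow> u < n \<longrightarrow> fiber (comps ms') u = {u} \<and> \<delta> u \<notin> ?X"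
  proof (intro allI impI conjI)
    fix u assume u: "v \<le> u" "u < n"
    then have "fiber (comps ms) u \<inter> \<Union>(below ` (children T p \<inter> ?X)) = {}"
      using fresh fresh_below by auto
    then show "fiber (comps ms') u = {u}" using main fresh u by simp
    show "\<delta> u \<notin> ?X" using fresh tt(6) u by auto
  qed
  have p0': "\<forall>q<N. q \<notin> ?X \<longrightarrow> children T q \<inter> ?X = {} \<longrightarrow> ptr' q = 0"
  proof (intro allI impI)
    fix q assume q: "q < N" "q \<notin> ?X" "children T q \<inter> ?X = {}"
    then have "q \<noteq> p" using int_p by auto
    then show "ptr' q = 0" using p0 q int(1) by (simp add: ptr'_def)
  qed
  have p1': "ptr' q \<noteq> 0 \<and> fiber (comps ms') (ptr' q - 1) = \<Union>(below ` (children T q \<inter> ?X)) \<and>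
      fiber (comps ms') (ptr' q - 1) \<noteq> {}" if q: "q < N" "q \<notin> ?X" "children T q \<inter> ?X \<noteq> {}" for q
  proof (cases "q = p")
    case True
    show ?thesis unfolding True using main by blast
  next
    case False
    have old: "ptr q \<noteq> 0" "fiber (comps ms) (ptr q - 1) = \<Union>(below ` (children T q \<inter> ?X))"
      "fiber (comps ms) (ptr q - 1) \<noteq> {}"
      using p1 q int(1)[OF False] by auto
    have "p \<notin> ?X" using pX pt by simp
    then have "fiber (comps ms) (ptr q - 1) \<inter> \<Union>(below ` (children T p \<inter> ?X)) = {}"
      unfolding old(2) using disj[OF q(2) _ False] by blast
    then have "fiber (comps ms') (ptr q - 1) = fiber (comps ms) (ptr q - 1)" using main old(3) by blast
    then show ?thesis using old False by (simp add: ptr'_def)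
  qed
  have rt': "root T \<in> ?X \<longrightarrow> (\<exists>l. fiber (comps ms') l = {..<n})" using rX t by auto
  have rdy': "q = p \<or> (\<exists>u. v \<le> u \<and> u < n \<and> q = \<delta> u)" if "q < N" "children T q \<subseteq> ?X" "q \<notin> ?X" for q
    using rdy that int(3)[of q] by auto
  have p1A: "\<forall>q<N. q \<notin> ?X \<longrightarrow> children T q \<inter> ?X \<noteq> {} \<longrightarrow> \<not> (A \<and> q = x) \<longrightarrow> ptr' q \<noteq> 0 \<and>
      fiber (comps ms') (ptr' q - 1) = \<Union>(below ` (children T q \<inter> ?X)) \<and> fiber (comps ms') (ptr' q - 1) \<noteq> {}" for A x
    by (intro allI impI, rule p1')
  have p': "fiber (comps ms') (ptr' p - 1) = \<Union>(below ` (children T p \<inter> ?X))" "fiber (comps ms') (ptr' p - 1) \<noteq> {}"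
    "valid_merges ms'" "narrow ms'"
    by (rule main[THEN conjunct2, THEN conjunct1] main[THEN conjunct2, THEN conjunct2, THEN conjunct1]
        main[THEN conjunct2, THEN conjunct2, THEN conjunct2, THEN conjunct1]
        main[THEN conjunct2, THEN conjunct2, THEN conjunct2, THEN conjunct2, THEN conjunct1])+
  show "inv ?X ms' v False t' l' cnt' ptr'" if c: "cnt' p \<noteq> 0"
  proof (rule invI[OF XN X(2) cnt Xcl _ _ fresh' p0' p1A rt' p'(3,4)])
    have "\<not> children T p \<subseteq> ?X" using c cnt pN by (metis Diff_eq_empty_iff card.empty)
    then show "\<forall>q<N. children T q \<subseteq> ?X \<longrightarrow> q \<notin> ?X \<longrightarrow> (False \<and> q = t') \<or> (\<exists>u. v \<le> u \<and> u < n \<and> q = \<delta> u)"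
      using rdy' by blast
  qed simp
  show "inv ?X ms' v True p (ptr' p - 1) cnt' ptr'" if c: "cnt' p = 0"
  proof (rule invI[OF XN X(2) cnt Xcl _ _ fresh' p0' p1A rt' p'(3,4)])
    have ch: "children T p \<subseteq> ?X" using c cnt pN by (simp add: card_eq_0_iff)
    then have "children T p \<inter> ?X = children T p" by (rule Int_absorb2)
    moreover have "children T p \<noteq> {}" using tp by blast
    ultimately have "\<Union>(below ` (children T p \<inter> ?X)) = below p"
      using below_children[OF pN] by simp
    moreover have "\<forall>u. v \<le> u \<longrightarrow> u < n \<longrightarrow> \<delta> u \<noteq> p" using leaf tp by blast
    moreover have "p \<notin> ?X" using pX pt by simp
    ultimately show "True \<longrightarrow> p < N \<and> p \<notin> ?X \<and> children T p \<subseteq> ?X \<and> fiber (comps ms') (ptr' p - 1) = below p \<and>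
        fiber (comps ms') (ptr' p - 1) \<noteq> {} \<and> (\<forall>u. v \<le> u \<longrightarrow> u < n \<longrightarrow> \<delta> u \<noteq> p)"
      using p'(1,2) pN ch by (intro impI conjI) simp_all
    show "\<forall>q<N. children T q \<subseteq> ?X \<longrightarrow> q \<notin> ?X \<longrightarrow> (True \<and> q = p) \<or> (\<exists>u. v \<le> u \<and> u < n \<and> q = \<delta> u)"
      using rdy' by blast
  qed
qed

lemma inv_final:
  assumes I: "inv X ms n False t l cnt ptr"
  shows "u < n \<Longrightarrow> comps ms u = comps ms 0" "valid_merges ms" "narrow ms"
proof -
  have "X = {..<N}" using I by (intro all_nodes) (auto simp: inv_def)
  then have "root T \<in> X" using root_node by simp
  then obtain l where "fiber (comps ms) l = {..<n}" using I by (auto simp: inv_def)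
  then have "comps ms u = l" if "u < n" for u using that by (auto simp: fiber_def)
  then show "comps ms u = comps ms 0" if "u < n" using that by simp
  show "valid_merges ms" "narrow ms" using I by (auto simp: inv_def)
qed

definition has_tree :: "(reg \<Rightarrow> nat) \<Rightarrow> arrays \<Rightarrow> bool" where
  "has_tree r h \<longleftrightarrow> r ''n'' = n \<and> r ''N'' = N \<and> r ''root'' = root T \<and> r ''nn'' = n * n \<and>
     (\<forall>t<N. h 16 (n * n + t) = parent T t) \<and> (\<forall>v<n. h 16 (n * n + (N + v)) = \<delta> v)"

lemma has_tree_upd [simp]:
  "x \<notin> {''n'', ''N'', ''root'', ''nn''} \<Longrightarrow> has_tree (r(x := a)) h \<longleftrightarrow> has_tree r h"
  "j \<noteq> 16 \<Longrightarrow> has_tree r (h(j := f)) \<longleftrightarrow> has_tree r h"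
  by (auto simp: has_tree_def)

lemma run_count_children:
  assumes R: "has_tree r h" and h0: "\<And>p. h 0 p = 0"
  obtains f where "run count_children (r, h) = (r, h(0 := f))" "\<And>p. f p = card (children T p)"
proof -
  let ?s = "IfS (EEq (V ''x'') (V ''root'')) Skip (Sto 0 (parent_of ''x'') (Plus (Rd 0 (parent_of ''x'')) (C 1)))"
  have r: "r ''N'' = N" "r ''root'' = root T" "r ''nn'' = n * n" and par: "\<And>t. t < N \<Longrightarrow> h 16 (n * n + t) = parent T t"
    using R by (auto simp: has_tree_def)
  define P where "P i r1 h1 \<longleftrightarrow> (\<forall>v. r1(''x'' := v) = r(''x'' := v)) \<and>
      (\<exists>f. h1 = h(0 := f) \<and> (\<forall>p. f p = card {s \<in> children T p. s < i}))" for i and r1 :: "reg \<Rightarrow> nat" and h1 :: arrays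
  have P0: "P 0 r h" unfolding P_def using h0 by (intro conjI exI[of _ "h 0"]) auto
  have PS: "P (Suc i) (fst (run ?s (r1(''x'' := i), h1))) (snd (run ?s (r1(''x'' := i), h1)))"
    if i: "i < N" and Pi: "P i r1 h1" for i r1 h1
  proof -
    from Pi obtain f where r1: "\<And>v. r1(''x'' := v) = r(''x'' := v)" and f: "h1 = h(0 := f)"
      "\<And>p. f p = card {s \<in> children T p. s < i}" unfolding P_def by blast
    define f' where "f' = (if i = root T then f else f(parent T i := f (parent T i) + 1))"
    have run: "run ?s (r1(''x'' := i), h1) = (r(''x'' := i), h(0 := f'))"
      unfolding r1 f(1) using r par[OF i] by (simp add: parent_of_def f'_def)
    have "f' p = card {s \<in> children T p. s < Suc i}" for p
    proof (cases "i \<in> children T p")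
      case True
      then have "{s \<in> children T p. s < Suc i} = insert i {s \<in> children T p. s < i}" by auto
      then show ?thesis using True f(2) by (simp add: f'_def children_iff)
    next
      case False
      then have "{s \<in> children T p. s < Suc i} = {s \<in> children T p. s < i}" by (auto simp: less_Suc_eq)
      then show ?thesis using False f(2) i by (auto simp: f'_def children_iff)
    qed
    then show ?thesis unfolding P_def run fst_conv snd_conv by (intro conjI exI[of _ f']) auto
  qed
  obtain r1 h1 where P: "P N r1 h1" and run: "run (For ''x'' (V ''N'') ?s) (r, h) = (r1(''x'' := r ''x''), h1)"
    using run_For_invariant[where P = P and x = "''x''" and s = ?s and b = "V ''N''" and m = N, OF _ P0 PS] r by auto
  from P obtain f where f: "\<And>v. r1(''x'' := v) = r(''x'' := v)" "h1 = h(0 := f)"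
    "\<And>p. f p = card {s \<in> children T p. s < N}" unfolding P_def by blast
  have "{s \<in> children T p. s < N} = children T p" for p by (auto simp: children_iff)
  then show thesis using that[of f] run f by (simp add: count_children_def)
qed

definition progress :: "nat \<Rightarrow> (reg \<Rightarrow> nat) \<Rightarrow> arrays \<Rightarrow> bool" where
  "progress i r h \<longleftrightarrow> has_tree r h \<and> (\<exists>X ms. inv X ms (r ''v'') (r ''act'' \<noteq> 0) (r ''t'') (r ''lab'') (h 0) (h 1) \<and>
     has_merges ms r h \<and> (i = card X + r ''v'' \<or> (r ''act'' = 0 \<and> r ''v'' = n)))"

lemma run_climb:
  assumes P: "progress i r h"
  shows "progress (Suc i) (fst (run climb (r, h))) (snd (run climb (r, h)))"
    "fst (run climb (r, h)) ''k'' = r ''k''" "snd (run climb (r, h)) 16 = h 16"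
proof -
  from P obtain X ms where R: "has_tree r h"
    and I: "inv X ms (r ''v'') (r ''act'' \<noteq> 0) (r ''t'') (r ''lab'') (h 0) (h 1)"
    and ms: "has_merges ms r h" and i: "i = card X + r ''v'' \<or> (r ''act'' = 0 \<and> r ''v'' = n)"
    unfolding progress_def by blast
  have r: "r ''n'' = n" "r ''N'' = N" "r ''root'' = root T" "r ''nn'' = n * n"
    and par: "\<And>t. t < N \<Longrightarrow> h 16 (n * n + t) = parent T t"
    and leafs: "\<And>v. v < n \<Longrightarrow> h 16 (n * n + (N + v)) = \<delta> v"
    using R by (auto simp: has_tree_def)
  have X: "finite X" using invD(1)[OF I] finite_subset by blast
  show "progress (Suc i) (fst (run climb (r, h))) (snd (run climb (r, h)))"
  proof (cases "r ''act'' = 0")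
    case inactive: True
    show ?thesis
    proof (cases "r ''v'' < n")
      case True
      have "inv X ms (Suc (r ''v'')) True (\<delta> (r ''v'')) (r ''v'') (h 0) (h 1)"
        using I inactive True by (intro inv_start[where t = "r ''t''" and l = "r ''lab''"]) simp_all
      then show ?thesis
        using inactive True r leafs R ms i unfolding progress_def
        by (auto simp: climb_def intro!: exI[of _ X] exI[of _ ms])
    next
      case False
      then have "r ''v'' = n" using invD(2)[OF I] by simp
      then show ?thesis using inactive r R ms I unfolding progress_def
        by (auto simp: climb_def intro!: exI[of _ X] exI[of _ ms])
    qed
  next
    case active: False
    then have I': "inv X ms (r ''v'') True (r ''t'') (r ''lab'') (h 0) (h 1)" using I by simp
    have t: "r ''t'' < N" "r ''t'' \<notin> X" using invD(6)[OF I'] by blast+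
    have i': "Suc i = card (insert (r ''t'') X) + r ''v''" using i active t X by simp
    show ?thesis
    proof (cases "r ''t'' = root T")
      case True
      from inv_root[OF I' True] show ?thesis
        using active True r R ms i' unfolding progress_def
        by (auto simp: climb_def intro!: exI[of _ "insert (r ''t'') X"] exI[of _ ms])
    next
      case nonroot: False
      define p where "p = parent T (r ''t'')"
      define ms' where "ms' = (if h 1 p = 0 then ms else ms @ [(h 1 p - 1, r ''lab'')])"
      define ptr' where "ptr' = (if h 1 p = 0 then (h 1)(p := Suc (r ''lab'')) else h 1)"
      define cnt' where "cnt' = (h 0)(p := h 0 p - 1)"
      note step = inv_climb[OF I' nonroot, folded p_def, folded ms'_def ptr'_def cnt'_def]
      define r1 where "r1 = (if h 1 p = 0 then r(''p'' := p) else r(''p'' := p, ''m'' := Suc (r ''m'')))"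
      define h1 where "h1 = (if h 1 p = 0 then h(1 := ptr', 0 := cnt')
        else h(2 := (h 2)(r ''m'' := h 1 p - 1), 3 := (h 3)(r ''m'' := r ''lab''), 0 := cnt'))"
      have h1: "h1 0 = cnt'" "h1 1 = ptr'" "has_tree r1 h1" "has_merges ms' r1 h1" "r1 ''v'' = r ''v''"
        using R ms by (auto simp: h1_def r1_def ptr'_def ms'_def has_merges_def nth_append less_Suc_eq)
      have run: "run climb (r, h) = (if cnt' p = 0 then r1(''t'' := p, ''lab'' := ptr' p - 1) else r1(''act'' := 0), h1)"
        using active nonroot r par[OF t(1)]
        by (auto simp: climb_def parent_of_def p_def[symmetric] r1_def h1_def cnt'_def ptr'_def)
      show ?thesis
      proof (cases "cnt' p = 0")
        case True
        have "r1 ''act'' \<noteq> 0" using active by (simp add: r1_def)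
        then show ?thesis using step(2)[OF True] h1 i' True unfolding progress_def run
          by (auto intro!: exI[of _ "insert (r ''t'') X"] exI[of _ ms'])
      next
        case False
        then show ?thesis using step(1)[OF False] h1 i' unfolding progress_def run
          by (auto intro!: exI[of _ "insert (r ''t'') X"] exI[of _ ms'])
      qed
    qed
  qed
  show "fst (run climb (r, h)) ''k'' = r ''k''" "snd (run climb (r, h)) 16 = h 16"
    by (simp_all add: climb_def)
qed

lemma run_list_merges:
  assumes R: "has_tree r h" "r ''NN'' = N + n" and z: "r ''v'' = 0" "r ''act'' = 0" "r ''m'' = 0"
    "\<And>p. h 0 p = 0" "\<And>p. h 1 p = 0"
  obtains ms r1 h1 where "run list_merges (r, h) = (r1, h1)" "has_merges ms r1 h1" "valid_merges ms" "narrow ms"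
    "\<And>u. u < n \<Longrightarrow> comps ms u = comps ms 0" "r1 ''n'' = n" "r1 ''k'' = r ''k''" "h1 16 = h 16"
proof -
  obtain f where f: "run count_children (r, h) = (r, h(0 := f))" "\<And>p. f p = card (children T p)"
    using run_count_children[OF R(1) z(4)] by blast
  define P where "P i r1 h1 \<longleftrightarrow> progress i r1 h1 \<and> r1 ''k'' = r ''k'' \<and> h1 16 = h 16" for i and r1 :: "reg \<Rightarrow> nat" and h1 :: arrays
  have "inv {} [] 0 False (r ''t'') (r ''lab'') f (h 1)"
    using f(2) z(5) by (intro inv_init) auto
  then have P0: "P 0 r (h(0 := f))"
    unfolding P_def progress_def using R(1) z
    by (auto simp: has_merges_def intro!: exI[of _ "{}"] exI[of _ "[]"])
  have PS: "P (Suc i) (fst (run climb (r1(''x'' := i), h1))) (snd (run climb (r1(''x'' := i), h1)))"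
    if "P i r1 h1" for i r1 h1
  proof -
    have "progress i (r1(''x'' := i)) h1"
      using that by (simp add: P_def progress_def)
    from run_climb[OF this] that show ?thesis by (simp add: P_def)
  qed
  obtain r1 h1 where Pm: "P (N + n) r1 h1"
    and run: "run (For ''x'' (V ''NN'') climb) (r, h(0 := f)) = (r1(''x'' := r ''x''), h1)"
    using run_For_invariant[where P = P and x = "''x''" and s = climb and b = "V ''NN''" and m = "N + n", OF _ P0 PS] R(2) by auto
  from Pm obtain X ms where I: "inv X ms (r1 ''v'') (r1 ''act'' \<noteq> 0) (r1 ''t'') (r1 ''lab'') (h1 0) (h1 1)"
    and ms: "has_merges ms r1 h1" and i: "N + n = card X + r1 ''v'' \<or> (r1 ''act'' = 0 \<and> r1 ''v'' = n)"
    and keep: "r1 ''k'' = r ''k''" "h1 16 = h 16" "r1 ''n'' = n"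
    unfolding P_def progress_def has_tree_def by blast
  have "r1 ''act'' = 0 \<and> r1 ''v'' = n"
  proof (rule ccontr)
    assume *: "\<not> ?thesis"
    have X: "X \<subseteq> {..<N}" "r1 ''v'' \<le> n" using invD(1,2)[OF I] .
    have "card X \<le> N" using card_mono[OF _ X(1)] by simp
    then have "card X = N" "r1 ''v'' = n" using * i X(2) by auto
    then have "X = {..<N}" using X(1) by (intro card_subset_eq) auto
    then have "r1 ''act'' = 0" using invD(6)[OF I] by auto
    then show False using * \<open>r1 ''v'' = n\<close> by simp
  qed
  then have "inv X ms n False (r1 ''t'') (r1 ''lab'') (h1 0) (h1 1)" using I by simp
  note fin = inv_final[OF this]
  show thesis
  proof (rule that[of "r1(''x'' := r ''x'')" h1 ms])
    show "run list_merges (r, h) = (r1(''x'' := r ''x''), h1)" using run f(1) by (simp add: list_merges_def)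
    show "has_merges ms (r1(''x'' := r ''x'')) h1" using ms by simp
  qed (use keep in \<open>simp_all add: fin(2,3)\<close>, rule fin(1))
qed

lemma narrow_width_ok:
  assumes "narrow ms"
  shows "width_ok ms (length ms) (3 * w + 1)"
  unfolding width_ok_def
proof (intro allI impI)
  fix i u assume i: "i \<le> length ms" and u: "u < n"
  let ?S = "fiber (comps (take i ms)) (comps (take i ms) u)"
  have "cls ?S u < card (firsts ?S)" using u by (intro cls_less) (auto simp: fiber_def)
  also have "\<dots> \<le> 3 * w + 1" using assms i u unfolding narrow_def by blast
  finally show "cls ?S u < 3 * w + 1" .
qed

lemma fall_coloring_iff:
  assumes "0 < n"
  shows "has_fall_coloring G k \<longleftrightarrow> 0 < k \<and> k \<le> n \<and> (\<exists>f. dominating_coloring k f)"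
proof
  assume "has_fall_coloring G k"
  then obtain C where C: "fall_coloring G k C" by (auto simp: has_fall_coloring_def)
  have un: "(\<Union>i\<in>{1..k}. C i) = {..<n}" and dis: "disjoint_family_on C {1..k}" and ne: "\<forall>i\<in>{1..k}. C i \<noteq> {}"
    and ind: "\<forall>i\<in>{1..k}. independent G (C i)"
    and dom: "\<forall>i\<in>{1..k}. \<forall>v\<in>C i. \<forall>j\<in>{1..k} - {i}. nbhd G v \<inter> C j \<noteq> {}"
    using C verts by (simp_all add: fall_coloring_def)
  have k: "0 < k" using un assms by (cases k) auto
  have fin: "finite (C i)" if "i \<in> {1..k}" for i
  proof (rule finite_subset)
    show "C i \<subseteq> {..<n}" using un that by blast
  qed simp
  have "k = (\<Sum>i\<in>{1..k}. 1)" by simp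
  also have "\<dots> \<le> (\<Sum>i\<in>{1..k}. card (C i))"
    using ne fin by (intro sum_mono) (simp add: Suc_le_eq card_gt_0_iff)
  also have "\<dots> = card (\<Union>i\<in>{1..k}. C i)"
    using dis fin by (intro card_UN_disjoint[symmetric]) (auto simp: disjoint_family_on_def)
  finally have kn: "k \<le> n" using un by simp
  define f where "f u = (THE i. i < k \<and> u \<in> C (Suc i))" for u
  have f: "f u < k \<and> u \<in> C (Suc (f u))" if "u < n" for u
  proof -
    from that un obtain i where i: "i \<in> {1..k}" "u \<in> C i" by blast
    then obtain j where j: "i = Suc j" "j < k" by (cases i) auto
    have uniq: "j' = j" if "j' < k \<and> u \<in> C (Suc j')" for j'
    proof (rule ccontr)
      assume "j' \<noteq> j"
      then have "C (Suc j') \<inter> C (Suc j) = {}"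
        using dis that j by (intro disjoint_family_onD[OF dis]) auto
      then show False using that i j by auto
    qed
    have "f u = j"
      unfolding f_def by (rule the_equality) (use i(2) j in simp, rule uniq)
    then show ?thesis using i(2) j by simp
  qed
  have f_eq: "f u = i" if "u < n" "i < k" "u \<in> C (Suc i)" for u i
  proof (rule ccontr)
    assume "f u \<noteq> i"
    then have "C (Suc (f u)) \<inter> C (Suc i) = {}"
      using f[OF that(1)] that by (intro disjoint_family_onD[OF dis]) auto
    then show False using f[OF that(1)] that by auto
  qed
  have "dominating_coloring k f"
    unfolding dominating_coloring_def proper_def
  proof (intro conjI ballI allI impI)
    show "f u < k" if "u \<in> {..<n}" for u using f that by simp
    show "f u \<noteq> f v" if uv: "u \<in> {..<n}" "v \<in> {..<n}" "E u v" for u v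
    proof
      assume eq: "f u = f v"
      have "Suc (f u) \<in> {1..k}" using f[of u] uv by simp
      then have "independent G (C (Suc (f u)))" using ind by blast
      moreover have "u \<in> C (Suc (f u))" "v \<in> C (Suc (f u))" using f[of u] f[of v] uv eq by simp_all
      ultimately show False using uv(3) by (simp add: independent_def E_def)
    qed
    show "\<exists>v<n. E u v \<and> f v = i" if "u < n" "i < k" "i \<noteq> f u" for u i
    proof -
      have "Suc (f u) \<in> {1..k}" "u \<in> C (Suc (f u))" "Suc i \<in> {1..k} - {Suc (f u)}" using f[of u] that by simp_all
      then have "nbhd G u \<inter> C (Suc i) \<noteq> {}" using dom by blast
      then obtain v where "v < n" "E u v" "v \<in> C (Suc i)" by (auto simp: nbhd_def verts E_def)
      then show ?thesis using f_eq that by blast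
    qed
  qed
  then show "0 < k \<and> k \<le> n \<and> (\<exists>f. dominating_coloring k f)" using k kn by blast
next
  assume "0 < k \<and> k \<le> n \<and> (\<exists>f. dominating_coloring k f)"
  then obtain f where k: "0 < k" and f: "dominating_coloring k f" by blast
  have lt: "f u < k" if "u < n" for u using f that by (simp add: dominating_coloring_def proper_def)
  have pr: "\<not> E u v" if "u < n" "v < n" "f u = f v" for u v
    using f that by (auto simp: dominating_coloring_def proper_def)
  have dom: "\<exists>v<n. E u v \<and> f v = i" if "u < n" "i < k" "i \<noteq> f u" for u i
    using f that by (simp add: dominating_coloring_def)
  define C where "C i = {u. u < n \<and> Suc (f u) = i}" for i
  have "fall_coloring G k C"
    unfolding fall_coloring_def
  proof (intro conjI ballI)
    show "(\<Union>i\<in>{1..k}. C i) = verts G" using lt by (force simp: C_def verts)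
    show "disjoint_family_on C {1..k}" by (auto simp: disjoint_family_on_def C_def)
    show "C i \<noteq> {}" if i: "i \<in> {1..k}" for i
    proof -
      obtain j where j: "i = Suc j" "j < k" using i by (cases i) auto
      show ?thesis using dom[OF assms j(2)] assms j by (cases "j = f 0") (auto simp: C_def)
    qed
    show "independent G (C i)" for i
      using pr by (auto simp: independent_def C_def verts E_def)
    show "nbhd G v \<inter> C j \<noteq> {}" if "i \<in> {1..k}" and v: "v \<in> C i" and ij: "j \<in> {1..k} - {i}" for i v j
    proof -
      obtain j' where j: "j = Suc j'" "j' < k" using ij by (cases j) auto
      have "v < n" "j' \<noteq> f v" using v ij j by (auto simp: C_def)
      from dom[OF this(1) j(2) this(2)] show ?thesis by (auto simp: C_def j nbhd_def verts E_def)
    qed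
  qed
  then show "has_fall_coloring G k" by (auto simp: has_fall_coloring_def)
qed

end


section \<open>Running time\<close>

lemmas program_defs = prepare_def count_children_def climb_def list_merges_def find_width_def update_def commit_def
  init_def cls_exp_def first_exp_def twin_exp_def same_def adj_def parent_of_def powers1_def powers2_def
  powers3_def powers4_def fill_bits_def bit_recurrence_def init_tables_def bit_exp_def hit_exp_def
  compatible_exp_def still_undom_exp_def merge_exp_def weight_exp_def fill_weights_def weight_at_def
  reachable_exp_def fill_reachable_def joined_exp_def join_tables_def merge_step_def answer_def dynamic_program_def

lemma wfs_program:
  "wfs prepare" "wfs list_merges" "wfs find_width" "wfs powers1" "wfs powers2" "wfs powers3" "wfs powers4"
  "wfs dynamic_program"
  by (simp_all add: program_defs derived_defs usr_def)

lemma sbounded_program: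
  "sbounded {''n''} prepare"
  "sbounded {''N'', ''NN''} list_merges"
  "sbounded {''n'', ''m''} find_width"
  "sbounded {} powers1"
  "sbounded {''W2''} powers2"
  "sbounded {''D'', ''b''} powers3"
  "sbounded {''M''} powers4"
  "sbounded {''n'', ''m'', ''k'', ''W2'', ''D'', ''b'', ''M'', ''L''} dynamic_program"
  by (simp_all add: program_defs derived_defs is_bound_def)

lemma sdepth_list_merges: "sdepth list_merges = 1"
  by (simp add: program_defs derived_defs)

definition compute_base :: com where
  "compute_base = seqs [Const (tmp 0) 0, Add (tmp 1) ''n'' (tmp 0), Const (tmp 2) 1,
     While (tmp 1) (Seq (Add ''B'' ''B'' ''n'') (Sub (tmp 1) (tmp 1) (tmp 2))),
     Add ''B'' ''B'' ''n'', Add ''B'' ''B'' ''N'']"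

lemma halts_compute_base:
  assumes "r ''B'' = 0"
  shows "\<exists>r'. halts compute_base (r, m) (3 * r ''n'' + 6) (r', m) \<and>
    agree r' (r(''B'' := r ''n'' * r ''n'' + r ''n'' + r ''N''))"
proof -
  let ?body = "Seq (Add ''B'' ''B'' ''n'') (Sub (tmp 1) (tmp 1) (tmp 2))"
  have loop: "\<exists>r'. halts (While (tmp 1) ?body) (r1, m) (3 * j + 1) (r', m) \<and>
      agree r' (r1(''B'' := r1 ''B'' + j * r1 ''n''))"
    if "r1 (tmp 1) = j" "r1 (tmp 2) = 1" for j r1
    using that
  proof (induction j arbitrary: r1)
    case 0
    have "halts (While (tmp 1) ?body) (r1, m) (3 * 0 + 1) (r1, m)"
      using halts_While_False[of "(r1, m)" "tmp 1" ?body] 0 by simp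
    moreover have "agree r1 (r1(''B'' := r1 ''B'' + 0 * r1 ''n''))" by (simp add: agree_def)
    ultimately show ?case by blast
  next
    case (Suc j)
    have r1: "r1 (tmp 1) = Suc j" "r1 (tmp 2) = 1" by fact+
    define r2 where "r2 = r1(''B'' := r1 ''B'' + r1 ''n'')"
    define r3 where "r3 = r2(tmp 1 := r2 (tmp 1) - r2 (tmp 2))"
    have body: "halts ?body (r1, m) (1 + 1) (r3, m)"
      unfolding r3_def r2_def by (intro halts_Seq[OF halts_basic(2)] halts_basic)
    have t: "tmp i \<noteq> ''B''" "tmp i \<noteq> ''n''" for i using usr_neq_tmp(2)[of "''B''" i] usr_neq_tmp(2)[of "''n''" i]
      by (simp_all add: usr_def)
    have "r3 (tmp 1) = j" "r3 (tmp 2) = 1" using r1 t by (simp_all add: r3_def r2_def)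
    from Suc.IH[OF this] obtain r' where r': "halts (While (tmp 1) ?body) (r3, m) (3 * j + 1) (r', m)"
      "agree r' (r3(''B'' := r3 ''B'' + j * r3 ''n''))" by blast
    have "halts (While (tmp 1) ?body) (r1, m) (Suc (1 + 1 + (3 * j + 1))) (r', m)"
      by (rule halts_While_True[OF _ body r'(1)]) (use r1 in simp)
    then have "halts (While (tmp 1) ?body) (r1, m) (3 * Suc j + 1) (r', m)"
      by (rule halts_mono) simp
    moreover have "agree r' (r1(''B'' := r1 ''B'' + Suc j * r1 ''n''))"
      using r'(2) t[of 1, symmetric] by (auto simp: agree_def r3_def r2_def)
    ultimately show ?case by blast
  qed
  have t: "tmp i \<noteq> ''B''" "tmp i \<noteq> ''n''" "tmp i \<noteq> ''N''" for i
    using usr_neq_tmp(2)[of "''B''" i] usr_neq_tmp(2)[of "''n''" i] usr_neq_tmp(2)[of "''N''" i]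
    by (simp_all add: usr_def)
  define r0 where "r0 = r(tmp 0 := 0)"
  define r1 where "r1 = r0(tmp 1 := r0 ''n'' + r0 (tmp 0))"
  define r2 where "r2 = r1(tmp 2 := 1)"
  have "r2 (tmp 1) = r ''n''" "r2 (tmp 2) = 1" using t[of 0, symmetric] by (simp_all add: r2_def r1_def r0_def)
  from loop[OF this] obtain r3 where r3: "halts (While (tmp 1) ?body) (r2, m) (3 * r ''n'' + 1) (r3, m)"
    "agree r3 (r2(''B'' := r2 ''B'' + r ''n'' * r2 ''n''))" by blast
  define r4 where "r4 = r3(''B'' := r3 ''B'' + r3 ''n'')"
  define r5 where "r5 = r4(''B'' := r4 ''B'' + r4 ''N'')"
  have "halts compute_base (r, m) (1 + (1 + (1 + (3 * r ''n'' + 1 + (1 + 1))))) (r5, m)"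
    unfolding compute_base_def seqs.simps r5_def r4_def
    by (rule halts_Seq[OF halts_basic(1)], fold r0_def, rule halts_Seq[OF halts_basic(2)], fold r1_def,
        rule halts_Seq[OF halts_basic(1)], fold r2_def, rule halts_Seq[OF r3(1)],
        rule halts_Seq[OF halts_basic(2)], rule halts_basic)
  then have "halts compute_base (r, m) (3 * r ''n'' + 6) (r5, m)"
    by (rule halts_mono) simp
  moreover have "usr ''n''" "usr ''N''" by (simp_all add: usr_def)
  then have "agree r5 (r(''B'' := r ''n'' * r ''n'' + r ''n'' + r ''N''))"
    using r3(2) assms t[symmetric] unfolding r5_def r4_def r2_def r1_def r0_def by (auto simp: agree_def)
  ultimately show ?thesis by blast
qed

definition main_stm :: stm where
  "main_stm = (prepare ;; list_merges ;; find_width ;; powers1 ;; powers2 ;; powers3 ;; powers4 ;; dynamic_program)"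

definition guarded_stm :: stm where
  "guarded_stm = IfS (EAnd (V ''k'') (ENot (ELt (V ''n'') (V ''k'')))) main_stm (Asg ''out'' (C 0))"

definition program :: com where
  "program = Seq compute_base (cstm guarded_stm 0)"

lemma wfs_guarded: "wfs guarded_stm"
  using wfs_program by (simp add: guarded_stm_def main_stm_def derived_defs usr_def)

definition loop_bound :: "nat \<Rightarrow> nat \<Rightarrow> nat" where
  "loop_bound n W = (n + 1) ^ (4 * 2 ^ (2 * W))"

lemma loop_bound:
  fixes n W :: nat
  assumes "0 < W"
  defines "D \<equiv> 2 ^ (2 * W)"
  defines "M \<equiv> (n + 1) ^ D"
  assumes n: "0 < n"
  shows "1 \<le> loop_bound n W" "n + 1 \<le> loop_bound n W" "2 * W \<le> loop_bound n W" "D \<le> loop_bound n W"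
    "M \<le> loop_bound n W" "M * (M * (M * (n + 1))) \<le> loop_bound n W"
proof -
  have D: "1 \<le> D" "2 * W < D" by (simp_all add: D_def)
  have Z: "loop_bound n W = M * (M * (M * M))"
  proof -
    have "loop_bound n W = M ^ 4"
      unfolding loop_bound_def M_def D_def power_mult[symmetric] by (simp add: mult.commute)
    then show ?thesis by (simp add: power4_eq_xxxx mult.assoc)
  qed
  have M1: "1 \<le> M" "n + 1 \<le> M" using D(1) power_increasing[of 1 D "n + 1"] by (simp_all add: M_def)
  have "D < 2 ^ D" by (rule less_exp)
  also have "\<dots> \<le> M" unfolding M_def using n by (intro power_mono) auto
  finally have DM: "D \<le> M" by simp
  have MZ: "M \<le> loop_bound n W" unfolding Z using M1(1) by simp
  show "1 \<le> loop_bound n W" "n + 1 \<le> loop_bound n W" "2 * W \<le> loop_bound n W" "D \<le> loop_bound n W"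
    "M \<le> loop_bound n W" using M1 D DM MZ by linarith+
  show "M * (M * (M * (n + 1))) \<le> loop_bound n W" unfolding Z using M1(2) by (intro mult_le_mono2)
qed

context decomposition
begin

lemma n_pos: "0 < n"
proof (rule ccontr)
  assume "\<not> 0 < n"
  then have "leaves T = {}" using bij by (simp add: bij_betw_def)
  then have "{} = {..<N}" using leafE bij \<open>\<not> 0 < n\<close> by (intro all_nodes) (auto simp: leaves_def nodes)
  then show False using root_node by auto
qed

lemma n_le_N: "n \<le> N"
proof -
  have "card {..<n} = card (leaves T)" using bij by (rule bij_betw_same_card)
  also have "\<dots> \<le> card (nodes T)" by (rule card_mono) (auto simp: leaves_def nodes)
  finally show ?thesis by (simp add: nodes)
qed

lemma length_merges:
  assumes "valid_merges ms"
  shows "length ms < n"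
proof -
  have "i + card (comps (take i ms) ` {..<n}) \<le> n" if "i \<le> length ms" for i
    using that
  proof (induction i)
    case 0
    then show ?case using card_image_le[of "{..<n}"] by simp
  next
    case (Suc i)
    let ?c = "comps (take i ms)" and ?c' = "comps (take (Suc i) ms)"
    define a c where "a = fst (ms ! i)" and "c = snd (ms ! i)"
    have "a \<noteq> c" "fiber ?c a \<noteq> {}" "fiber ?c c \<noteq> {}"
      using assms Suc.prems by (simp_all add: valid_merges_def a_def c_def)
    then have v: "a \<noteq> c" "a \<in> ?c ` {..<n}" "c \<in> ?c ` {..<n}"
      by (auto simp: fiber_def)
    have "?c' ` {..<n} \<subseteq> ?c ` {..<n} - {c}"
      using v Suc.prems comps_take_Suc[of i ms] by (auto simp: a_def c_def)
    then have "card (?c' ` {..<n}) \<le> card (?c ` {..<n} - {c})" by (intro card_mono) auto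
    also have "\<dots> < card (?c ` {..<n})" using v(3) by (intro psubset_card_mono) auto
    finally show ?case using Suc by simp
  qed
  from this[OF order_refl] have "length ms + card (comps ms ` {..<n}) \<le> n" by simp
  moreover have "0 < card (comps ms ` {..<n})" using n_pos by (auto simp: card_gt_0_iff)
  ultimately show ?thesis by simp
qed

definition input_ok :: "nat \<Rightarrow> (reg \<Rightarrow> nat) \<Rightarrow> arrays \<Rightarrow> bool" where
  "input_ok k r h \<longleftrightarrow> r ''n'' = n \<and> r ''N'' = N \<and> r ''root'' = root T \<and> r ''k'' = k \<and> r ''v'' = 0 \<and> r ''act'' = 0 \<and>
     r ''m'' = 0 \<and> (\<forall>p. h 0 p = 0) \<and> (\<forall>p. h 1 p = 0) \<and> (\<forall>u<n. \<forall>v<n. h 16 (u * n + v) = of_bool (E u v)) \<and>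
     (\<forall>t<N. h 16 (n * n + t) = parent T t) \<and> (\<forall>v<n. h 16 (n * n + (N + v)) = \<delta> v)"

end

lemma stage_costs:
  obtains K d where
    "\<And>\<sigma> Z. 1 \<le> Z \<Longrightarrow> fst \<sigma> ''n'' \<le> Z \<Longrightarrow> scost prepare \<sigma> \<le> K * Z ^ d"
    "\<And>\<sigma> Z. 1 \<le> Z \<Longrightarrow> fst \<sigma> ''N'' \<le> Z \<Longrightarrow> fst \<sigma> ''NN'' \<le> Z \<Longrightarrow> scost list_merges \<sigma> \<le> K * Z"
    "\<And>\<sigma> Z. 1 \<le> Z \<Longrightarrow> fst \<sigma> ''n'' \<le> Z \<Longrightarrow> fst \<sigma> ''m'' \<le> Z \<Longrightarrow> scost find_width \<sigma> \<le> K * Z ^ d"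
    "\<And>\<sigma> Z. 1 \<le> Z \<Longrightarrow> scost powers1 \<sigma> \<le> K * Z ^ d"
    "\<And>\<sigma> Z. 1 \<le> Z \<Longrightarrow> fst \<sigma> ''W2'' \<le> Z \<Longrightarrow> scost powers2 \<sigma> \<le> K * Z ^ d"
    "\<And>\<sigma> Z. 1 \<le> Z \<Longrightarrow> fst \<sigma> ''D'' \<le> Z \<Longrightarrow> fst \<sigma> ''b'' \<le> Z \<Longrightarrow> scost powers3 \<sigma> \<le> K * Z ^ d"
    "\<And>\<sigma> Z. 1 \<le> Z \<Longrightarrow> fst \<sigma> ''M'' \<le> Z \<Longrightarrow> scost powers4 \<sigma> \<le> K * Z ^ d"
    "\<And>\<sigma> Z. 1 \<le> Z \<Longrightarrow> (\<forall>y\<in>{''n'', ''m'', ''k'', ''W2'', ''D'', ''b'', ''M'', ''L''}. fst \<sigma> y \<le> Z) \<Longrightarrow>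
       scost dynamic_program \<sigma> \<le> K * Z ^ d"
proof -
  note bs = sbounded_program[THEN scost_bound]
  obtain K1 where 1: "\<forall>\<sigma> Z. 1 \<le> Z \<longrightarrow> (\<forall>y\<in>{''n''}. fst \<sigma> y \<le> Z) \<longrightarrow> scost prepare \<sigma> \<le> K1 * Z ^ sdepth prepare"
    using bs(1) by (rule exE)
  obtain K2 where 2: "\<forall>\<sigma> Z. 1 \<le> Z \<longrightarrow> (\<forall>y\<in>{''N'', ''NN''}. fst \<sigma> y \<le> Z) \<longrightarrow> scost list_merges \<sigma> \<le> K2 * Z ^ sdepth list_merges"
    using bs(2) by (rule exE)
  obtain K3 where 3: "\<forall>\<sigma> Z. 1 \<le> Z \<longrightarrow> (\<forall>y\<in>{''n'', ''m''}. fst \<sigma> y \<le> Z) \<longrightarrow> scost find_width \<sigma> \<le> K3 * Z ^ sdepth find_width"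
    using bs(3) by (rule exE)
  obtain K4 where 4: "\<forall>\<sigma> Z. 1 \<le> Z \<longrightarrow> (\<forall>y\<in>{}. fst \<sigma> y \<le> Z) \<longrightarrow> scost powers1 \<sigma> \<le> K4 * Z ^ sdepth powers1"
    using bs(4) by (rule exE)
  obtain K5 where 5: "\<forall>\<sigma> Z. 1 \<le> Z \<longrightarrow> (\<forall>y\<in>{''W2''}. fst \<sigma> y \<le> Z) \<longrightarrow> scost powers2 \<sigma> \<le> K5 * Z ^ sdepth powers2"
    using bs(5) by (rule exE)
  obtain K6 where 6: "\<forall>\<sigma> Z. 1 \<le> Z \<longrightarrow> (\<forall>y\<in>{''D'', ''b''}. fst \<sigma> y \<le> Z) \<longrightarrow> scost powers3 \<sigma> \<le> K6 * Z ^ sdepth powers3"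
    using bs(6) by (rule exE)
  obtain K7 where 7: "\<forall>\<sigma> Z. 1 \<le> Z \<longrightarrow> (\<forall>y\<in>{''M''}. fst \<sigma> y \<le> Z) \<longrightarrow> scost powers4 \<sigma> \<le> K7 * Z ^ sdepth powers4"
    using bs(7) by (rule exE)
  obtain K8 where 8: "\<forall>\<sigma> Z. 1 \<le> Z \<longrightarrow> (\<forall>y\<in>{''n'', ''m'', ''k'', ''W2'', ''D'', ''b'', ''M'', ''L''}. fst \<sigma> y \<le> Z) \<longrightarrow>
      scost dynamic_program \<sigma> \<le> K8 * Z ^ sdepth dynamic_program"
    using bs(8) by (rule exE)
  define K where "K = K1 + K2 + K3 + K4 + K5 + K6 + K7 + K8"
  define d where "d = sdepth prepare + sdepth find_width + sdepth powers1 + sdepth powers2 + sdepth powers3 +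
    sdepth powers4 + sdepth dynamic_program"
  have up: "c \<le> K * Z ^ d" if "c \<le> K' * Z ^ d'" "1 \<le> Z" "K' \<le> K" "d' \<le> d" for c K' d' Z
  proof -
    have "c \<le> K' * Z ^ d" using mult_power_mono[OF that(1,2,4)] .
    also have "\<dots> \<le> K * Z ^ d" using that(3) by (rule mult_le_mono1)
    finally show ?thesis .
  qed
  show thesis
  proof (rule that[of K d])
    show "scost prepare \<sigma> \<le> K * Z ^ d" if "1 \<le> Z" "fst \<sigma> ''n'' \<le> Z" for \<sigma> Z
      by (rule up[OF 1[rule_format]]) (use that in \<open>auto simp: K_def d_def\<close>)
    show "scost list_merges \<sigma> \<le> K * Z" if "1 \<le> Z" "fst \<sigma> ''N'' \<le> Z" "fst \<sigma> ''NN'' \<le> Z" for \<sigma> Z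
    proof -
      have "scost list_merges \<sigma> \<le> K2 * Z ^ sdepth list_merges"
        by (rule 2[rule_format]) (use that in auto)
      also have "\<dots> = K2 * Z" by (simp add: sdepth_list_merges)
      also have "\<dots> \<le> K * Z" by (rule mult_le_mono1) (simp add: K_def)
      finally show ?thesis .
    qed
    show "scost find_width \<sigma> \<le> K * Z ^ d" if "1 \<le> Z" "fst \<sigma> ''n'' \<le> Z" "fst \<sigma> ''m'' \<le> Z" for \<sigma> Z
      by (rule up[OF 3[rule_format]]) (use that in \<open>auto simp: K_def d_def\<close>)
    show "scost powers1 \<sigma> \<le> K * Z ^ d" if "1 \<le> Z" for \<sigma> Z
      by (rule up[OF 4[rule_format]]) (use that in \<open>auto simp: K_def d_def\<close>)
    show "scost powers2 \<sigma> \<le> K * Z ^ d" if "1 \<le> Z" "fst \<sigma> ''W2'' \<le> Z" for \<sigma> Z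
      by (rule up[OF 5[rule_format]]) (use that in \<open>auto simp: K_def d_def\<close>)
    show "scost powers3 \<sigma> \<le> K * Z ^ d" if "1 \<le> Z" "fst \<sigma> ''D'' \<le> Z" "fst \<sigma> ''b'' \<le> Z" for \<sigma> Z
      by (rule up[OF 6[rule_format]]) (use that in \<open>auto simp: K_def d_def\<close>)
    show "scost powers4 \<sigma> \<le> K * Z ^ d" if "1 \<le> Z" "fst \<sigma> ''M'' \<le> Z" for \<sigma> Z
      by (rule up[OF 7[rule_format]]) (use that in \<open>auto simp: K_def d_def\<close>)
    show "scost dynamic_program \<sigma> \<le> K * Z ^ d"
      if "1 \<le> Z" "\<forall>y\<in>{''n'', ''m'', ''k'', ''W2'', ''D'', ''b'', ''M'', ''L''}. fst \<sigma> y \<le> Z" for \<sigma> Z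
      by (rule up[OF 8[rule_format]]) (use that in \<open>auto simp: K_def d_def\<close>)
  qed
qed

lemma loop_bound_mono: "W \<le> W' \<Longrightarrow> loop_bound n W \<le> loop_bound n W'"
  unfolding loop_bound_def by (intro power_increasing mult_le_mono2) auto

context decomposition
begin

lemma width_ok_n: "width_ok ms j n"
  unfolding width_ok_def
proof (intro allI impI)
  fix i u assume u: "u < n"
  let ?S = "fiber (comps (take i ms)) (comps (take i ms) u)"
  have "cls ?S u < card (firsts ?S)" using u by (intro cls_less) (auto simp: fiber_def)
  also have "\<dots> \<le> card {..<n}" by (intro card_mono) (auto simp: firsts_def fiber_def)
  finally show "cls ?S u < n" by simp
qed

lemma run_main:
  assumes I: "input_ok k r h" and k: "0 < k" "k \<le> n"
    and cost: "\<And>\<sigma> Z. 1 \<le> Z \<Longrightarrow> fst \<sigma> ''n'' \<le> Z \<Longrightarrow> scost prepare \<sigma> \<le> K * Z ^ d"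
    "\<And>\<sigma> Z. 1 \<le> Z \<Longrightarrow> fst \<sigma> ''N'' \<le> Z \<Longrightarrow> fst \<sigma> ''NN'' \<le> Z \<Longrightarrow> scost list_merges \<sigma> \<le> K * Z"
    "\<And>\<sigma> Z. 1 \<le> Z \<Longrightarrow> fst \<sigma> ''n'' \<le> Z \<Longrightarrow> fst \<sigma> ''m'' \<le> Z \<Longrightarrow> scost find_width \<sigma> \<le> K * Z ^ d"
    "\<And>\<sigma> Z. 1 \<le> Z \<Longrightarrow> scost powers1 \<sigma> \<le> K * Z ^ d"
    "\<And>\<sigma> Z. 1 \<le> Z \<Longrightarrow> fst \<sigma> ''W2'' \<le> Z \<Longrightarrow> scost powers2 \<sigma> \<le> K * Z ^ d"
    "\<And>\<sigma> Z. 1 \<le> Z \<Longrightarrow> fst \<sigma> ''D'' \<le> Z \<Longrightarrow> fst \<sigma> ''b'' \<le> Z \<Longrightarrow> scost powers3 \<sigma> \<le> K * Z ^ d"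
    "\<And>\<sigma> Z. 1 \<le> Z \<Longrightarrow> fst \<sigma> ''M'' \<le> Z \<Longrightarrow> scost powers4 \<sigma> \<le> K * Z ^ d"
    "\<And>\<sigma> Z. 1 \<le> Z \<Longrightarrow> (\<forall>y\<in>{''n'', ''m'', ''k'', ''W2'', ''D'', ''b'', ''M'', ''L''}. fst \<sigma> y \<le> Z) \<Longrightarrow>
       scost dynamic_program \<sigma> \<le> K * Z ^ d"
  shows "fst (run main_stm (r, h)) ''out'' = of_bool (has_fall_coloring G k)"
    "scost main_stm (r, h) \<le> 2 * K * N + 7 * K * loop_bound n (min n (3 * w + 1)) ^ d"
proof -
  define r0 where "r0 = r(''nn'' := n * n, ''NN'' := N + n)"
  have s0: "run prepare (r, h) = (r0, h)"
    using I by (simp add: prepare_def EMul_def r0_def input_ok_def)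
  have "has_tree r0 h" using I by (simp add: has_tree_def r0_def input_ok_def)
  moreover have r0: "r0 ''NN'' = N + n" "r0 ''v'' = 0" "r0 ''act'' = 0" "r0 ''m'' = 0" "r0 ''N'' = N" "r0 ''k'' = k"
    "\<And>p. h 0 p = 0" "\<And>p. h 1 p = 0"
    using I by (simp_all add: r0_def input_ok_def)
  ultimately obtain ms r1 h1 where s1: "run list_merges (r0, h) = (r1, h1)"
    and ms: "has_merges ms r1 h1" "valid_merges ms" "narrow ms" and final: "\<And>u. u < n \<Longrightarrow> comps ms u = comps ms 0"
    and keep: "r1 ''n'' = n" "r1 ''k'' = r0 ''k''" "h1 16 = h 16"
    using run_list_merges[of r0 h] by metis
  have "has_graph r1 h1" using I keep by (simp add: has_graph_def input_ok_def)
  then obtain W r2 h2 where s2: "run find_width (r1, h1) = (r2, h2)" and W: "r2 ''W'' = W" "0 < W" "width_ok ms (length ms) W"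
    "\<And>B. 0 < B \<Longrightarrow> width_ok ms (length ms) B \<Longrightarrow> W \<le> B"
    and r2: "has_graph r2 h2" "has_merges ms r2 h2" "r2 ''k'' = r1 ''k''"
    using run_find_width[OF _ ms(1)] by metis
  have n2: "r2 ''n'' = n" "r2 ''m'' = length ms" "r2 ''k'' = k"
    using r2 keep r0 by (auto simp: has_graph_def has_merges_def)
  have W_le: "W \<le> min n (3 * w + 1)"
    using W(4)[OF n_pos width_ok_n] W(4)[OF _ narrow_width_ok[OF ms(3)]] by simp
  define D where "D = (2::nat) ^ (2 * W)"
  define M where "M = (n + 1) ^ D"
  define r3 where "r3 = r2(''W2'' := 2 * W, ''g'' := 1, ''b'' := n + 1)"
  have s3: "run powers1 (r2, h2) = (r3, h2)"
    using n2 W(1) by (simp add: run_powers1 r3_def)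
  have "r3 ''g'' = 1" by (simp add: r3_def)
  from run_powers2[where r = r3 and h = h2, OF this] obtain f where s4': "run powers2 (r3, h2) = (r3(''D'' := 2 ^ r3 ''W2'', ''g'' := 1), h2(8 := f))"
    "\<And>i. i < r3 ''W2'' \<Longrightarrow> f i = 2 ^ i" by blast
  define r4 where "r4 = r3(''D'' := D, ''g'' := 1)"
  have s4: "run powers2 (r3, h2) = (r4, h2(8 := f))" "\<And>i. i < 2 * W \<Longrightarrow> f i = 2 ^ i"
    using s4' by (simp_all add: r4_def r3_def D_def)
  have "r4 ''g'' = 1" by (simp add: r4_def)
  from run_powers3[where r = r4 and h = "h2(8 := f)", OF this] obtain g x where s5': "run powers3 (r4, h2(8 := f)) =
      (r4(''g'' := x, ''M'' := r4 ''b'' ^ r4 ''D''), h2(8 := f, 9 := g))" "\<And>i. i < r4 ''D'' \<Longrightarrow> g i = r4 ''b'' ^ i" by blast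
  define r5 where "r5 = r4(''g'' := x, ''M'' := M)"
  have s5: "run powers3 (r4, h2(8 := f)) = (r5, h2(8 := f, 9 := g))" "\<And>i. i < D \<Longrightarrow> g i = (n + 1) ^ i"
    using s5' by (simp_all add: r5_def r4_def r3_def M_def)
  define h5 where "h5 = h2(8 := f, 9 := g)"
  define r6 where "r6 = r5(''L'' := M * (M * (M * (n + 1))))"
  have s6: "run powers4 (r5, h5) = (r6, h5)"
    by (simp add: run_powers4 r6_def r5_def r4_def r3_def)
  have E: "env k W r6 h5"
    unfolding env_def
    using r2(1) n2 W(1) s4(2) s5(2) by (simp add: r6_def r5_def r4_def r3_def h5_def M_def D_def)
  have m6: "has_merges ms r6 h5" using r2(2) by (simp add: r6_def r5_def r4_def r3_def h5_def)
  have run: "run main_stm (r, h) = run dynamic_program (r6, h5)"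
    by (simp add: main_stm_def s0 s1 s2 s3 s4(1) s5(1) s6 flip: h5_def)
  show "fst (run main_stm (r, h)) ''out'' = of_bool (has_fall_coloring G k)"
    unfolding run using run_dynamic_program[OF E m6 ms(2) W(3,2) k(1) _ n_pos final] k fall_coloring_iff[OF n_pos]
    by simp
  define Z where "Z = loop_bound n W"
  note Z = loop_bound[OF W(2) n_pos, folded D_def, folded M_def, folded Z_def]
  have len: "length ms \<le> Z" using length_merges[OF ms(2)] Z(2) by simp
  have k_Z: "k \<le> Z" "n \<le> Z" using k Z(2) by simp_all
  have c0: "scost prepare (r, h) \<le> K * Z ^ d" using I k_Z by (intro cost(1) Z(1)) (simp add: input_ok_def)
  have c1: "scost list_merges (r0, h) \<le> K * (N + n)" using r0 n_pos by (intro cost(2)) simp_all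
  have c2: "scost find_width (r1, h1) \<le> K * Z ^ d"
    using keep ms(1) k_Z len by (intro cost(3) Z(1)) (simp_all add: has_merges_def)
  have c3: "scost powers1 (r2, h2) \<le> K * Z ^ d" by (intro cost(4) Z(1))
  have c4: "scost powers2 (r3, h2) \<le> K * Z ^ d" using Z by (intro cost(5)) (simp_all add: r3_def)
  have c5: "scost powers3 (r4, h2(8 := f)) \<le> K * Z ^ d" using Z by (intro cost(6)) (simp_all add: r4_def r3_def)
  have c6: "scost powers4 (r5, h5) \<le> K * Z ^ d" using Z by (intro cost(7)) (simp_all add: r5_def)
  have c7: "scost dynamic_program (r6, h5) \<le> K * Z ^ d"
    using Z k_Z len n2 by (intro cost(8)) (simp_all add: r6_def r5_def r4_def r3_def)
  have "scost main_stm (r, h) = scost prepare (r, h) + scost list_merges (r0, h) + scost find_width (r1, h1) +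
      scost powers1 (r2, h2) + scost powers2 (r3, h2) + scost powers3 (r4, h2(8 := f)) + scost powers4 (r5, h5) +
      scost dynamic_program (r6, h5)"
    by (simp add: main_stm_def s0 s1 s2 s3 s4(1) s5(1) s6 flip: h5_def)
  also have "\<dots> \<le> K * (N + n) + 7 * (K * Z ^ d)"
    using c0 c1 c2 c3 c4 c5 c6 c7 by linarith
  also have "K * (N + n) \<le> K * (2 * N)" using n_le_N by (intro mult_le_mono2) simp
  also have "K * Z ^ d \<le> K * loop_bound n (min n (3 * w + 1)) ^ d"
    unfolding Z_def using W_le by (intro mult_le_mono2 power_mono loop_bound_mono) auto
  finally show "scost main_stm (r, h) \<le> 2 * K * N + 7 * K * loop_bound n (min n (3 * w + 1)) ^ d"
    by (simp add: mult.assoc mult.left_commute)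
qed

lemma loop_bound_power_le:
  "loop_bound n (min n (3 * w + 1)) ^ d \<le> 2 ^ (16 * d) * n ^ 2 ^ (6 * w + (d + 5))"
proof (cases "n = 1")
  case True
  then have "min n (3 * w + 1) = 1" by simp
  then have "loop_bound n (min n (3 * w + 1)) = 2 ^ 16"
    using True by (simp add: loop_bound_def flip: numeral_2_eq_2)
  then have "loop_bound n (min n (3 * w + 1)) ^ d = 2 ^ (16 * d)" by (simp only: power_mult)
  then show ?thesis using True by simp
next
  case False
  then have n: "2 \<le> n" using n_pos by simp
  have "n + 1 \<le> n ^ 2"
  proof -
    have "n + 1 \<le> 2 * n" using n by simp
    also have "\<dots> \<le> n * n" using n by (rule mult_le_mono1)
    finally show ?thesis by (simp add: power2_eq_square)
  qed
  have "loop_bound n (min n (3 * w + 1)) ^ d \<le> loop_bound n (3 * w + 1) ^ d"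
    by (intro power_mono loop_bound_mono) auto
  also have "\<dots> = (n + 1) ^ (4 * 2 ^ (2 * (3 * w + 1)) * d)"
    unfolding loop_bound_def by (rule power_mult[symmetric])
  also have "4 * 2 ^ (2 * (3 * w + 1)) * d = 2 ^ (6 * w + 4) * d"
    by (simp add: power_add)
  also have "(n + 1) ^ (2 ^ (6 * w + 4) * d) \<le> (n ^ 2) ^ (2 ^ (6 * w + 4) * d)"
    using \<open>n + 1 \<le> n ^ 2\<close> by (intro power_mono) auto
  also have "\<dots> = n ^ (2 * (2 ^ (6 * w + 4) * d))" by (rule power_mult[symmetric])
  also have "\<dots> \<le> n ^ 2 ^ (6 * w + (d + 5))"
  proof (intro power_increasing)
    have "2 * (2 ^ (6 * w + 4) * d) \<le> 2 * (2 ^ (6 * w + 4) * 2 ^ d)"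
      using less_exp[of d] by (intro mult_le_mono2) simp
    also have "\<dots> = 2 ^ (6 * w + (d + 5))" by (simp add: power_add)
    finally show "2 * (2 ^ (6 * w + 4) * d) \<le> 2 ^ (6 * w + (d + 5))" .
  qed (use n in simp)
  also have "\<dots> \<le> 2 ^ (16 * d) * n ^ 2 ^ (6 * w + (d + 5))" by simp
  finally show ?thesis .
qed

end

lemma linear_bigo: "(\<lambda>w. real (6 * w + c)) \<in> O(\<lambda>w. real w)"
proof (rule bigoI)
  show "\<forall>\<^sub>F w in at_top. norm (real (6 * w + c)) \<le> real (6 + c) * norm (real w)"
    using eventually_ge_at_top[of 1]
  proof eventually_elim
    case (elim w)
    then have "c * 1 \<le> c * w" by (intro mult_le_mono2)
    then have "6 * w + c \<le> (6 + c) * w" by (simp add: algebra_simps)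
    then have "real (6 * w + c) \<le> real ((6 + c) * w)" by (rule of_nat_mono)
    then show ?case by simp
  qed
qed

theorem mainTheorem2:
  "\<exists>(P :: com) (f :: nat \<Rightarrow> nat) (c :: nat).
     (\<lambda>w. real (f w)) \<in> O(\<lambda>w. real w) \<and>
     (\<forall>(G :: nat graph) (T :: nat rtree) (\<delta> :: nat \<Rightarrow> nat) (k :: nat) (n :: nat) (N :: nat) (w :: nat).
        simple_graph G \<and> verts G = {..<n} \<and> nodes T = {..<N} \<and>
        rooted_branch_decomposition G T \<delta> \<and> module_width G T \<delta> = w \<longrightarrow>
        (\<exists>t s. exec P (input_state G T \<delta> k) t s \<and>
               ram_output s = (if has_fall_coloring G k then 1 else 0) \<and>
               t \<le> c * (N + n ^ (2 ^ f w))))"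
proof (rule stage_costs)
  fix K d
  assume cost: "\<And>\<sigma> Z. 1 \<le> Z \<Longrightarrow> fst \<sigma> ''n'' \<le> Z \<Longrightarrow> scost prepare \<sigma> \<le> K * Z ^ d"
    "\<And>\<sigma> Z. 1 \<le> Z \<Longrightarrow> fst \<sigma> ''N'' \<le> Z \<Longrightarrow> fst \<sigma> ''NN'' \<le> Z \<Longrightarrow> scost list_merges \<sigma> \<le> K * Z"
    "\<And>\<sigma> Z. 1 \<le> Z \<Longrightarrow> fst \<sigma> ''n'' \<le> Z \<Longrightarrow> fst \<sigma> ''m'' \<le> Z \<Longrightarrow> scost find_width \<sigma> \<le> K * Z ^ d"
    "\<And>\<sigma> Z. 1 \<le> Z \<Longrightarrow> scost powers1 \<sigma> \<le> K * Z ^ d"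
    "\<And>\<sigma> Z. 1 \<le> Z \<Longrightarrow> fst \<sigma> ''W2'' \<le> Z \<Longrightarrow> scost powers2 \<sigma> \<le> K * Z ^ d"
    "\<And>\<sigma> Z. 1 \<le> Z \<Longrightarrow> fst \<sigma> ''D'' \<le> Z \<Longrightarrow> fst \<sigma> ''b'' \<le> Z \<Longrightarrow> scost powers3 \<sigma> \<le> K * Z ^ d"
    "\<And>\<sigma> Z. 1 \<le> Z \<Longrightarrow> fst \<sigma> ''M'' \<le> Z \<Longrightarrow> scost powers4 \<sigma> \<le> K * Z ^ d"
    "\<And>\<sigma> Z. 1 \<le> Z \<Longrightarrow> (\<forall>y\<in>{''n'', ''m'', ''k'', ''W2'', ''D'', ''b'', ''M'', ''L''}. fst \<sigma> y \<le> Z) \<Longrightarrow>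
       scost dynamic_program \<sigma> \<le> K * Z ^ d"
  define c where "c = 40 + 2 * K + 7 * K * 2 ^ (16 * d)"
  show ?thesis
  proof (rule exI[of _ program], rule exI[of _ "\<lambda>w. 6 * w + (d + 5)"], rule exI[of _ c],
      intro conjI linear_bigo allI impI)
    fix G :: "nat graph" and T :: "nat rtree" and \<delta> :: "nat \<Rightarrow> nat" and k n N w :: nat
    assume "simple_graph G \<and> verts G = {..<n} \<and> nodes T = {..<N} \<and>
        rooted_branch_decomposition G T \<delta> \<and> module_width G T \<delta> = w"
    then interpret decomposition G T \<delta> n N w by unfold_locales auto
    define r where "r = fst (input_state G T \<delta> k)"
    define m where "m = input_mem G T \<delta>"
    define B where "B = n * n + n + N"
    define h where "h j i = (if j = 16 \<and> i < B then m i else 0)" for j i :: nat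
    have cards: "card (verts G) = n" "card (nodes T) = N" by (simp_all add: verts nodes)
    have r: "r x = ((\<lambda>_. 0)(''n'' := n, ''N'' := N, ''root'' := root T, ''k'' := k)) x" for x
      by (simp add: r_def input_state_def cards)
    have m_beyond: "m (B + i) = 0" for i
      by (simp add: m_def input_mem_def cards B_def Let_def)
    have st: "stores B m h"
      unfolding stores_def using m_beyond[of "16 * _ + _"] by (auto simp: h_def add.assoc)
    obtain r1 where r1: "halts compute_base (r, m) (3 * n + 6) (r1, m)" "agree r1 (r(''B'' := B))"
      using halts_compute_base[of r m] by (auto simp: r B_def)
    let ?\<sigma> = "(r(''B'' := B), h)"
    have "fst ?\<sigma> ''B'' = B" "agree r1 (fst ?\<sigma>)" "stores B m (snd ?\<sigma>)" using r1(2) st by simp_all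
    from cstm_halts[OF wfs_guarded this(2,1,3), of 0] obtain r2 m2 where
      r2: "halts (cstm guarded_stm 0) (r1, m) (scost guarded_stm ?\<sigma>) (r2, m2)" "agree r2 (fst (run guarded_stm ?\<sigma>))"
      by blast
    have out: "r2 ''out'' = fst (run guarded_stm ?\<sigma>) ''out''"
      using r2(2) by (rule agreeD) (simp add: usr_def)
    have ok: "input_ok k (r(''B'' := B)) h"
    proof -
      have adj: "h 16 (u * n + v) = of_bool (E u v)" if "u < n" "v < n" for u v
      proof -
        have "u * n + v < Suc u * n" using that by simp
        also have "\<dots> \<le> n * n" using that by (intro mult_le_mono1) simp
        finally have "u * n + v < n * n" .
        then show ?thesis using that by (simp add: h_def m_def input_mem_def cards B_def E_def)
      qed
      have par: "h 16 (n * n + t) = parent T t" if "t < N" for t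
        using that by (simp add: h_def m_def input_mem_def cards B_def)
      have leafs: "h 16 (n * n + (N + v)) = \<delta> v" if "v < n" for v
        using that by (simp add: h_def m_def input_mem_def cards B_def)
      show ?thesis unfolding input_ok_def using adj par leafs by (simp add: r h_def)
    qed
    let ?Y = "n ^ 2 ^ (6 * w + (d + 5))"
    have res: "fst (run guarded_stm ?\<sigma>) ''out'' = (if has_fall_coloring G k then 1 else 0) \<and>
        scost guarded_stm ?\<sigma> \<le> 30 + (2 * K * N + 7 * K * (2 ^ (16 * d) * ?Y))"
    proof (cases "0 < k \<and> k \<le> n")
      case True
      then have holds: "holds (EAnd (V ''k'') (ENot (ELt (V ''n'') (V ''k'')))) (fst ?\<sigma>) (snd ?\<sigma>)"
        by (simp add: r)
      then have run: "run guarded_stm ?\<sigma> = run main_stm ?\<sigma>"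
        "scost guarded_stm ?\<sigma> = ecost (EAnd (V ''k'') (ENot (ELt (V ''n'') (V ''k'')))) (fst ?\<sigma>) (snd ?\<sigma>) + 1 + scost main_stm ?\<sigma>"
        unfolding guarded_stm_def by (simp_all add: holds_def)
      have "ecost (EAnd (V ''k'') (ENot (ELt (V ''n'') (V ''k'')))) (fst ?\<sigma>) (snd ?\<sigma>) + 1 \<le> 30"
        by (simp add: derived_defs)
      moreover have "scost main_stm ?\<sigma> \<le> 2 * K * N + 7 * K * loop_bound n (min n (3 * w + 1)) ^ d"
        using True by (intro run_main(2)[OF ok]) (use cost in blast)+
      moreover have "7 * K * loop_bound n (min n (3 * w + 1)) ^ d \<le> 7 * K * (2 ^ (16 * d) * ?Y)"
        by (intro mult_le_mono2 loop_bound_power_le)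
      moreover have "fst (run main_stm ?\<sigma>) ''out'' = of_bool (has_fall_coloring G k)"
        using True by (intro run_main(1)[OF ok]) (use cost in blast)+
      ultimately show ?thesis unfolding run by (intro conjI) (simp, linarith)
    next
      case False
      then have "\<not> holds (EAnd (V ''k'') (ENot (ELt (V ''n'') (V ''k'')))) (fst ?\<sigma>) (snd ?\<sigma>)"
        by (auto simp: r)
      then have run: "run guarded_stm ?\<sigma> = run (Asg ''out'' (C 0)) ?\<sigma>"
        "scost guarded_stm ?\<sigma> = ecost (EAnd (V ''k'') (ENot (ELt (V ''n'') (V ''k'')))) (fst ?\<sigma>) (snd ?\<sigma>) + 1 + 3"
        unfolding guarded_stm_def by (simp_all add: holds_def)
      have "ecost (EAnd (V ''k'') (ENot (ELt (V ''n'') (V ''k'')))) (fst ?\<sigma>) (snd ?\<sigma>) + 1 + 3 \<le> 30"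
        by (simp add: derived_defs)
      moreover have "\<not> has_fall_coloring G k" using False fall_coloring_iff[OF n_pos] by blast
      ultimately show ?thesis unfolding run by simp
    qed
    have "halts program (r, m) (3 * n + 6 + scost guarded_stm ?\<sigma>) (r2, m2)"
      unfolding program_def by (rule halts_Seq[OF r1(1) r2(1)])
    moreover have "3 * n + 6 + scost guarded_stm ?\<sigma> \<le> c * (N + ?Y)"
    proof -
      have "1 \<le> N" "1 \<le> ?Y" using n_le_N n_pos by simp_all
      have "3 * n + 6 + scost guarded_stm ?\<sigma> \<le> 3 * N + 36 * N + (2 * K * N + 7 * K * (2 ^ (16 * d) * ?Y))"
        using res n_le_N \<open>1 \<le> N\<close> by linarith
      also have "\<dots> \<le> (40 + 2 * K) * N + 7 * K * 2 ^ (16 * d) * ?Y"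
        by (simp add: algebra_simps)
      also have "\<dots> \<le> c * N + c * ?Y"
        by (rule add_mono; rule mult_le_mono1; simp add: c_def)
      finally show ?thesis by (simp add: algebra_simps)
    qed
    ultimately have "halts program (r, m) (c * (N + ?Y)) (r2, m2)" by (rule halts_mono)
    moreover have "input_state G T \<delta> k = (r, m)" by (simp add: r_def m_def input_state_def)
    ultimately obtain t where t: "exec program (input_state G T \<delta> k) t (r2, m2)" "t \<le> c * (N + ?Y)"
      by (auto simp: halts_def)
    show "\<exists>t s. exec program (input_state G T \<delta> k) t s \<and>
        ram_output s = (if has_fall_coloring G k then 1 else 0) \<and> t \<le> c * (N + ?Y)"
      using t out res by (intro exI[of _ t] exI[of _ "(r2, m2)"]) (simp add: ram_output_def)
  qed
qed

end
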